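(* Let $A\in\mathbb{R}^{n\times n}$, $q\in\mathbb{R}^n$. For $y^{(0)}=(x^{(0)},z_1^{(0)},z_2^{(0)})\in\mathcal{F}_1$, the homotopy equation $H(y,y^{(0)},\lambda)=0$ determines a bounded smooth curve $\Gamma_y^{(0)}\subset\mathcal{F}_1\times(0,1]$ which starts from $(y^{(0)},1)$ and approaches the hyperplane $\lambda=0$. As $\lambda\to0$, the limit set $L\times\{0\}\subset\bar{\mathcal{F}}_1\times\{0\}$ of $\Gamma_y^{(0)}$ is nonempty, and every point $(x,z_1,z_2)\in L$ is a solution of the system $$(A+A^t)x+q-z_1-A^tz_2=0,\qquad Z_1x=0,\qquad Z_2(Ax+q)=0,$$ where $Z_1=\mathrm{diag}(z_1)$ and $Z_2=\mathrm{diag}(z_2)$.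
   Context: Let $\mathcal{F}=\{x\in\mathbb{R}^n : x>0,\ Ax+q>0\}$, $\bar{\mathcal{F}}=\{x\in\mathbb{R}^n : x\ge0,\ Ax+q\ge0\}$ (componentwise inequalities), $\mathcal{F}_1=\mathcal{F}\times\mathbb{R}^n_{++}\times\mathbb{R}^n_{++}$ and $\bar{\mathcal{F}}_1=\bar{\mathcal{F}}\times\mathbb{R}^n_{+}\times\mathbb{R}^n_{+}$, where $\mathbb{R}^n_{++}$ and $\mathbb{R}^n_+$ are the positive and nonnegative orthants. $A^t$ denotes the transpose of $A$. For $y=(x,z_1,z_2)\in\mathbb{R}^n\times\mathbb{R}^n\times\mathbb{R}^n$, $y^{(0)}\in\mathcal{F}_1$ and $\lambda\in(0,1]$, the homotopy function is $$H(y,y^{(0)},\lambda)=\begin{bmatrix}(1-\lambda)[(A+A^t)x+q-z_1-A^tz_2]+\lambda(x-x^{(0)})\\ Z_1x-\lambda Z_1^{(0)}x^{(0)}\\ Z_2(Ax+q)-\lambda Z_2^{(0)}(Ax^{(0)}+q)\end{bmatrix},$$ where $Z_i=\mathrm{diag}(z_i)$ and $Z_i^{(0)}=\mathrm{diag}(z_i^{(0)})$ for $i=1,2$. The curve $\Gamma_y^{(0)}$ is the curve starting from $(y^{(0)},1)$ (the connected component containing $(y^{(0)},1)$) in the zero set $\{(y,\lambda)\in\mathcal{F}_1\times(0,1] : H(y,y^{(0)},\lambda)=0\}$. The limit set $L$ is the set of all $\bar y$ such that there are points $(y^k,\lambda^k)\in\Gamma_y^{(0)}$ with $\lambda^k\to0$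 and $y^k\to\bar y$.
   Formalization: Smoothness of the curve fails for some starting points (n=1, A=-1, q=1, x0=1/2, both z0=1/4: branches cross); it is claimed when 0 is a regular value of H(.,y0,.), which is shown for almost every y0 in F_1. All other claims hold for every y0. *)

theory Defs
  imports "HOL-Analysis.Analysis"
begin

text \<open>
  A point \<open>y = (x, z\<^sub>1, z\<^sub>2)\<close> is a nested pair; points of the curve are pairs
  \<open>(y, \<mu>)\<close> with \<open>\<mu>\<close> the homotopy parameter.
\<close>

type_synonym 'n triple = "(real^'n) \<times> (real^'n) \<times> (real^'n)"

definition feas_int :: "real^'n^'n \<Rightarrow> real^'n \<Rightarrow> (real^'n) set" where
  "feas_int A q = {x. (\<forall>i. x $ i > 0) \<and> (\<forall>i. (A *v x + q) $ i > 0)}"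

definition feas_cl :: "real^'n^'n \<Rightarrow> real^'n \<Rightarrow> (real^'n) set" where
  "feas_cl A q = {x. (\<forall>i. x $ i \<ge> 0) \<and> (\<forall>i. (A *v x + q) $ i \<ge> 0)}"

definition feas1_int :: "real^'n^'n \<Rightarrow> real^'n \<Rightarrow> 'n triple set" where
  "feas1_int A q = feas_int A q \<times> {z. \<forall>i. z $ i > 0} \<times> {z. \<forall>i. z $ i > 0}"

definition feas1_cl :: "real^'n^'n \<Rightarrow> real^'n \<Rightarrow> 'n triple set" where
  "feas1_cl A q = feas_cl A q \<times> {z. \<forall>i. z $ i \<ge> 0} \<times> {z. \<forall>i. z $ i \<ge> 0}"

definition diag :: "real^'n \<Rightarrow> real^'n^'n" where
  "diag z = (\<chi> i j. if i = j then z $ i else 0)"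

fun homotopy_fun ::
  "real^'n^'n \<Rightarrow> real^'n \<Rightarrow> 'n triple \<Rightarrow> 'n triple \<Rightarrow> real \<Rightarrow> 'n triple" where
  "homotopy_fun A q (x, z1, z2) (x0, z10, z20) \<mu> =
     ((1 - \<mu>) *\<^sub>R ((A + transpose A) *v x + q - z1 - transpose A *v z2) + \<mu> *\<^sub>R (x - x0),
      diag z1 *v x - \<mu> *\<^sub>R (diag z10 *v x0),
      diag z2 *v (A *v x + q) - \<mu> *\<^sub>R (diag z20 *v (A *v x0 + q)))"

definition zero_set :: "real^'n^'n \<Rightarrow> real^'n \<Rightarrow> 'n triple \<Rightarrow> ('n triple \<times> real) set" where
  "zero_set A q y0 =
     {(y, \<mu>). y \<in> feas1_int A q \<and> 0 < \<mu> \<and> \<mu> \<le> 1 \<and> homotopy_fun A q y y0 \<mu> = 0}"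

definition homotopy_curve ::
  "real^'n^'n \<Rightarrow> real^'n \<Rightarrow> 'n triple \<Rightarrow> ('n triple \<times> real) set" where
  "homotopy_curve A q y0 = connected_component_set (zero_set A q y0) (y0, 1)"

definition limit_set :: "real^'n^'n \<Rightarrow> real^'n \<Rightarrow> 'n triple \<Rightarrow> 'n triple set" where
  "limit_set A q y0 =
     {ybar. \<exists>y l. (\<forall>k::nat. (y k, l k) \<in> homotopy_curve A q y0) \<and>
                  l \<longlonglongrightarrow> 0 \<and> y \<longlonglongrightarrow> ybar}"

text \<open>
  The value \<open>c\<close> is regular for \<open>f\<close> on \<open>S\<close>. The set \<open>S\<close> below contains boundary points (those with
  \<open>\<mu> = 1\<close>); there the derivative is that of the polynomial \<open>f\<close> on the whole space.
\<close>

definition regular_value_on ::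
  "('a::real_normed_vector \<Rightarrow> 'b::real_normed_vector) \<Rightarrow> 'a set \<Rightarrow> 'b \<Rightarrow> bool" where
  "regular_value_on f S c \<longleftrightarrow>
     (\<forall>p\<in>S. f p = c \<longrightarrow> (\<exists>D. (f has_derivative D) (at p) \<and> surj D))"

text \<open>
  At exceptional starting points the homotopy curve can branch, so it is a smooth curve only for
  starting points at which zero is a regular value. Example with n = 1: A = (-1), q = 1,
  y0 = (1/2, 1/4, 1/4), with a pitchfork at \<open>x = 1/2\<close>, \<open>\<mu> = 2 - sqrt 2\<close>.
\<close>

definition regular_start :: "real^'n^'n \<Rightarrow> real^'n \<Rightarrow> 'n triple \<Rightarrow> bool" where
  "regular_start A q y0 \<longleftrightarrow>
     regular_value_on (\<lambda>p. homotopy_fun A q (fst p) y0 (snd p)) (feas1_int A q \<times> {0<..1}) 0"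

text \<open>
  Infinitely differentiable on an interval \<open>S\<close>, one-sidedly at endpoints in \<open>S\<close>:
  \<open>D k\<close> is the \<open>k\<close>-th derivative.
\<close>

definition smooth_on_interval :: "real set \<Rightarrow> (real \<Rightarrow> 'a::real_normed_vector) \<Rightarrow> bool" where
  "smooth_on_interval S g \<longleftrightarrow>
     (\<exists>D. (\<forall>t\<in>S. D 0 t = g t) \<and>
          (\<forall>k::nat. \<forall>t\<in>S. (D k has_vector_derivative D (Suc k) t) (at t within S)))"

text \<open>
  \<open>g\<close> exhibits \<open>C\<close> as a smooth curve starting from \<open>p\<close>: it is a smooth embedding with
  nowhere vanishing velocity of the half-open interval onto \<open>C\<close>.
\<close>

definition smooth_curve_param ::
  "'a::real_normed_vector set \<Rightarrow> 'a \<Rightarrow> (real \<Rightarrow> 'a) \<Rightarrow> bool" where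
  "smooth_curve_param C p g \<longleftrightarrow>
     g 0 = p \<and> smooth_on_interval {0..<1} g \<and>
     (\<forall>t\<in>{0..<1}. vector_derivative g (at t within {0..<1}) \<noteq> 0) \<and>
     (\<exists>h. homeomorphism {0..<1} C g h)"

end

theory Submission
  imports Defs
begin

text \<open>
  Write \<open>w = A x + q\<close> for the slack. A zero of the homotopy satisfies \<open>z\<^sub>1\<^sub>i x\<^sub>i = \<mu> c\<^sub>i\<close> and
  \<open>z\<^sub>2\<^sub>i w\<^sub>i = \<mu> d\<^sub>i\<close> with positive constants \<open>c\<close> and \<open>d\<close> given by the starting point. So zeros whose parameter \<open>\<mu>\<close>
  stays away from 0 cannot approach the boundary of the feasible set, and limits of zeros as \<open>\<mu>\<close> tends to
  0 solve the system by continuity. What remains are boundedness and the existence and shape of the curve.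

  \<^bold>\<open>Boundedness.\<close> Let \<open>l\<close> be a limit direction of zeros with \<open>norm x\<close> tending to infinity. Then \<open>l\<close> and \<open>A l\<close> are
  nonnegative. In the first block paired with \<open>l\<close>, namely
  \<open>(1 - \<mu>) (l \<bullet> w + A l \<bullet> x - l \<bullet> z\<^sub>1 - A l \<bullet> z\<^sub>2) + \<mu> (l \<bullet> (x - x\<^sub>0)) = 0\<close>, only the multiplier terms can be negative,
  and they are of order \<open>\<mu>\<close>. So \<open>l \<bullet> x\<close> stays bounded, a contradiction (\<open>primal_component_bounded\<close>). Pairing the
  first block with \<open>x - x\<^sub>0\<close> then bounds the multipliers (\<open>multiplier_bound\<close>).

  \<^bold>\<open>Regular starting points.\<close> The homotopy is a polynomial map from dimension \<open>3 n + 1\<close> to dimension \<open>3 n\<close>. The maximal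
  minors of its derivative form a polynomial vector field that spans the kernel at regular zeros
  (\<open>polynomial_kernel_field\<close>). Multiplied by \<open>\<mu>\<close> and cut off outside a large ball, it has a complete flow, which preserves
  the value of the homotopy and the positivity of \<open>\<mu>\<close>, \<open>x\<close>, \<open>w\<close>, \<open>z\<^sub>1\<close>, \<open>z\<^sub>2\<close>. The start is the only zero with
  \<open>\<mu> = 1\<close>, and the parameter decreases there; so the trajectory of the start never returns to that level and is
  injective. By a flow box argument it is open and closed in its component, hence is the whole
  curve; and since the zeros with \<open>\<mu> \<ge> \<epsilon>\<close> form a compact set, which an injective trajectory must leave
  for good, \<open>\<mu>\<close> tends to 0 along it. It is smooth as an integral curve of a polynomial field.

  \<^bold>\<open>Almost all starting points are regular.\<close> The homotopy is \<open>\<mu> (\<Psi>(y, 1/\<mu>) - \<Psi>(y\<^sub>0, 1))\<close> for one polynomial map \<open>\<Psi>\<close>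
  (\<open>homotopy_fun_eq_scaled\<close>), so exceptional starts come from critical values of \<open>\<Psi>\<close>. Its critical points lie in
  the zero set of a determinant that, for each \<open>y\<close>, is a polynomial in the last variable, nonzero at 1; they form a
  null set. For a null set of critical points Sard's theorem with a drop of one dimension follows from second
  order Taylor estimates (\<open>negligible_critical_values_one_more_dimension\<close>).

  \<^bold>\<open>Arbitrary starting points.\<close> The curve may branch, but it still reaches every neighbourhood of \<open>\<mu> = 0\<close>:
  otherwise it would be a compact component, isolated by a compact relatively open part of the zero
  set, and curves of regular starts nearby, which leave every such neighbourhood, would accumulate at a zero
  outside it (\<open>curve_reaches_small_parameter\<close>).
\<close>

section \<open>Polynomial maps and their derivatives\<close>

lemma real_polynomial_function_det:
  fixes M :: "'a::real_normed_vector \<Rightarrow> real^'m^'m"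
  assumes "\<And>i j. real_polynomial_function (\<lambda>x. M x $ i $ j)"
  shows "real_polynomial_function (\<lambda>x. det (M x))"
  unfolding det_def
  by (intro real_polynomial_function_sum real_polynomial_function.intros(4)
      real_polynomial_function_prod finite assms real_polynomial_function.intros(2))

lemma real_polynomial_function_finite_roots:
  fixes g :: "real \<Rightarrow> real"
  assumes "real_polynomial_function g" "g t0 \<noteq> 0"
  shows "finite {t. g t = 0}"
proof -
  obtain a n where g: "g = (\<lambda>x. \<Sum>i\<le>n. a i * x ^ i)"
    using assms(1) real_polynomial_function_iff_sum by blast
  have "\<exists>i. i \<le> n \<and> a i \<noteq> 0"
    using assms(2) unfolding g by (metis (no_types, lifting) atMost_iff mult_eq_0_iff sum.not_neutral_contains_not_neutral)
  then show ?thesis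
    unfolding g using polyfun_finite_roots[of a n] by blast
qed

lemma real_polynomial_function_inner_right:
  assumes "polynomial_function f"
  shows "real_polynomial_function (\<lambda>x. f x \<bullet> b)"
  using assms bounded_linear_inner_left[of b] unfolding polynomial_function_def o_def by blast

lemma real_polynomial_function_has_derivative:
  fixes g :: "'a::real_normed_vector \<Rightarrow> real"
  assumes "real_polynomial_function g"
  obtains g' where "\<And>p. (g has_derivative g' p) (at p)"
    "\<And>v. real_polynomial_function (\<lambda>p. g' p v)"
proof -
  have "\<exists>g'. (\<forall>p. (g has_derivative g' p) (at p)) \<and> (\<forall>v. real_polynomial_function (\<lambda>p. g' p v))"
    using assms
  proof (induction g rule: real_polynomial_function.induct)
    case (linear f)
    then show ?case
      by (intro exI[of _ "\<lambda>p. f"]) (auto intro: bounded_linear_imp_has_derivative)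
  next
    case (const c)
    then show ?case
      by (intro exI[of _ "\<lambda>p v. 0"]) auto
  next
    case (add f g)
    then obtain f' g' where "\<And>p. (f has_derivative f' p) (at p)" "\<And>p. (g has_derivative g' p) (at p)"
      "\<And>v. real_polynomial_function (\<lambda>p. f' p v)" "\<And>v. real_polynomial_function (\<lambda>p. g' p v)"
      by blast
    then show ?case
      by (intro exI[of _ "\<lambda>p v. f' p v + g' p v"]) (auto intro: has_derivative_add)
  next
    case (mult f g)
    then obtain f' g' where "\<And>p. (f has_derivative f' p) (at p)" "\<And>p. (g has_derivative g' p) (at p)"
      "\<And>v. real_polynomial_function (\<lambda>p. f' p v)" "\<And>v. real_polynomial_function (\<lambda>p. g' p v)"
      by blast
    with mult.hyps show ?case
      by (intro exI[of _ "\<lambda>p v. f p * g' p v + f' p v * g p"])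
         (auto intro!: has_derivative_mult real_polynomial_function.intros(3) real_polynomial_function.intros(4))
  qed
  with that show ?thesis by blast
qed

text \<open>
  The derivative is again polynomial in the base point. This keeps every vector field below
  polynomial, hence locally Lipschitz and infinitely differentiable.
\<close>

lemma polynomial_function_has_derivative:
  fixes f :: "'a::real_normed_vector \<Rightarrow> 'b::euclidean_space"
  assumes "polynomial_function f"
  shows "\<exists>f'. (\<forall>p. (f has_derivative f' p) (at p)) \<and> (\<forall>v. polynomial_function (\<lambda>p. f' p v))"
proof -
  have "\<forall>b. \<exists>g'. (\<forall>p. ((\<lambda>p. f p \<bullet> b) has_derivative g' p) (at p)) \<and>
      (\<forall>v. real_polynomial_function (\<lambda>p. g' p v))"
    using real_polynomial_function_has_derivative[OF real_polynomial_function_inner_right[OF assms]]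
    by metis
  then obtain G where G: "\<And>b p. ((\<lambda>p. f p \<bullet> b) has_derivative G b p) (at p)"
     "\<And>b v. real_polynomial_function (\<lambda>p. G b p v)"
    by metis
  show ?thesis
  proof (intro exI conjI allI)
    show "(f has_derivative (\<lambda>v. \<Sum>b\<in>Basis. G b p v *\<^sub>R b)) (at p)" for p
      unfolding has_derivative_componentwise_within[where f=f]
      using G(1)[of _ p] by (auto simp: inner_sum_left inner_Basis if_distrib cong: if_cong)
    show "polynomial_function (\<lambda>p. \<Sum>b\<in>Basis. G b p v *\<^sub>R b)" for v
      using G(2) by (intro polynomial_function_sum polynomial_function_mult)
         (auto simp: real_polynomial_function_eq)
  qed
qed

lemma polynomial_function_frechet_derivative:
  fixes f :: "'a::real_normed_vector \<Rightarrow> 'b::euclidean_space"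
  assumes "polynomial_function f"
  shows "(f has_derivative frechet_derivative f (at p)) (at p)"
    and "polynomial_function (\<lambda>p. frechet_derivative f (at p) v)"
proof -
  obtain f' where f': "(\<forall>p. (f has_derivative f' p) (at p)) \<and> (\<forall>v. polynomial_function (\<lambda>p. f' p v))"
    using polynomial_function_has_derivative[OF assms] by (elim exE)
  have eq: "frechet_derivative f (at p) = f' p" for p
    by (rule frechet_derivative_at[OF conjunct1[OF f', THEN spec], symmetric])
  show "(f has_derivative frechet_derivative f (at p)) (at p)"
    unfolding eq using conjunct1[OF f'] by (rule spec)
  show "polynomial_function (\<lambda>p. frechet_derivative f (at p) v)"
    unfolding eq using conjunct2[OF f'] by (rule spec)
qed

lemma polynomial_function_Pair:
  assumes "polynomial_function f" "polynomial_function g"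
  shows "polynomial_function (\<lambda>x. (f x, g x))"
proof -
  have "polynomial_function (\<lambda>x. (f x, 0))"
    using polynomial_function_compose[OF assms(1), of "\<lambda>u. (u, 0)"]
    by (simp add: o_def polynomial_function_bounded_linear bounded_linear_Pair bounded_linear_ident bounded_linear_zero)
  moreover have "polynomial_function (\<lambda>x. (0, g x))"
    using polynomial_function_compose[OF assms(2), of "\<lambda>u. (0, u)"]
    by (simp add: o_def polynomial_function_bounded_linear bounded_linear_Pair bounded_linear_ident bounded_linear_zero)
  ultimately have "polynomial_function (\<lambda>x. (f x, 0) + (0, g x))"
    by (rule polynomial_function_add)
  then show ?thesis by simp
qed

lemma polynomial_function_vec:
  fixes f :: "'a::real_normed_vector \<Rightarrow> 'i::finite \<Rightarrow> real"
  assumes "\<And>i. real_polynomial_function (\<lambda>x. f x i)"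
  shows "polynomial_function (\<lambda>x. (\<chi> i. f x i) :: real^'i)"
  using assms unfolding polynomial_function_iff_Basis_inner
  by (auto simp: Basis_vec_def inner_axis)

lemma polynomial_function_nth:
  assumes "polynomial_function f"
  shows "real_polynomial_function (\<lambda>x. f x $ i)"
  using assms bounded_linear_vec_nth[of i] unfolding polynomial_function_def o_def by blast

lemma polynomial_function_fst:
  assumes "polynomial_function f"
  shows "polynomial_function (\<lambda>x. fst (f x))"
  using polynomial_function_compose[OF assms polynomial_function_bounded_linear[OF bounded_linear_fst]]
  unfolding o_def .

lemma polynomial_function_snd:
  assumes "polynomial_function f"
  shows "polynomial_function (\<lambda>x. snd (f x))"
  using polynomial_function_compose[OF assms polynomial_function_bounded_linear[OF bounded_linear_snd]]
  unfolding o_def .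

section \<open>A polynomial field spanning the kernel of the derivative\<close>

definition replace_column :: "real^'m^'m \<Rightarrow> 'm \<Rightarrow> real^'m \<Rightarrow> real^'m^'m" where
  "replace_column M k b = (\<chi> i j. if j = k then b $ i else M $ i $ j)"

text \<open>
  By Cramer's rule, the adjugate of \<open>M\<close> applied to \<open>b\<close>.
\<close>

definition cramer_vec :: "real^'m^'m \<Rightarrow> real^'m \<Rightarrow> real^'m" where
  "cramer_vec M b = (\<chi> k. det (replace_column M k b))"

lemma det_nonzero_if_surj:
  fixes M :: "real^'m^'m"
  assumes "surj ((*v) M)"
  shows "det M \<noteq> 0"
  using assms by (simp add: invertible_det_nz[symmetric] invertible_right_inverse matrix_right_invertible_surjective)

text \<open>
  \<open>det (M + s I)\<close> is a polynomial in \<open>s\<close>, and it is nonzero for \<open>s\<close> larger than the operator norm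
  of \<open>M\<close>; so its zeros cannot accumulate at 0.
\<close>

lemma invertible_perturbations:
  fixes M :: "real^'m^'m"
  obtains t where "t \<longlonglongrightarrow> (0::real)" "\<And>k::nat. det (M + t k *\<^sub>R mat 1) \<noteq> 0"
proof -
  define g where "g s = det (M + s *\<^sub>R mat 1)" for s
  have "real_polynomial_function g"
    unfolding g_def
  proof (rule real_polynomial_function_det)
    fix i j :: 'm
    have "real_polynomial_function (\<lambda>s. M $ i $ j + s * ((mat 1 :: real^'m^'m) $ i $ j))"
      by (intro real_polynomial_function.intros bounded_linear_ident)
    then show "real_polynomial_function (\<lambda>s. (M + s *\<^sub>R mat 1) $ i $ j)"
      by simp
  qed
  moreover have "\<exists>s. g s \<noteq> 0"
  proof -
    obtain B where B: "B > 0" "\<And>v. norm (M *v v) \<le> B * norm v"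
      using linear_bounded_pos[OF matrix_vector_mul_linear[of M]] by blast
    \<comment> \<open>\<open>B + 1\<close> exceeds the operator norm of \<open>M\<close>, so \<open>M + (B + 1) I\<close> is injective.\<close>
    have "v = 0" if "(M + (B+1) *\<^sub>R mat 1) *v v = 0" for v
    proof -
      have "M *v v = - ((B+1) *\<^sub>R v)"
        using that by (simp add: matrix_vector_mult_add_rdistrib scaleR_matrix_vector_assoc[symmetric] eq_neg_iff_add_eq_0)
      then have "(B+1) * norm v \<le> B * norm v"
        using B(2)[of v] B(1) by (simp add: abs_if)
      then show ?thesis using B(1) by (auto simp: algebra_simps)
    qed
    then have "g (B+1) \<noteq> 0"
      unfolding g_def invertible_det_nz[symmetric] invertible_left_inverse matrix_left_invertible_ker by blast
    then show ?thesis ..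
  qed
  ultimately have fin: "finite {s. g s = 0}"
    using real_polynomial_function_finite_roots by blast
  have "\<exists>s\<in>ball 0 (1 / Suc k). g s \<noteq> 0" for k
  proof (rule ccontr)
    assume "\<not> ?thesis"
    then have "ball 0 (1 / Suc k) \<subseteq> {s. g s = 0}" by blast
    then have "finite (ball (0::real) (1 / Suc k))" using fin finite_subset by blast
    then show False
      using finite_imp_not_open[of "ball (0::real) (1 / Suc k)"] by auto
  qed
  then obtain t where t: "\<And>k. t k \<in> ball 0 (1 / Suc k)" "\<And>k. g (t k) \<noteq> 0"
    by metis
  have "t \<longlonglongrightarrow> 0"
    by (rule Lim_null_comparison[OF _ LIMSEQ_inverse_real_of_nat])
       (use t(1) in \<open>auto intro!: always_eventually simp: inverse_eq_divide less_imp_le\<close>)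
  with t(2) that show ?thesis unfolding g_def by blast
qed

text \<open>
  For invertible \<open>M\<close> this is Cramer's rule. Both sides are continuous in \<open>M\<close>, and invertible
  matrices are dense.
\<close>

lemma matrix_mult_cramer_vec:
  fixes M :: "real^'m^'m"
  shows "M *v cramer_vec M b = det M *\<^sub>R b"
proof -
  obtain t where t: "t \<longlonglongrightarrow> 0" "\<And>k. det (M + t k *\<^sub>R mat 1) \<noteq> 0"
    using invertible_perturbations by blast
  define N where "N k = M + t k *\<^sub>R mat 1" for k
  have N: "N \<longlonglongrightarrow> M"
    unfolding N_def using t(1) by (auto intro!: tendsto_eq_intros)
  have eq: "N k *v cramer_vec (N k) b = det (N k) *\<^sub>R b" for k
  proof -
    have nz: "det (N k) \<noteq> 0" using t(2) by (simp add: N_def)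
    have "N k *v (\<chi> l. det (replace_column (N k) l b) / det (N k)) = b"
      using cramer[OF nz, of _ b] by (simp add: replace_column_def)
    moreover have "(\<chi> l. det (replace_column (N k) l b) / det (N k)) = (1 / det (N k)) *\<^sub>R cramer_vec (N k) b"
      by (simp add: vec_eq_iff cramer_vec_def)
    ultimately have "b = (1 / det (N k)) *\<^sub>R (N k *v cramer_vec (N k) b)"
      by (simp add: matrix_vector_mult_scaleR)
    then have "det (N k) *\<^sub>R b = det (N k) *\<^sub>R ((1 / det (N k)) *\<^sub>R (N k *v cramer_vec (N k) b))"
      by (rule arg_cong)
    then show ?thesis using nz by simp
  qed
  have detlim: "(\<lambda>k. det (F (N k))) \<longlonglongrightarrow> det (F M)"
    if "continuous_on UNIV F" for F :: "real^'m^'m \<Rightarrow> real^'m^'m"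
  proof -
    have "(\<lambda>k. F (N k)) \<longlonglongrightarrow> F M"
      by (rule continuous_on_tendsto_compose[OF that N]) auto
    then show ?thesis
      unfolding det_def
      by (intro tendsto_sum tendsto_mult tendsto_const tendsto_prod tendsto_vec_nth)
  qed
  have "(\<lambda>k. det (replace_column (N k) l b)) \<longlonglongrightarrow> det (replace_column M l b)" for l
  proof (rule detlim)
    show "continuous_on UNIV (\<lambda>M. replace_column M l b)"
      unfolding replace_column_def
    proof (intro continuous_on_vec_lambda)
      show "continuous_on UNIV (\<lambda>M. if j = l then b $ i else M $ i $ j)" for i j :: 'm
        by (cases "j = l") (simp_all add: continuous_on_component continuous_on_id)
    qed
  qed
  then have K: "(\<lambda>k. cramer_vec (N k) b) \<longlonglongrightarrow> cramer_vec M b"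
    unfolding cramer_vec_def by (intro tendsto_vec_lambda)
  have "(\<lambda>k. N k *v cramer_vec (N k) b) \<longlonglongrightarrow> M *v cramer_vec M b"
    unfolding matrix_vector_mult_def
    by (intro tendsto_vec_lambda tendsto_sum tendsto_mult tendsto_vec_nth N K)
  moreover have "(\<lambda>k. det (N k) *\<^sub>R b) \<longlonglongrightarrow> det M *\<^sub>R b"
    using detlim[of "\<lambda>M. M"] by (auto intro!: tendsto_scaleR simp: continuous_on_id)
  ultimately show ?thesis
    unfolding eq by (rule LIMSEQ_unique)
qed

text \<open>
  If \<open>M\<close> is singular, some column \<open>k\<close> depends on the others. When \<open>b\<close> together with the columns of
  \<open>M\<close> spans the whole space, so do \<open>b\<close> and the columns other than \<open>k\<close>, so the \<open>k\<close>-th Cramer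
  determinant is nonzero.
\<close>

lemma cramer_vec_nonzero:
  fixes M :: "real^'m^'m"
  assumes surj: "\<And>w. \<exists>v \<tau>. M *v v + \<tau> *\<^sub>R b = w" and sing: "det M = 0"
  shows "cramer_vec M b \<noteq> 0"
proof -
  obtain c k where c: "M *v c = 0" and k: "c $ k \<noteq> 0"
    using sing by (metis invertible_det_nz invertible_left_inverse matrix_left_invertible_ker vec_eq_iff zero_index)
  have "\<exists>u. replace_column M k b *v u = w" for w
  proof -
    obtain v \<tau> where v: "M *v v + \<tau> *\<^sub>R b = w" using surj by blast
    \<comment> \<open>Subtracting a multiple of the kernel vector \<open>c\<close> clears the \<open>k\<close>-th coordinate.\<close>
    define v' where "v' = v - (v $ k / c $ k) *\<^sub>R c"
    have 1: "M *v v' = M *v v"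
      by (simp add: v'_def matrix_vector_mult_diff_distrib matrix_vector_mult_scaleR c)
    have 2: "v' $ k = 0" using k by (simp add: v'_def)
    have "(replace_column M k b *v (v' + \<tau> *\<^sub>R axis k 1)) $ i = (M *v v' + \<tau> *\<^sub>R b) $ i" for i
    proof -
      have "(replace_column M k b *v (v' + \<tau> *\<^sub>R axis k 1)) $ i
          = (\<Sum>j\<in>UNIV. M $ i $ j * v' $ j + (if j = k then \<tau> * b $ i else 0))"
        unfolding matrix_vector_mult_def replace_column_def
        by (auto intro!: sum.cong simp: 2 axis_def)
      also have "\<dots> = (M *v v' + \<tau> *\<^sub>R b) $ i"
        by (simp add: sum.distrib matrix_vector_mult_def)
      finally show ?thesis .
    qed
    then show ?thesis using v 1 by (metis vec_eq_iff)
  qed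
  then have "det (replace_column M k b) \<noteq> 0"
    by (intro det_nonzero_if_surj) (metis surjI)
  then show ?thesis by (auto simp: cramer_vec_def vec_eq_iff)
qed

text \<open>
  The field is the generalised cross product of the rows of the derivative: its components are, up
  to sign, the maximal minors of the matrix \<open>(M p | b p)\<close>, where \<open>M p\<close> is the partial derivative in the
  first argument and \<open>b p\<close> the one in the last variable. Being made of minors it is polynomial and
  defined everywhere, and it spans the kernel wherever the derivative is onto. The maps \<open>e\<close> and \<open>d\<close>
  only identify the space with one in which determinants are available.
\<close>

lemma polynomial_kernel_field:
  fixes f :: "'b::euclidean_space \<times> real \<Rightarrow> 'b" and e :: "'b \<Rightarrow> real^'m" and d :: "real^'m \<Rightarrow> 'b"
  assumes f: "polynomial_function f" and e: "linear e" and d: "linear d"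
    and ed [simp]: "\<And>u. e (d u) = u" "\<And>y. d (e y) = y"
  obtains T where "polynomial_function T"
    "\<And>p D. (f has_derivative D) (at p) \<Longrightarrow> D (T p) = 0"
    "\<And>p D. (f has_derivative D) (at p) \<Longrightarrow> surj D \<Longrightarrow> T p \<noteq> 0"
    "\<And>p D. (f has_derivative D) (at p) \<Longrightarrow> snd (T p) \<noteq> 0 \<longleftrightarrow> inj (\<lambda>v. D (v, 0))"
proof -
  define f' where "f' p = frechet_derivative f (at p)" for p
  note f' = polynomial_function_frechet_derivative(1)[OF f, folded f'_def]
  note pf' = polynomial_function_frechet_derivative(2)[OF f, folded f'_def]
  define M where "M p = matrix (\<lambda>u. e (f' p (d u, 0)))" for p
  define b where "b p = e (f' p (0, 1))" for p
  have lin: "linear (f' p)" for p by (rule has_derivative_linear[OF f'])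
  have linM: "linear (\<lambda>u. e (f' p (d u, 0)))" for p
  proof -
    have "linear (\<lambda>u. (d u, 0::real))" using d
      by (intro linearI) (auto simp: linear_add linear_scale)
    show ?thesis
      using linear_compose[OF linear_compose[OF \<open>linear (\<lambda>u. (d u, 0::real))\<close> lin[of p]] e]
      unfolding o_def .
  qed
  have Mv: "M p *v u = e (f' p (d u, 0))" for p u
    unfolding M_def by (rule matrix_works) (simp add: linear_matrix_vector_mul_eq linM)
  have split: "e (f' p (y, \<tau>)) = M p *v e y + \<tau> *\<^sub>R b p" for p y \<tau>
  proof -
    have "f' p (y, \<tau>) = f' p (y, 0) + \<tau> *\<^sub>R f' p (0, 1)"
      using linear_add[OF lin, of p "(y,0)" "\<tau> *\<^sub>R (0,1)"] linear_scale[OF lin, of p \<tau> "(0,1)"] by simp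
    then show ?thesis
      by (simp add: Mv b_def linear_add[OF e] linear_scale[OF e])
  qed
  define T where "T p = (- d (cramer_vec (M p) (b p)), det (M p))" for p
  have bl: "bounded_linear e" "bounded_linear d"
    using e d by (simp_all add: linear_conv_bounded_linear)
  have pe: "polynomial_function (\<lambda>p. e (f' p v))" for v
    using polynomial_function_compose[OF pf' polynomial_function_bounded_linear[OF bl(1)]] unfolding o_def .
  have pM: "real_polynomial_function (\<lambda>p. M p $ i $ j)" for i j
    unfolding M_def matrix_def using polynomial_function_nth[OF pe] by simp
  have pb: "real_polynomial_function (\<lambda>p. b p $ i)" for i
    unfolding b_def using polynomial_function_nth[OF pe] by simp
  have "real_polynomial_function (\<lambda>p. replace_column (M p) k (b p) $ i $ j)" for i j k
    by (cases "j = k") (simp_all add: replace_column_def pM pb)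
  then have "polynomial_function (\<lambda>p. cramer_vec (M p) (b p))"
    unfolding cramer_vec_def
    by (intro polynomial_function_vec real_polynomial_function_det)
  from polynomial_function_compose[OF this polynomial_function_bounded_linear[OF bl(2)]]
  have "polynomial_function (\<lambda>p. d (cramer_vec (M p) (b p)))" unfolding o_def .
  then have pT: "polynomial_function T"
    unfolding T_def
    by (intro polynomial_function_Pair polynomial_function_minus)
       (simp_all add: real_polynomial_function_det pM flip: real_polynomial_function_eq)
  have inje: "e y = 0 \<longleftrightarrow> y = 0" for y
    by (metis e ed(2) linear_0)
  have D_eq: "D = f' p" if "(f has_derivative D) (at p)" for D p
    by (rule has_derivative_unique[OF that f'])
  have ker: "f' p (T p) = 0" for p
  proof -
    have "e (f' p (T p)) = 0"
      using matrix_mult_cramer_vec[of "M p" "b p"] unfolding T_def split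
      by (simp add: linear_neg[OF e] linear_neg[OF matrix_vector_mul_linear, of "M p"])
    then show ?thesis by (simp add: inje)
  qed
  have nz: "T p \<noteq> 0" if "surj (f' p)" for p
  proof
    assume T0: "T p = 0"
    have "\<exists>v \<tau>. M p *v v + \<tau> *\<^sub>R b p = w" for w
    proof -
      obtain z where "d w = f' p z"
        using \<open>surj (f' p)\<close> by (rule surjE)
      then have "w = e (f' p (fst z, snd z))" by (metis ed(1) prod.collapse)
      then show ?thesis unfolding split by blast
    qed
    moreover have "det (M p) = 0" using T0 by (simp add: T_def zero_prod_def)
    ultimately have "cramer_vec (M p) (b p) \<noteq> 0" by (rule cramer_vec_nonzero)
    moreover have "d (cramer_vec (M p) (b p)) = 0" using T0 by (simp add: T_def zero_prod_def)
    ultimately show False by (metis ed(1) e linear_0)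
  qed
  have sndT: "snd (T p) \<noteq> 0 \<longleftrightarrow> inj (\<lambda>v. f' p (v, 0))" for p
  proof -
    have l: "linear (\<lambda>v. f' p (v, 0))"
    proof -
      have "linear (\<lambda>v::'b. (v, 0::real))" by (intro linearI) auto
      show ?thesis
        using linear_compose[OF \<open>linear (\<lambda>v::'b. (v, 0::real))\<close> lin[of p]] unfolding o_def .
    qed
    have "snd (T p) \<noteq> 0 \<longleftrightarrow> (\<forall>u. M p *v u = 0 \<longrightarrow> u = 0)"
      by (simp add: T_def invertible_det_nz[symmetric] invertible_left_inverse matrix_left_invertible_ker)
    also have "\<dots> \<longleftrightarrow> (\<forall>v. f' p (v, 0) = 0 \<longrightarrow> v = 0)"
      unfolding Mv inje by (metis ed(1) ed(2) inje)
    also have "\<dots> \<longleftrightarrow> inj (\<lambda>v. f' p (v, 0))"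
      using linear_injective_0[OF l] by simp
    finally show ?thesis .
  qed
  show ?thesis
  proof (rule that[OF pT])
    fix p D assume D: "(f has_derivative D) (at p)"
    show "D (T p) = 0" unfolding D_eq[OF D] by (rule ker)
    show "T p \<noteq> 0" if "surj D" using that unfolding D_eq[OF D] by (rule nz)
    show "snd (T p) \<noteq> 0 \<longleftrightarrow> inj (\<lambda>v. D (v, 0))" unfolding D_eq[OF D] by (rule sndT)
  qed
qed

section \<open>Global flows of Lipschitz fields\<close>

text \<open>
  The estimate that makes the Picard operator a contraction in the norm weighted by
  \<open>exp (- 2 L \<bar>t\<bar>)\<close>: integrating the exponential gains the factor \<open>1 / (2 L)\<close>.
\<close>

lemma exponential_growth_bound_forward:
  fixes F :: "real \<Rightarrow> 'a::real_normed_vector"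
  assumes F: "\<And>t. (F has_vector_derivative f t) (at t)" and "F 0 = 0"
    and f: "\<And>t. norm (f t) \<le> L * exp (2 * L * \<bar>t\<bar>) * d" and L: "L > 0" and d: "d \<ge> 0" and t: "t \<ge> 0"
  shows "norm (F t) \<le> d / 2 * exp (2 * L * t)"
proof (cases "t = 0")
  case False
  have "norm (F t - F 0) \<le> d / 2 * exp (2 * L * t) - d / 2 * exp (2 * L * 0)"
  proof (rule differentiable_bound_general)
    show "0 < t" using False t by simp
    show "continuous_on {0..t} F"
      by (intro continuous_at_imp_continuous_on ballI has_vector_derivative_continuous[OF F])
    show "continuous_on {0..t} (\<lambda>s. d / 2 * exp (2 * L * s))" by (intro continuous_intros)
    show "(F has_vector_derivative f s) (at s)" for s by (rule F)
    show "((\<lambda>s. d / 2 * exp (2 * L * s)) has_vector_derivative L * exp (2 * L * \<bar>s\<bar>) * d) (at s)"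
      if "0 < s" for s
      unfolding has_real_derivative_iff_has_vector_derivative[symmetric]
      using that by (auto intro!: derivative_eq_intros)
  qed (rule f)
  then show ?thesis using d \<open>F 0 = 0\<close> by simp
qed (use assms in auto)

lemma has_vector_derivative_reflect:
  fixes F :: "real \<Rightarrow> 'a::real_normed_vector"
  assumes "(F has_vector_derivative D) (at (- t))"
  shows "((\<lambda>s. F (- s)) has_vector_derivative - D) (at t)"
proof -
  have "((uminus :: real \<Rightarrow> real) has_vector_derivative - 1) (at t)"
    by (auto intro!: derivative_eq_intros)
  from vector_diff_chain_at[OF this assms] show ?thesis by (simp add: o_def)
qed

lemma has_vector_derivative_translate:
  fixes F :: "real \<Rightarrow> 'a::real_normed_vector"
  assumes "(F has_vector_derivative D) (at (a + t))"
  shows "((\<lambda>s. F (a + s)) has_vector_derivative D) (at t)"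
proof -
  have "((\<lambda>s. a + s) has_vector_derivative 1) (at t)"
    by (auto intro!: derivative_eq_intros)
  from vector_diff_chain_at[OF this assms] show ?thesis by (simp add: o_def)
qed

lemma exponential_growth_bound:
  fixes F :: "real \<Rightarrow> 'a::real_normed_vector"
  assumes F: "\<And>t. (F has_vector_derivative f t) (at t)" and "F 0 = 0"
    and f: "\<And>t. norm (f t) \<le> L * exp (2 * L * \<bar>t\<bar>) * d" and L: "L > 0" and d: "d \<ge> 0"
  shows "norm (F t) \<le> d / 2 * exp (2 * L * \<bar>t\<bar>)"
proof (cases "t \<ge> 0")
  case True
  then show ?thesis using exponential_growth_bound_forward[OF F _ f L d True] \<open>F 0 = 0\<close> by simp
next
  case False
  have "norm (F (- (- t))) \<le> d / 2 * exp (2 * L * (- t))"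
  proof (rule exponential_growth_bound_forward[where F = "\<lambda>s. F (- s)" and f = "\<lambda>s. - f (- s)"])
    show "((\<lambda>s. F (- s)) has_vector_derivative - f (- s)) (at s)" for s
      by (rule has_vector_derivative_reflect[OF F])
    show "norm (- f (- s)) \<le> L * exp (2 * L * \<bar>s\<bar>) * d" for s using f[of "- s"] by simp
  qed (use \<open>F 0 = 0\<close> L d False in auto)
  then show ?thesis using False by simp
qed

lemma continuous_antiderivative:
  fixes f :: "real \<Rightarrow> 'a::euclidean_space"
  assumes "continuous_on UNIV f"
  shows "\<exists>F. F 0 = 0 \<and> (\<forall>t. (F has_vector_derivative f t) (at t))"
proof -
  have "isCont f x" for x using assms by (simp add: continuous_on_eq_continuous_at)
  then obtain F where F: "\<forall>x::real. -\<infinity> < ereal x \<longrightarrow> ereal x < \<infinity> \<longrightarrow> (F has_vector_derivative f x) (at x)"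
    using einterval_antiderivative[of "-\<infinity>" "\<infinity>" f] by auto
  have "((\<lambda>t. F t - F 0) has_vector_derivative f t) (at t)" for t
    using has_vector_derivative_diff[OF F[rule_format, of t] has_vector_derivative_const] by simp
  then show ?thesis by (intro exI[of _ "\<lambda>t. F t - F 0"]) simp
qed

text \<open>
  Writing a candidate solution as \<open>p + exp (2 L \<bar>t\<bar>) u t\<close> with \<open>u\<close> bounded turns the Picard
  operator into a contraction on the Banach space of bounded continuous functions on the whole
  line. One application of the fixed point theorem thus yields a solution for all times.
\<close>

lemma lipschitz_ode_solution:
  fixes Y :: "'a::euclidean_space \<Rightarrow> 'a"
  assumes lip: "\<And>p q. norm (Y p - Y q) \<le> L * norm (p - q)" and L: "L > 0"
    and bd: "\<And>p. norm (Y p) \<le> B"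
  shows "\<exists>\<gamma>. \<gamma> 0 = p \<and> (\<forall>t. (\<gamma> has_vector_derivative Y (\<gamma> t)) (at t))"
proof -
  have contY: "continuous_on UNIV Y"
    by (rule lipschitz_on_continuous_on[of L])
       (use lip L in \<open>auto simp: lipschitz_on_def dist_norm\<close>)
  define w where "w s = exp (2 * L * \<bar>s\<bar>)" for s :: real
  have w: "w s > 0" "continuous_on UNIV w" for s unfolding w_def by (auto intro!: continuous_intros)
  define path where "path u s = p + w s *\<^sub>R apply_bcontfun u s" for u :: "real \<Rightarrow>\<^sub>C 'a" and s
  have contf: "continuous_on UNIV (\<lambda>s. Y (path u s))" for u
    unfolding path_def
    by (intro continuous_on_compose2[OF contY] continuous_intros w) auto
  have "\<exists>F. \<forall>u. F u 0 = 0 \<and> (\<forall>t. (F u has_vector_derivative Y (path u t)) (at t))"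
    using continuous_antiderivative[OF contf] by (intro choice allI)
  then obtain F where F0: "\<And>u. F u 0 = 0"
    and F: "\<And>u t. (F u has_vector_derivative Y (path u t)) (at t)" by auto
  have contF: "continuous_on UNIV (F u)" for u
    by (intro continuous_at_imp_continuous_on ballI has_vector_derivative_continuous[OF F])
  define \<Phi> where "\<Phi> u = Bcontfun (\<lambda>t. (1 / w t) *\<^sub>R F u t)" for u
  have w1: "1 \<le> w s" for s unfolding w_def using L by simp
  have in_b: "(\<lambda>t. (1 / w t) *\<^sub>R F u t) \<in> bcontfun" for u
  proof (rule bcontfun_normI)
    have nz: "w s \<noteq> 0" for s using w(1)[of s] by simp
    show "continuous_on UNIV (\<lambda>t. (1 / w t) *\<^sub>R F u t)"
      by (intro continuous_intros w contF) (use nz in auto)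
    have B0: "0 \<le> B" using bd[of p] norm_ge_zero order_trans by blast
    have "norm (Y (path u t)) \<le> L * exp (2 * L * \<bar>t\<bar>) * (B / L)" for t
    proof -
      have "norm (Y (path u t)) \<le> 1 * B" using bd by simp
      also have "\<dots> \<le> w t * B" using w1 B0 by (intro mult_right_mono)
      also have "\<dots> = L * exp (2 * L * \<bar>t\<bar>) * (B / L)" using L by (simp add: w_def)
      finally show ?thesis .
    qed
    then have "norm (F u t) \<le> (B / L) / 2 * exp (2 * L * \<bar>t\<bar>)" for t
      by (rule exponential_growth_bound[OF F F0 _ L]) (use B0 L in simp)
    then show "norm ((1 / w t) *\<^sub>R F u t) \<le> B / L / 2" for t
      using w(1)[of t] by (simp add: w_def field_simps)
  qed
  have ap: "apply_bcontfun (\<Phi> u) = (\<lambda>t. (1 / w t) *\<^sub>R F u t)" for u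
    unfolding \<Phi>_def by (rule Bcontfun_inverse[OF in_b])
  have contr: "dist (\<Phi> u) (\<Phi> v) \<le> 1 / 2 * dist u v" for u v
  proof (rule dist_bound)
    fix t
    have "norm (F u t - F v t) \<le> dist u v / 2 * exp (2 * L * \<bar>t\<bar>)"
    proof (rule exponential_growth_bound[where F = "\<lambda>t. F u t - F v t" and f = "\<lambda>t. Y (path u t) - Y (path v t)"])
      show "((\<lambda>t. F u t - F v t) has_vector_derivative Y (path u t) - Y (path v t)) (at t)" for t
        by (intro has_vector_derivative_diff F)
      show "norm (Y (path u t) - Y (path v t)) \<le> L * exp (2 * L * \<bar>t\<bar>) * dist u v" for t
      proof -
        have "norm (Y (path u t) - Y (path v t)) \<le> L * norm (path u t - path v t)" by (rule lip)
        also have "path u t - path v t = w t *\<^sub>R (apply_bcontfun u t - apply_bcontfun v t)"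
          by (simp add: path_def scaleR_diff_right)
        also have "L * norm \<dots> = L * (w t * dist (apply_bcontfun u t) (apply_bcontfun v t))"
          using w(1)[of t] by (simp add: dist_norm)
        also have "\<dots> \<le> L * (w t * dist u v)"
          using L w(1)[of t] dist_bounded[of u t v] by (intro mult_left_mono) auto
        finally show ?thesis by (simp add: w_def mult.assoc)
      qed
    qed (use L F0 in auto)
    then have "norm (F u t - F v t) / w t \<le> 1 / 2 * dist u v"
      using w(1)[of t] by (simp add: w_def pos_divide_le_eq)
    moreover have "apply_bcontfun (\<Phi> u) t - apply_bcontfun (\<Phi> v) t = (1 / w t) *\<^sub>R (F u t - F v t)"
      by (simp add: ap scaleR_diff_right)
    ultimately show "dist (apply_bcontfun (\<Phi> u) t) (apply_bcontfun (\<Phi> v) t) \<le> 1 / 2 * dist u v"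
      unfolding dist_norm using w(1)[of t] by simp
  qed
  have "\<exists>!u. \<Phi> u = u"
    by (rule banach_fix_type[of "1/2"]) (use contr in auto)
  then obtain u where u: "\<Phi> u = u" by blast
  have "path u t = p + F u t" for t
    unfolding path_def using fun_cong[OF ap[of u], of t] w(1)[of t] unfolding u by simp
  then have path: "path u = (\<lambda>t. p + F u t)" by (rule ext)
  have "(path u has_vector_derivative Y (path u t)) (at t)" for t
    unfolding path
    using has_vector_derivative_add[OF has_vector_derivative_const F[of u t], of p]
    by (simp add: path)
  moreover have "path u 0 = p" by (simp add: path F0)
  ultimately show ?thesis by blast
qed

text \<open>
  Gronwall's argument: the squared distance of two solutions, damped by \<open>exp (- 2 L t)\<close>, does not
  increase.
\<close>

lemma lipschitz_ode_unique_forward: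
  fixes Y :: "'a::real_inner \<Rightarrow> 'a"
  assumes lip: "\<And>p q. norm (Y p - Y q) \<le> L * norm (p - q)"
    and \<gamma>: "\<And>t. (\<gamma> has_vector_derivative Y (\<gamma> t)) (at t)"
    and \<eta>: "\<And>t. (\<eta> has_vector_derivative Y (\<eta> t)) (at t)"
    and eq: "\<gamma> 0 = \<eta> 0" and t: "t \<ge> 0"
  shows "\<gamma> t = \<eta> t"
proof -
  define g where "g t = exp (- (2 * L) * t) * ((\<gamma> t - \<eta> t) \<bullet> (\<gamma> t - \<eta> t))" for t
  have "g t \<le> g 0"
  proof (rule DERIV_nonpos_imp_nonincreasing[OF t])
    fix s
    define u where "u = \<gamma> s - \<eta> s"
    define v where "v = Y (\<gamma> s) - Y (\<eta> s)"
    have d: "((\<lambda>s. \<gamma> s - \<eta> s) has_derivative (\<lambda>h. h *\<^sub>R v)) (at s)"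
      unfolding v_def using has_vector_derivative_diff[OF \<gamma> \<eta>] by (simp add: has_vector_derivative_def)
    have ip: "((\<lambda>s. (\<gamma> s - \<eta> s) \<bullet> (\<gamma> s - \<eta> s)) has_field_derivative 2 * (u \<bullet> v)) (at s)"
      unfolding has_field_derivative_def
      by (rule has_derivative_eq_rhs[OF has_derivative_inner[OF d d]])
         (simp add: u_def inner_commute[of v] algebra_simps fun_eq_iff)
    have "(g has_field_derivative
        exp (- (2 * L) * s) * (2 * (u \<bullet> v)) + exp (- (2 * L) * s) * (- (2 * L)) * (u \<bullet> u)) (at s)"
      unfolding g_def
      by (rule derivative_eq_intros ip refl | simp add: u_def)+
    moreover have "u \<bullet> v \<le> L * (u \<bullet> u)"
    proof -
      have "u \<bullet> v \<le> norm u * norm v" by (rule norm_cauchy_schwarz)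
      also have "\<dots> \<le> norm u * (L * norm u)" unfolding u_def v_def using lip by (intro mult_left_mono) auto
      finally show ?thesis by (simp add: power2_norm_eq_inner[symmetric] power2_eq_square mult.left_commute)
    qed
    then have "exp (- (2 * L) * s) * (2 * (u \<bullet> v)) + exp (- (2 * L) * s) * (- (2 * L)) * (u \<bullet> u) \<le> 0"
      by (simp add: mult.left_commute mult.assoc)
    ultimately show "\<exists>y. (g has_real_derivative y) (at s) \<and> y \<le> 0" by blast
  qed
  then have "(\<gamma> t - \<eta> t) \<bullet> (\<gamma> t - \<eta> t) \<le> 0" using eq by (simp add: g_def mult_le_0_iff)
  then have "(\<gamma> t - \<eta> t) \<bullet> (\<gamma> t - \<eta> t) = 0"
    using inner_ge_zero[of "\<gamma> t - \<eta> t"] by linarith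
  then show ?thesis unfolding inner_eq_zero_iff by simp
qed

lemma lipschitz_ode_unique:
  fixes Y :: "'a::real_inner \<Rightarrow> 'a"
  assumes lip: "\<And>p q. norm (Y p - Y q) \<le> L * norm (p - q)"
    and \<gamma>: "\<And>t. (\<gamma> has_vector_derivative Y (\<gamma> t)) (at t)"
    and \<eta>: "\<And>t. (\<eta> has_vector_derivative Y (\<eta> t)) (at t)"
    and eq: "\<gamma> 0 = \<eta> 0"
  shows "\<gamma> t = \<eta> t"
proof (cases "t \<ge> 0")
  case True
  then show ?thesis by (rule lipschitz_ode_unique_forward[OF lip \<gamma> \<eta> eq])
next
  case False
  have "\<gamma> (- (- t)) = \<eta> (- (- t))"
  proof (rule lipschitz_ode_unique_forward[where Y = "\<lambda>p. - Y p" and L = L and \<gamma> = "\<lambda>s. \<gamma> (- s)" and \<eta> = "\<lambda>s. \<eta> (- s)"])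
    show "norm (- Y p - - Y q) \<le> L * norm (p - q)" for p q
      using lip[of p q] by (simp add: norm_minus_commute)
    show "((\<lambda>s. \<gamma> (- s)) has_vector_derivative - Y (\<gamma> (- s))) (at s)" for s
      by (rule has_vector_derivative_reflect[OF \<gamma>])
    show "((\<lambda>s. \<eta> (- s)) has_vector_derivative - Y (\<eta> (- s))) (at s)" for s
      by (rule has_vector_derivative_reflect[OF \<eta>])
  qed (use eq False in auto)
  then show ?thesis by simp
qed

lemma lipschitz_flow_exists:
  fixes Y :: "'a::euclidean_space \<Rightarrow> 'a"
  assumes lip: "\<And>p q. norm (Y p - Y q) \<le> L * norm (p - q)" and L: "L > 0"
    and bd: "\<And>p. norm (Y p) \<le> B"
  shows "\<exists>\<phi>. \<forall>p. \<phi> p 0 = p \<and> (\<forall>t. (\<phi> p has_vector_derivative Y (\<phi> p t)) (at t)) \<and>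
    (\<forall>s t. \<phi> (\<phi> p s) t = \<phi> p (s + t))"
proof -
  have "\<exists>\<phi>. \<forall>p. \<phi> p 0 = p \<and> (\<forall>t. (\<phi> p has_vector_derivative Y (\<phi> p t)) (at t))"
    by (intro choice allI lipschitz_ode_solution[OF lip L bd])
  then obtain \<phi> where \<phi>: "\<And>p. \<phi> p 0 = p" "\<And>p t. (\<phi> p has_vector_derivative Y (\<phi> p t)) (at t)"
    by auto
  have "\<phi> (\<phi> p s) t = \<phi> p (s + t)" for p s t
  proof (rule lipschitz_ode_unique[OF lip \<phi>(2), where \<eta> = "\<lambda>t. \<phi> p (s + t)"])
    show "((\<lambda>t. \<phi> p (s + t)) has_vector_derivative Y (\<phi> p (s + t))) (at t)" for t
      by (rule has_vector_derivative_translate[OF \<phi>(2)])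
  qed (simp add: \<phi>(1))
  with \<phi> show ?thesis by blast
qed

lemma polynomial_function_lipschitz_on_cball:
  fixes f :: "'a::euclidean_space \<Rightarrow> 'b::euclidean_space"
  assumes "polynomial_function f"
  shows "\<exists>L>0. \<forall>p\<in>cball 0 R. \<forall>q\<in>cball 0 R. norm (f p - f q) \<le> L * norm (p - q)"
proof -
  define f' where "f' p = frechet_derivative f (at p)" for p
  note f' = polynomial_function_frechet_derivative(1)[OF assms, folded f'_def]
  note pf' = polynomial_function_frechet_derivative(2)[OF assms, folded f'_def]
  define g where "g p = (\<Sum>b\<in>Basis. norm (f' p b))" for p
  have "continuous_on (cball 0 R) g"
    unfolding g_def by (intro continuous_intros continuous_on_polymonial_function pf')
  then have "bounded (g ` cball 0 R)"
    by (intro compact_imp_bounded compact_continuous_image compact_cball)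
  then obtain K where "\<forall>y\<in>g ` cball 0 R. norm y \<le> K"
    unfolding bounded_iff by (elim exE)
  then have K: "\<bar>g p\<bar> \<le> K" if "p \<in> cball 0 R" for p
    using that by simp
  have "norm (f p - f q) \<le> (\<bar>K\<bar> + 1) * norm (p - q)" if "p \<in> cball 0 R" "q \<in> cball 0 R" for p q
  proof (rule differentiable_bound[OF convex_cball[of 0 R] _ _ that])
    show "(f has_derivative f' x) (at x within cball 0 R)" for x
      by (rule has_derivative_at_withinI[OF f'])
    show "onorm (f' x) \<le> \<bar>K\<bar> + 1" if "x \<in> cball 0 R" for x
      using onorm_componentwise[OF has_derivative_bounded_linear[OF f'[of x]]] K[OF that]
      unfolding g_def by linarith
  qed
  then show ?thesis by (intro exI[of _ "\<bar>K\<bar> + 1"]) auto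
qed

text \<open>
  Multiplying the field by a scalar function makes it globally Lipschitz and keeps its direction.
  A conserved quantity of the field is therefore still conserved by the truncated one, everywhere
  and not just inside the ball. The truncation is Lipschitz but not smooth, which is harmless
  because the curves of interest stay inside the ball.
\<close>

lemma polynomial_field_cutoff:
  fixes X :: "'a::euclidean_space \<Rightarrow> 'a"
  assumes "polynomial_function X"
  shows "\<exists>cut L B. continuous_on UNIV cut \<and> (\<forall>p. norm p \<le> R \<longrightarrow> cut p = (1::real)) \<and> L > 0 \<and>
    (\<forall>p q. norm (cut p *\<^sub>R X p - cut q *\<^sub>R X q) \<le> L * norm (p - q)) \<and> (\<forall>p. norm (cut p *\<^sub>R X p) \<le> B)"
proof -
  define cut where "cut p = max 0 (min 1 (R + 1 - norm p))" for p :: 'a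
  obtain L where L: "L > 0" "\<forall>p\<in>cball 0 (R+1). \<forall>q\<in>cball 0 (R+1). norm (X p - X q) \<le> L * norm (p - q)"
    using polynomial_function_lipschitz_on_cball[OF assms, of "R + 1"] by blast
  have "bounded (X ` cball 0 (R+1))"
    by (intro compact_imp_bounded compact_continuous_image compact_cball continuous_on_polymonial_function assms)
  then obtain B where B: "B > 0" "\<And>p. norm p \<le> R + 1 \<Longrightarrow> norm (X p) \<le> B"
    unfolding bounded_pos by auto
  have cut: "0 \<le> cut p" "cut p \<le> 1" "norm p > R + 1 \<Longrightarrow> cut p = 0" "\<bar>cut p - cut q\<bar> \<le> norm (p - q)" for p q
  proof -
    have "\<bar>norm p - norm q\<bar> \<le> norm (p - q)" by (rule norm_triangle_ineq3)
    then show "\<bar>cut p - cut q\<bar> \<le> norm (p - q)" unfolding cut_def by linarith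
  qed (auto simp: cut_def)
  have key: "norm (cut p *\<^sub>R X p - cut q *\<^sub>R X q) \<le> (L + B) * norm (p - q)" if p: "norm p \<le> R + 1" for p q
  proof (cases "norm q \<le> R + 1")
    case True
    have "cut p *\<^sub>R X p - cut q *\<^sub>R X q = cut p *\<^sub>R (X p - X q) + (cut p - cut q) *\<^sub>R X q"
      by (simp add: algebra_simps)
    also have "norm \<dots> \<le> cut p * norm (X p - X q) + \<bar>cut p - cut q\<bar> * norm (X q)"
      using norm_triangle_ineq[of "cut p *\<^sub>R (X p - X q)" "(cut p - cut q) *\<^sub>R X q"] cut(1)[of p] by simp
    also have "\<dots> \<le> 1 * (L * norm (p - q)) + norm (p - q) * B"
      using cut L B True p by (intro add_mono mult_mono) auto
    finally show ?thesis by (simp add: algebra_simps)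
  next
    case False
    then have "cut q = 0" using cut(3) by auto
    then have "norm (cut p *\<^sub>R X p - cut q *\<^sub>R X q) = \<bar>cut p - cut q\<bar> * norm (X p)" by simp
    also have "\<dots> \<le> norm (p - q) * B" using cut B p by (intro mult_mono) auto
    also have "\<dots> \<le> (L + B) * norm (p - q)" using L(1) by (simp add: algebra_simps)
    finally show ?thesis .
  qed
  have "norm (cut p *\<^sub>R X p - cut q *\<^sub>R X q) \<le> (L + B) * norm (p - q)" for p q
  proof (cases "norm p \<le> R + 1 \<or> norm q \<le> R + 1")
    case True
    then show ?thesis using key[of p q] key[of q p] by (auto simp: norm_minus_commute)
  next
    case False
    then have "cut p = 0" "cut q = 0" using cut(3) by auto
    then show ?thesis using L B by simp
  qed
  moreover have "norm (cut p *\<^sub>R X p) \<le> B" for p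
  proof (cases "norm p \<le> R + 1")
    case True
    have "norm (cut p *\<^sub>R X p) \<le> 1 * B" using mult_mono[OF cut(2)[of p] B(2)[OF True]] cut(1)[of p] by simp
    then show ?thesis by simp
  qed (use cut(3)[of p] B in simp)
  moreover have "continuous_on UNIV cut" unfolding cut_def by (intro continuous_intros)
  moreover have "norm p \<le> R \<longrightarrow> cut p = 1" for p by (auto simp: cut_def)
  ultimately show ?thesis
    using L(1) B(1) by (intro exI[of _ cut] exI[of _ "L + B"] exI[of _ B] conjI allI) simp_all
qed

section \<open>Regular level sets are integral curves\<close>

text \<open>
  A right inverse of \<open>D\<close> together with \<open>V\<close> gives an injective map from a space of the same
  dimension, so it is onto.
\<close>

lemma kernel_line:
  fixes D :: "'a::euclidean_space \<Rightarrow> 'b::euclidean_space"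
  assumes D: "linear D" "surj D" and dim: "DIM('a) = DIM('b) + 1" and V: "D V = 0" "V \<noteq> 0" and v: "D v = 0"
  shows "\<exists>c. v = c *\<^sub>R V"
proof -
  obtain S where S: "linear S" "D \<circ> S = id"
    using linear_surjective_right_inverse[OF D] by auto
  have DS: "D (S w) = w" for w using S(2) by (metis comp_apply id_apply)
  define T where "T z = S (fst z) + snd z *\<^sub>R V" for z :: "'b \<times> real"
  have T: "linear T"
    by (intro linearI) (auto simp: T_def linear_add[OF S(1)] linear_scale[OF S(1)] algebra_simps)
  have DT: "D (T z) = fst z" for z
    by (simp add: T_def linear_add[OF D(1)] linear_scale[OF D(1)] DS V(1))
  have "inj T"
    unfolding linear_injective_0[OF T]
  proof (intro allI impI)
    fix z assume z: "T z = 0"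
    then have "fst z = 0" using DT[of z] by (simp add: linear_0[OF D(1)])
    moreover have "snd z = 0" using z V(2) by (simp add: T_def \<open>fst z = 0\<close> linear_0[OF S(1)])
    ultimately show "z = 0" by (simp add: prod_eq_iff)
  qed
  then have "dim (T ` UNIV) = DIM('a)"
    using dim_image_eq[OF T, of UNIV] dim by simp
  then have "span (range T) = UNIV" by (simp add: dim_eq_full)
  then have "range T = UNIV"
    using linear_subspace_image[OF T subspace_UNIV] by (metis span_eq_iff)
  then obtain z where z: "v = T z" by (metis surjD)
  then have "fst z = 0" using DT[of z] v by simp
  then show ?thesis using z by (auto simp: T_def linear_0[OF S(1)])
qed

text \<open>
  Extend \<open>f\<close> by the linear functional \<open>V \<bullet> x\<close> to a map between spaces of equal dimension. Its
  derivative at the base point is injective because the kernel of \<open>D\<close> is spanned by \<open>V\<close>, so the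
  extended map is injective near the base point. Along \<open>\<phi>\<close> the functional runs through a neighbourhood
  of its initial value; hence a nearby point of the level set shares its image with some \<open>\<phi> s\<close> and
  so equals it.
\<close>

lemma polynomial_level_set_flow_box:
  fixes f :: "'a::euclidean_space \<Rightarrow> 'b::euclidean_space" and \<phi> :: "real \<Rightarrow> 'a"
  assumes f: "polynomial_function f" and dim: "DIM('a) = DIM('b) + 1"
    and D: "(f has_derivative D) (at (\<phi> 0))" "surj D" "D V = 0" "V \<noteq> 0"
    and \<phi>: "(\<phi> has_vector_derivative V) (at 0)" "continuous_on UNIV \<phi>"
    and lev: "\<And>t. f (\<phi> t) = f (\<phi> 0)" and \<delta>: "\<delta> > 0"
  shows "\<exists>W. open W \<and> \<phi> 0 \<in> W \<and> (\<forall>p\<in>W. f p = f (\<phi> 0) \<longrightarrow> (\<exists>s. \<bar>s\<bar> < \<delta> \<and> p = \<phi> s))"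
proof -
  define p0 where "p0 = \<phi> 0"
  define f' where "f' p = frechet_derivative f (at p)" for p
  note f' = polynomial_function_frechet_derivative(1)[OF f, folded f'_def]
  note pf' = polynomial_function_frechet_derivative(2)[OF f, folded f'_def]
  have D_eq: "D = f' p0"
    unfolding p0_def by (rule has_derivative_unique[OF D(1) f'])
  define G where "G x = (f x, V \<bullet> x)" for x
  define G' where "G' x v = (f' x v, V \<bullet> v)" for x v
  have G': "(G has_derivative G' x) (at x)" for x
  proof -
    have "((\<lambda>x. V \<bullet> x) has_derivative (\<lambda>v. V \<bullet> v)) (at x)"
      by (rule bounded_linear_imp_has_derivative[OF bounded_linear_inner_right])
    from has_derivative_Pair[OF f' this] show ?thesis by (simp add: G_def[abs_def] G'_def[abs_def])
  qed
  have linG: "linear (G' x)" for x by (rule has_derivative_linear[OF G'])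
  have "inj (G' p0)"
    unfolding linear_injective_0[OF linG]
  proof (intro allI impI)
    fix v assume "G' p0 v = 0"
    then have v: "f' p0 v = 0" "V \<bullet> v = 0" by (auto simp: G'_def zero_prod_def)
    obtain c where "v = c *\<^sub>R V"
      using kernel_line[OF has_derivative_linear[OF D(1)] D(2) dim D(3,4)] v(1) unfolding D_eq by auto
    with v(2) D(4) show "v = 0" by simp
  qed
  then obtain g' where g': "linear g'" "g' \<circ> G' p0 = id"
    using linear_injective_left_inverse[OF linG] by auto
  have cont: "\<exists>d>0. \<forall>x. dist p0 x < d \<longrightarrow> onorm (\<lambda>v. G' x v - G' p0 v) < e" if e: "e > 0" for e
  proof -
    define h where "h x = (\<Sum>b\<in>Basis. norm (f' x b - f' p0 b))" for x
    have "continuous_on UNIV h"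
      unfolding h_def by (intro continuous_intros continuous_on_polymonial_function pf')
    then have "\<exists>d>0. \<forall>x. dist x p0 < d \<longrightarrow> dist (h x) (h p0) < e"
      using e unfolding continuous_on_iff by (metis UNIV_I)
    then obtain d where d: "d > 0" "\<And>x. dist x p0 < d \<Longrightarrow> dist (h x) (h p0) < e" by auto
    have "onorm (\<lambda>v. G' x v - G' p0 v) < e" if "dist p0 x < d" for x
    proof -
      have "bounded_linear (\<lambda>v. G' x v - G' p0 v)"
        by (intro bounded_linear_sub has_derivative_bounded_linear[OF G'])
      then have "onorm (\<lambda>v. G' x v - G' p0 v) \<le> (\<Sum>b\<in>Basis. norm (G' x b - G' p0 b))"
        by (rule onorm_componentwise)
      also have "\<dots> = h x" by (simp add: h_def G'_def norm_Pair)
      also have "\<dots> < e"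
        using d(2)[of x] that by (simp add: dist_commute dist_real_def h_def)
      finally show ?thesis .
    qed
    with d(1) show ?thesis by blast
  qed
  obtain r where r: "r > 0" "inj_on G (ball p0 r)"
    by (rule has_derivative_locally_injective[OF UNIV_I open_UNIV _ g'(2) G' cont])
       (use g'(1) in \<open>auto simp: linear_conv_bounded_linear\<close>)
  have "continuous (at 0) \<phi>" using \<phi>(2) by (simp add: continuous_on_eq_continuous_at)
  then obtain \<eta> where \<eta>: "\<eta> > 0" "\<And>s. \<bar>s\<bar> < \<eta> \<Longrightarrow> \<phi> s \<in> ball p0 r"
    using r(1) unfolding continuous_at_eps_delta p0_def by (auto simp: dist_norm norm_minus_commute)
  define \<tau> where "\<tau> s = V \<bullet> \<phi> s" for s
  have d\<tau>: "(\<tau> has_real_derivative V \<bullet> V) (at 0)"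
    unfolding \<tau>_def has_real_derivative_iff_has_vector_derivative
    by (rule bounded_linear.has_vector_derivative[OF bounded_linear_inner_right \<phi>(1)])
  have VV: "V \<bullet> V > 0" using D(4) by simp
  obtain d1 where d1: "d1 > 0" "\<And>h. 0 < h \<Longrightarrow> h < d1 \<Longrightarrow> \<tau> 0 < \<tau> h"
    using DERIV_pos_inc_right[OF d\<tau> VV] by auto
  obtain d2 where d2: "d2 > 0" "\<And>h. 0 < h \<Longrightarrow> h < d2 \<Longrightarrow> \<tau> (- h) < \<tau> 0"
    using DERIV_pos_inc_left[OF d\<tau> VV] by auto
  \<comment> \<open>On \<open>{-m..m}\<close> the curve stays in the ball of injectivity, and \<open>\<tau>\<close> takes values on both sides of \<open>\<tau> 0\<close>.\<close>
  define m where "m = min (min \<eta> \<delta>) (min d1 d2) / 2"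
  have m: "0 < m" "m < \<eta>" "m < \<delta>" "m < d1" "m < d2"
    unfolding m_def using \<eta>(1) \<delta> d1(1) d2(1) by auto
  define W where "W = ball p0 r \<inter> {x. \<tau> (- m) < V \<bullet> x} \<inter> {x. V \<bullet> x < \<tau> m}"
  have "open W"
    unfolding W_def by (intro open_Int open_ball open_Collect_less continuous_intros)
  moreover have "p0 \<in> W"
    using d1(2)[OF m(1,4)] d2(2)[OF m(1,5)] r(1) by (simp add: W_def \<tau>_def p0_def)
  moreover have "\<exists>s. \<bar>s\<bar> < \<delta> \<and> p = \<phi> s" if p: "p \<in> W" "f p = f p0" for p
  proof -
    have "continuous_on {-m..m} \<tau>"
      unfolding \<tau>_def by (intro continuous_intros continuous_on_subset[OF \<phi>(2)]) auto
    then obtain s where s: "- m \<le> s" "s \<le> m" "\<tau> s = V \<bullet> p"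
      using IVT'[of \<tau> "- m" "V \<bullet> p" m] p(1) m(1) by (auto simp: W_def)
    have "G p = G (\<phi> s)"
      using s(3) p(2) lev[of s] by (simp add: G_def \<tau>_def p0_def)
    moreover have "\<phi> s \<in> ball p0 r" using s m by (intro \<eta>(2)) auto
    moreover have "p \<in> ball p0 r" using p(1) by (simp add: W_def)
    ultimately have "p = \<phi> s" using r(2) by (auto dest: inj_onD)
    then show ?thesis using s m by (intro exI[of _ s]) auto
  qed
  ultimately show ?thesis unfolding p0_def by blast
qed

section \<open>Smooth parametrization of integral curves\<close>

text \<open>
  Finite differentiability is stated by recursion, so that closure under products and polynomial
  maps can be proved by induction on the order.
\<close>

primrec times_differentiable_on :: "nat \<Rightarrow> real set \<Rightarrow> (real \<Rightarrow> 'a::real_normed_vector) \<Rightarrow> bool" where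
  "times_differentiable_on 0 S g \<longleftrightarrow> True"
| "times_differentiable_on (Suc k) S g \<longleftrightarrow>
     (\<exists>g'. (\<forall>t\<in>S. (g has_vector_derivative g' t) (at t within S)) \<and> times_differentiable_on k S g')"

lemma times_differentiable_on_cong:
  "(\<And>t. t \<in> S \<Longrightarrow> g t = h t) \<Longrightarrow> times_differentiable_on k S g \<Longrightarrow> times_differentiable_on k S h"
proof (cases k)
  case (Suc j)
  assume eq: "\<And>t. t \<in> S \<Longrightarrow> g t = h t" and "times_differentiable_on k S g"
  then obtain g' where g': "\<forall>t\<in>S. (g has_vector_derivative g' t) (at t within S)" "times_differentiable_on j S g'"
    using Suc by auto
  have "(h has_vector_derivative g' t) (at t within S)" if "t \<in> S" for t
    using g'(1) that by (intro has_vector_derivative_transform[OF that, of h g]) (auto simp: eq)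
  then show ?thesis using g'(2) Suc by auto
qed simp

lemma times_differentiable_on_less:
  "times_differentiable_on (Suc k) S g \<Longrightarrow> times_differentiable_on k S g"
proof (induction k arbitrary: g)
  case (Suc k)
  then obtain g' where g': "\<forall>t\<in>S. (g has_vector_derivative g' t) (at t within S)" "times_differentiable_on (Suc k) S g'"
    by (metis times_differentiable_on.simps(2))
  then show ?case using Suc.IH[OF g'(2)] by auto
qed simp

lemma times_differentiable_on_const: "times_differentiable_on k S (\<lambda>t. c)"
proof (induction k arbitrary: c)
  case (Suc k)
  show ?case using Suc[of 0] by (auto intro!: exI[of _ "\<lambda>t. 0"])
qed simp

lemma times_differentiable_on_add:
  "times_differentiable_on k S g \<Longrightarrow> times_differentiable_on k S h \<Longrightarrow> times_differentiable_on k S (\<lambda>t. g t + h t)"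
proof (induction k arbitrary: g h)
  case (Suc k)
  obtain g' where g': "\<forall>t\<in>S. (g has_vector_derivative g' t) (at t within S)" "times_differentiable_on k S g'"
    using Suc.prems(1) by auto
  obtain h' where h': "\<forall>t\<in>S. (h has_vector_derivative h' t) (at t within S)" "times_differentiable_on k S h'"
    using Suc.prems(2) by auto
  have "\<forall>t\<in>S. ((\<lambda>t. g t + h t) has_vector_derivative g' t + h' t) (at t within S)"
    using g'(1) h'(1) by (auto intro: has_vector_derivative_add)
  then show ?case using Suc.IH[OF g'(2) h'(2)] by auto
qed simp

lemma times_differentiable_on_scaleR:
  "times_differentiable_on k S g \<Longrightarrow> times_differentiable_on k S h \<Longrightarrow> times_differentiable_on k S (\<lambda>t. g t *\<^sub>R h t)"
proof (induction k arbitrary: g h)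
  case (Suc k)
  obtain g' where g': "\<forall>t\<in>S. (g has_vector_derivative g' t) (at t within S)" "times_differentiable_on k S g'"
    using Suc.prems(1) by auto
  obtain h' where h': "\<forall>t\<in>S. (h has_vector_derivative h' t) (at t within S)" "times_differentiable_on k S h'"
    using Suc.prems(2) by auto
  have "\<forall>t\<in>S. ((\<lambda>t. g t *\<^sub>R h t) has_vector_derivative g t *\<^sub>R h' t + g' t *\<^sub>R h t) (at t within S)"
    using g'(1) h'(1)
    by (intro ballI has_vector_derivative_scaleR) (simp_all add: has_real_derivative_iff_has_vector_derivative)
  moreover have "times_differentiable_on k S (\<lambda>t. g t *\<^sub>R h' t + g' t *\<^sub>R h t)"
    using times_differentiable_on_less[OF Suc.prems(1)] times_differentiable_on_less[OF Suc.prems(2)] g'(2) h'(2)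
    by (intro times_differentiable_on_add Suc.IH)
  ultimately show ?case unfolding times_differentiable_on.simps by (intro exI conjI)
qed simp

lemma times_differentiable_on_bounded_linear:
  "bounded_linear F \<Longrightarrow> times_differentiable_on k S g \<Longrightarrow> times_differentiable_on k S (\<lambda>t. F (g t))"
proof (induction k arbitrary: g)
  case (Suc k)
  then obtain g' where g': "\<forall>t\<in>S. (g has_vector_derivative g' t) (at t within S)" "times_differentiable_on k S g'"
    by auto
  have "\<forall>t\<in>S. ((\<lambda>t. F (g t)) has_vector_derivative F (g' t)) (at t within S)"
    using g'(1) by (auto intro: bounded_linear.has_vector_derivative[OF Suc.prems(1)])
  then show ?case using Suc.IH[OF Suc.prems(1) g'(2)] by auto
qed simp

lemma times_differentiable_on_real_polynomial:
  assumes "real_polynomial_function r" and g: "times_differentiable_on k S g"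
  shows "times_differentiable_on k S (\<lambda>t. r (g t))"
  using assms(1)
proof (induction r rule: real_polynomial_function.induct)
  case (linear F)
  then show ?case by (rule times_differentiable_on_bounded_linear[OF _ g])
next
  case (mult r1 r2)
  then show ?case using times_differentiable_on_scaleR[of k S "\<lambda>t. r1 (g t)" "\<lambda>t. r2 (g t)"] by simp
qed (auto intro: times_differentiable_on_const times_differentiable_on_add)

lemma times_differentiable_on_sum:
  "(\<And>i. i \<in> I \<Longrightarrow> times_differentiable_on k S (g i)) \<Longrightarrow> times_differentiable_on k S (\<lambda>t. \<Sum>i\<in>I. g i t)"
  by (induction I rule: infinite_finite_induct)
     (auto intro: times_differentiable_on_const times_differentiable_on_add)

lemma times_differentiable_on_polynomial:
  fixes X :: "'a::real_normed_vector \<Rightarrow> 'b::euclidean_space"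
  assumes X: "polynomial_function X" and g: "times_differentiable_on k S g"
  shows "times_differentiable_on k S (\<lambda>t. X (g t))"
proof -
  have "times_differentiable_on k S (\<lambda>t. \<Sum>b\<in>Basis. (X (g t) \<bullet> b) *\<^sub>R b)"
    by (intro times_differentiable_on_sum times_differentiable_on_scaleR times_differentiable_on_const
        times_differentiable_on_real_polynomial[OF _ g] real_polynomial_function_inner_right X)
  then show ?thesis by (simp add: euclidean_representation)
qed

lemma times_differentiable_on_reciprocal:
  "times_differentiable_on k {0..<1} (\<lambda>s. 1 / (1 - s) :: real)"
proof (induction k)
  case (Suc k)
  have "((\<lambda>s. 1 / (1 - s)) has_vector_derivative (1 / (1 - t)) *\<^sub>R (1 / (1 - t))) (at t within {0..<1})"
    if "t \<in> {0..<1}" for t :: real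
    unfolding has_real_derivative_iff_has_vector_derivative[symmetric]
    using that by (auto intro!: derivative_eq_intros simp: divide_simps)
  then show ?case
    unfolding times_differentiable_on.simps
    using times_differentiable_on_scaleR[OF Suc Suc] by (intro exI conjI ballI)
qed simp

text \<open>
  The witnesses for different orders need not be compatible. Uniqueness of derivatives makes
  the iterated derivative a single sequence that serves all orders.
\<close>

lemma smooth_on_interval_if_times_differentiable_on:
  fixes g :: "real \<Rightarrow> 'a::real_normed_vector"
  assumes nb: "\<And>t. t \<in> S \<Longrightarrow> at t within S \<noteq> bot" and g: "\<And>k. times_differentiable_on k S g"
  shows "smooth_on_interval S g"
proof -
  define d where "d h t = vector_derivative h (at t within S)" for h :: "real \<Rightarrow> 'a" and t
  have step: "(\<forall>t\<in>S. (h has_vector_derivative d h t) (at t within S)) \<and> (\<forall>k. times_differentiable_on k S (d h))"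
    if h: "\<And>k. times_differentiable_on k S h" for h
  proof -
    have "times_differentiable_on k S (d h) \<and> (\<forall>t\<in>S. (h has_vector_derivative d h t) (at t within S))" for k
    proof -
      obtain h' where h': "\<forall>t\<in>S. (h has_vector_derivative h' t) (at t within S)" "times_differentiable_on k S h'"
        using h[of "Suc k"] by auto
      have "d h t = h' t" if "t \<in> S" for t
        unfolding d_def using h'(1) that nb by (intro vector_derivative_within) auto
      then show ?thesis using h' times_differentiable_on_cong[of S h' "d h" k] by auto
    qed
    then show ?thesis by auto
  qed
  have all: "times_differentiable_on k S ((d ^^ j) g)" for j k
  proof (induction j arbitrary: k)
    case (Suc j)
    then show ?case using step[of "(d ^^ j) g"] by simp
  qed (simp add: g)
  show ?thesis
    unfolding smooth_on_interval_def
    using step[OF all] by (intro exI[of _ "\<lambda>j. (d ^^ j) g"]) auto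
qed

lemma homeomorphism_halfline:
  "homeomorphism {0..<1} {0..} (\<lambda>s. s / (1 - s)) (\<lambda>t::real. t / (1 + t))"
proof (rule homeomorphismI)
  show "continuous_on {0..<1} (\<lambda>s. s / (1 - s) :: real)" by (intro continuous_intros) auto
  show "continuous_on {0..} (\<lambda>t::real. t / (1 + t))" by (intro continuous_intros) auto
qed (auto simp: field_simps)

text \<open>
  The half line is compressed to \<open>{0..<1}\<close> by \<open>s / (1 - s)\<close>. The compressed curve \<open>g\<close> satisfies
  \<open>g' = (1 - s)\<^sup>-\<^sup>2 X (g s)\<close>, whose right-hand side is as often differentiable as \<open>g\<close>; so \<open>g\<close> gains
  one order of differentiability, and all orders by induction.
\<close>

lemma polynomial_integral_curve_smooth_param:
  fixes X :: "'a::euclidean_space \<Rightarrow> 'a"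
  assumes X: "polynomial_function X"
    and \<gamma>: "\<And>t. t \<ge> 0 \<Longrightarrow> (\<gamma> has_vector_derivative X (\<gamma> t)) (at t)"
    and nz: "\<And>t. t \<ge> 0 \<Longrightarrow> X (\<gamma> t) \<noteq> 0"
    and hom: "homeomorphism {0..} C \<gamma> h"
  shows "smooth_curve_param C (\<gamma> 0) (\<lambda>s. \<gamma> (s / (1 - s)))"
proof -
  define c where "c s = 1 / (1 - s)" for s :: real
  define g where "g s = \<gamma> (s / (1 - s))" for s
  have g': "(g has_vector_derivative (c s *\<^sub>R c s) *\<^sub>R X (g s)) (at s within {0..<1})" if "s \<in> {0..<1}" for s
  proof -
    have "((\<lambda>s. s / (1 - s)) has_vector_derivative c s * c s) (at s)"
      unfolding has_real_derivative_iff_has_vector_derivative[symmetric] c_def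
      using that by (auto intro!: derivative_eq_intros simp: divide_simps)
    moreover have "(\<gamma> has_vector_derivative X (g s)) (at (s / (1 - s)))"
      unfolding g_def using that by (intro \<gamma>) auto
    ultimately have "(\<gamma> \<circ> (\<lambda>s. s / (1 - s)) has_vector_derivative (c s * c s) *\<^sub>R X (g s)) (at s)"
      by (rule vector_diff_chain_at)
    then show ?thesis
      by (simp add: g_def[abs_def] o_def has_vector_derivative_at_within)
  qed
  have nb: "at t within {0..<1} \<noteq> bot" if "t \<in> {0..<1}" for t :: real
  proof -
    have "t \<in> closure {t<..<1}" using that by simp
    also have "closure {t<..<1} \<subseteq> closure ({0..<1} - {t})" using that by (intro closure_mono) auto
    finally show ?thesis by (simp add: at_within_eq_bot_iff)
  qed
  have c: "times_differentiable_on k {0..<1} c" for k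
    unfolding c_def by (rule times_differentiable_on_reciprocal)
  have td: "times_differentiable_on k {0..<1} g" for k
  proof (induction k)
    case (Suc k)
    have "times_differentiable_on k {0..<1} (\<lambda>s. (c s *\<^sub>R c s) *\<^sub>R X (g s))"
      by (intro times_differentiable_on_scaleR c times_differentiable_on_polynomial[OF X] Suc)
    then show ?case unfolding times_differentiable_on.simps using g' by (intro exI conjI ballI)
  qed simp
  have "smooth_on_interval {0..<1} g"
    by (rule smooth_on_interval_if_times_differentiable_on[OF nb td])
  moreover have "vector_derivative g (at t within {0..<1}) \<noteq> 0" if "t \<in> {0..<1}" for t
    using vector_derivative_within[OF nb[OF that] g'[OF that]] nz[of "t / (1 - t)"] that
    by (simp add: c_def g_def)
  moreover have "homeomorphism {0..<1} C (\<gamma> \<circ> (\<lambda>s. s / (1 - s))) ((\<lambda>t. t / (1 + t)) \<circ> h)"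
    by (rule homeomorphism_compose[OF homeomorphism_halfline hom])
  ultimately show ?thesis
    unfolding smooth_curve_param_def g_def[abs_def] o_def by auto
qed

section \<open>Critical values in one dimension less\<close>

text \<open>
  The translates of the slab by the multiples of \<open>3 e\<close> in the direction \<open>a\<close> are pairwise disjoint,
  and about \<open>m / (3 e)\<close> of them fit into the ball of radius \<open>2 m\<close>. Their total volume is at most that of the ball.
\<close>

lemma measure_slab_le:
  fixes a :: "'b::euclidean_space"
  assumes a: "norm a = 1" and m: "0 < m" and e: "0 < e"
  shows "{z. norm z \<le> m \<and> \<bar>a \<bullet> z\<bar> \<le> e} \<in> lmeasurable"
    and "measure lebesgue {z. norm z \<le> m \<and> \<bar>a \<bullet> z\<bar> \<le> e} \<le>
           3 * unit_ball_vol DIM('b) * 2 ^ DIM('b) * e * m ^ (DIM('b) - 1)"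
proof -
  define S where "S = {z. norm z \<le> m \<and> \<bar>a \<bullet> z\<bar> \<le> e}"
  have "S = cball 0 m \<inter> {z. \<bar>a \<bullet> z\<bar> \<le> e}" by (auto simp: S_def)
  moreover have "closed {z. \<bar>a \<bullet> z\<bar> \<le> e}" by (intro closed_Collect_le continuous_intros)
  ultimately have "compact S" by (metis compact_Int_closed compact_cball)
  then have S: "S \<in> lmeasurable" by (rule lmeasurable_compact)
  \<comment> \<open>\<open>n + 1\<close> translates fit, and \<open>n + 1\<close> is at least \<open>m / (3 e)\<close>.\<close>
  define n where "n = nat \<lfloor>m / (3 * e)\<rfloor>"
  define T where "T k = (+) ((3 * e * real k) *\<^sub>R a) ` S" for k :: nat
  have T: "T k \<in> lmeasurable" "measure lebesgue (T k) = measure lebesgue S" for k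
    unfolding T_def using S by (auto simp: measure_translation measurable_translation)
  have disj: "disjoint_family_on T {..n}"
    unfolding disjoint_family_on_def
  proof (intro ballI impI)
    fix j k :: nat assume jk: "j \<noteq> k"
    show "T j \<inter> T k = {}"
    proof (rule ccontr)
      assume "T j \<inter> T k \<noteq> {}"
      then obtain y z where yz: "y \<in> S" "z \<in> S"
        and eq: "(3 * e * real j) *\<^sub>R a + y = (3 * e * real k) *\<^sub>R a + z"
        unfolding T_def by auto
      have "a \<bullet> a = 1" using a by (simp add: norm_eq_1)
      then have "3 * e * real j + a \<bullet> y = 3 * e * real k + a \<bullet> z"
        using arg_cong[OF eq, of "\<lambda>x. a \<bullet> x"] by (simp add: inner_add_right)
      then have "\<bar>3 * e * real j - 3 * e * real k\<bar> \<le> 2 * e"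
        using yz unfolding S_def by auto
      moreover have "3 * e * 1 \<le> 3 * e * \<bar>real j - real k\<bar>"
        using jk e by (intro mult_left_mono) auto
      moreover have "3 * e * \<bar>real j - real k\<bar> = \<bar>3 * e * real j - 3 * e * real k\<bar>"
        using e by (simp add: abs_mult flip: right_diff_distrib)
      ultimately show False using e by linarith
    qed
  qed
  have sub: "(\<Union>k\<in>{..n}. T k) \<subseteq> cball 0 (2 * m)"
  proof (intro UN_least subsetI)
    fix k x assume k: "k \<in> {..n}" and "x \<in> T k"
    then obtain y where y: "y \<in> S" "x = (3 * e * real k) *\<^sub>R a + y" unfolding T_def by auto
    have "real n \<le> m / (3 * e)" unfolding n_def using m e by (simp add: of_nat_nat)
    then have "real k \<le> m / (3 * e)" using k by (meson atMost_iff of_nat_mono order_trans)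
    then have "3 * e * real k \<le> m" using e by (simp add: field_simps)
    moreover have "norm x \<le> norm ((3 * e * real k) *\<^sub>R a) + norm y"
      unfolding y(2) by (rule norm_triangle_ineq)
    moreover have "norm ((3 * e * real k) *\<^sub>R a) = 3 * e * real k" using e a by simp
    moreover have "norm y \<le> m" using y(1) by (simp add: S_def)
    ultimately show "x \<in> cball 0 (2 * m)" by simp
  qed
  have "real (Suc n) * measure lebesgue S = (\<Sum>k\<in>{..n}. measure lebesgue (T k))"
    by (simp add: T)
  also have "\<dots> = measure lebesgue (\<Union>k\<in>{..n}. T k)"
  proof (rule measure_finite_Union[symmetric])
    show "T ` {..n} \<subseteq> sets lebesgue" using T(1) by (blast dest: fmeasurableD)
    show "emeasure lebesgue (T k) \<noteq> \<infinity>" for k using fmeasurableD2[OF T(1)] by simp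
  qed (use disj in simp_all)
  also have "\<dots> \<le> measure lebesgue (cball (0::'b) (2 * m))"
    using T by (intro measure_mono_fmeasurable sub) auto
  also have "\<dots> = unit_ball_vol DIM('b) * (2 * m) ^ DIM('b)"
    using m by (simp add: content_cball)
  finally have "real (Suc n) * measure lebesgue S \<le> unit_ball_vol DIM('b) * (2 * m) ^ DIM('b)" .
  moreover have "m / (3 * e) * measure lebesgue S \<le> real (Suc n) * measure lebesgue S"
  proof (intro mult_right_mono)
    show "m / (3 * e) \<le> real (Suc n)" unfolding n_def using m e
      by (simp add: of_nat_nat) linarith
  qed simp
  ultimately have "m / (3 * e) * measure lebesgue S \<le> unit_ball_vol DIM('b) * (2 * m) ^ DIM('b)"
    by linarith
  then have "m * measure lebesgue S \<le> 3 * e * (unit_ball_vol DIM('b) * (2 * m) ^ DIM('b))"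
    using e by (simp add: field_simps)
  also have "(2 * m) ^ DIM('b) = 2 ^ DIM('b) * (m * m ^ (DIM('b) - 1))"
    by (simp add: power_mult_distrib flip: power_eq_if)
       (metis DIM_positive Suc_pred power_Suc)
  also have "3 * e * (unit_ball_vol DIM('b) * (2 ^ DIM('b) * (m * m ^ (DIM('b) - 1)))) =
      m * (3 * unit_ball_vol DIM('b) * 2 ^ DIM('b) * e * m ^ (DIM('b) - 1))"
    by (simp add: ac_simps)
  finally show "measure lebesgue {z. norm z \<le> m \<and> \<bar>a \<bullet> z\<bar> \<le> e} \<le>
           3 * unit_ball_vol DIM('b) * 2 ^ DIM('b) * e * m ^ (DIM('b) - 1)"
    using m by (simp add: S_def)
  show "{z. norm z \<le> m \<and> \<bar>a \<bullet> z\<bar> \<le> e} \<in> lmeasurable" using S by (simp add: S_def)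
qed

text \<open>
  Cover the null set by countably many non-overlapping cubes of small total volume. The hypothesis
  bounds the volume of the image of the part in each cube by a fixed multiple of the volume of
  that cube.
\<close>

lemma negligible_image_if_small_on_balls:
  fixes f :: "'a::euclidean_space \<Rightarrow> 'b::euclidean_space"
  assumes S: "negligible S" "bounded S" and M: "M \<ge> 0" and \<rho>: "\<rho> > 0"
    and small: "\<And>x r. x \<in> S \<Longrightarrow> 0 < r \<Longrightarrow> r \<le> \<rho> \<Longrightarrow>
      \<exists>U. U \<in> lmeasurable \<and> f ` (S \<inter> cball x r) \<subseteq> U \<and> measure lebesgue U \<le> M * r ^ DIM('a)"
  shows "negligible (f ` S)"
  unfolding negligible_outer_le
proof (intro allI impI)
  fix e :: real assume e: "e > 0"
  define d where "d = real DIM('a)"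
  have d: "d \<ge> 1" unfolding d_def by (simp add: DIM_ge_Suc0)
  define M' where "M' = M * d ^ DIM('a)"
  have M': "M' \<ge> 0" using M d by (simp add: M'_def)
  have eM: "e / (M' + 1) > 0" using e M' by simp
  obtain T where T: "open T" "S \<subseteq> T" "T \<in> lmeasurable" "measure lebesgue T \<le> e / (M' + 1)"
  proof -
    have Sl: "S \<in> lmeasurable" using S(1) by (rule negligible_imp_measurable)
    then obtain T where T: "open T" "S \<subseteq> T" "T - S \<in> lmeasurable" "emeasure lebesgue (T - S) < ennreal (e / (M' + 1))"
      using sets_lebesgue_outer_open[OF _ eM, of S] by (auto dest: fmeasurableD)
    have "T \<in> lmeasurable" using Sl T fmeasurable_Diff_D by blast
    moreover have "measure lebesgue T = measure lebesgue (T - S)"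
      using S(1) \<open>T \<in> lmeasurable\<close> by (simp add: measure_Diff_null_set negligible_iff_null_sets fmeasurableD)
    moreover have "measure lebesgue (T - S) \<le> e / (M' + 1)"
      using T(3,4) eM by (simp add: emeasure_eq_measure2 ennreal_less_iff)
    ultimately show ?thesis using that T by simp
  qed
  \<comment> \<open>A cube inside a ball of radius \<open>\<rho> / (2 d)\<close> has side \<open>s\<close> with \<open>d s \<le> \<rho>\<close>, so the
      hypothesis applies with radius \<open>d s\<close>.\<close>
  have "\<forall>x. \<exists>r>0. r \<le> \<rho> / (2 * d) \<and> (x \<in> S \<longrightarrow> ball x r \<subseteq> T)"
  proof
    fix x
    show "\<exists>r>0. r \<le> \<rho> / (2 * d) \<and> (x \<in> S \<longrightarrow> ball x r \<subseteq> T)"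
    proof (cases "x \<in> S")
      case True
      then obtain \<epsilon> where "\<epsilon> > 0" "ball x \<epsilon> \<subseteq> T" using T by (meson openE subsetD)
      then show ?thesis using \<rho> d
        by (intro exI[of _ "min \<epsilon> (\<rho> / (2 * d))"]) auto
    next
      case False
      then show ?thesis using \<rho> d by (intro exI[of _ "\<rho> / (2 * d)"]) auto
    qed
  qed
  then obtain R where R: "\<And>x. R x > 0" "\<And>x. R x \<le> \<rho> / (2 * d)" "\<And>x. x \<in> S \<Longrightarrow> ball x (R x) \<subseteq> T"
    by metis
  have gauge: "gauge (\<lambda>x. ball x (R x))" using R(1) by (simp add: gauge_def)
  obtain B where B: "\<And>x. x \<in> S \<Longrightarrow> norm x \<le> B" using S(2) bounded_iff by blast
  define c where "c = \<bar>B\<bar> + 1"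
  have c: "S \<subseteq> cbox (- c *\<^sub>R One) (c *\<^sub>R One)" "box (- c *\<^sub>R One :: 'a) (c *\<^sub>R One) \<noteq> {}"
  proof
    fix x assume x: "x \<in> S"
    have "\<bar>x \<bullet> i\<bar> \<le> c" if "i \<in> Basis" for i
      using Basis_le_norm[OF that, of x] B[OF x] unfolding c_def by linarith
    then show "x \<in> cbox (- c *\<^sub>R One) (c *\<^sub>R One)" by (force simp: mem_box abs_le_iff)
  qed (use abs_ge_zero[of B] in \<open>simp add: box_ne_empty c_def del: abs_ge_zero\<close>)
  obtain \<D> where \<D>': "countable \<D>" "\<Union>\<D> \<subseteq> cbox (- c *\<^sub>R One) (c *\<^sub>R One)"
    "\<And>K. K \<in> \<D> \<Longrightarrow> interior K \<noteq> {} \<and> (\<exists>c d. K = cbox c d)"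
    "pairwise (\<lambda>A B. interior A \<inter> interior B = {}) \<D>"
    "\<And>K. K \<in> \<D> \<Longrightarrow> \<exists>x \<in> S \<inter> K. K \<subseteq> ball x (R x)"
    "\<And>u v. cbox u v \<in> \<D> \<Longrightarrow> \<exists>n. \<forall>i \<in> Basis. v \<bullet> i - u \<bullet> i = ((c *\<^sub>R One) \<bullet> i - (- c *\<^sub>R One) \<bullet> i) / 2 ^ n"
    "S \<subseteq> \<Union>\<D>"
    by (rule covering_lemma[OF c gauge]) (rule that)
  note \<D> = \<D>'(1,3-7)
  have "\<exists>U. U \<in> lmeasurable \<and> f ` (S \<inter> K) \<subseteq> U \<and> measure lebesgue U \<le> M' * measure lebesgue K"
    if K: "K \<in> \<D>" for K
  proof -
    obtain u v where uv: "K = cbox u v" using \<D>(2)[OF K] by (elim conjE exE)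
    obtain x where x: "x \<in> S" "x \<in> K" "K \<subseteq> ball x (R x)" using \<D>(4)[OF K] by (elim bexE IntE)
    obtain n where n: "\<forall>i\<in>Basis. v \<bullet> i - u \<bullet> i = ((c *\<^sub>R One) \<bullet> i - (- c *\<^sub>R One) \<bullet> i) / 2 ^ n"
      using \<D>(5)[OF K[unfolded uv]] by (elim exE)
    define s where "s = 2 * c / 2 ^ n"
    have s: "s > 0" by (simp add: s_def c_def)
    have vu: "v \<bullet> i - u \<bullet> i = s" if "i \<in> Basis" for i
      using bspec[OF n that] that by (simp add: s_def)
    have le: "norm (y - x) \<le> d * s" if "y \<in> K" for y
    proof -
      have "norm (y - x) \<le> (\<Sum>i\<in>Basis. \<bar>(y - x) \<bullet> i\<bar>)" by (rule norm_le_l1)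
      also have "\<dots> \<le> (\<Sum>i\<in>(Basis::'a set). s)"
      proof (rule sum_mono)
        fix i :: 'a assume i: "i \<in> Basis"
        have "u \<bullet> i \<le> y \<bullet> i" "y \<bullet> i \<le> v \<bullet> i" "u \<bullet> i \<le> x \<bullet> i" "x \<bullet> i \<le> v \<bullet> i"
          using that x(2) i unfolding uv by (auto simp: mem_box)
        then show "\<bar>(y - x) \<bullet> i\<bar> \<le> s" using vu[OF i] by (simp add: inner_diff_left)
      qed
      finally show ?thesis by (simp add: d_def)
    qed
    have "u \<in> K" "v \<in> K" unfolding uv using vu s by (force simp: mem_box)+
    then have "norm (u - x) < R x" "norm (v - x) < R x"
      using x(3) by (auto simp: dist_norm norm_minus_commute subset_iff)
    moreover have "norm (v - u) \<le> norm (v - x) + norm (u - x)"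
      using norm_triangle_ineq4[of "v - x" "u - x"] by simp
    moreover obtain i :: 'a where i: "i \<in> Basis" using nonempty_Basis by blast
    have "s \<le> norm (v - u)"
      using Basis_le_norm[OF i, of "v - u"] vu[OF i] s by (simp add: inner_diff_left)
    ultimately have "s \<le> 2 * (\<rho> / (2 * d))" using R(2)[of x] by linarith
    then have "d * s \<le> \<rho>" using d by (simp add: field_simps)
    then obtain U where U: "U \<in> lmeasurable" "f ` (S \<inter> cball x (d * s)) \<subseteq> U"
       "measure lebesgue U \<le> M * (d * s) ^ DIM('a)"
      using small[OF x(1), of "d * s"] s d by auto
    have "S \<inter> K \<subseteq> S \<inter> cball x (d * s)"
      using le by (auto simp: dist_norm norm_minus_commute)
    then have "f ` (S \<inter> K) \<subseteq> U" using U(2) by blast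
    moreover have "measure lebesgue K = s ^ DIM('a)"
    proof -
      have "u \<bullet> i \<le> v \<bullet> i" if "i \<in> Basis" for i using vu[OF that] s by simp
      then have "measure lborel (cbox u v) = (\<Prod>i\<in>Basis. v \<bullet> i - u \<bullet> i)" by (simp add: content_cbox_cases inner_diff_left)
      also have "\<dots> = (\<Prod>i\<in>(Basis::'a set). s)" by (intro prod.cong refl vu)
      finally have "measure lebesgue K = (\<Prod>i\<in>(Basis::'a set). s)" unfolding uv by simp
      also have "\<dots> = s ^ DIM('a)" by simp
      finally show ?thesis .
    qed
    ultimately show ?thesis using U(1,3)
      by (intro exI[of _ U]) (simp add: M'_def power_mult_distrib mult.assoc)
  qed
  then obtain U where U: "\<And>K. K \<in> \<D> \<Longrightarrow> U K \<in> lmeasurable" "\<And>K. K \<in> \<D> \<Longrightarrow> f ` (S \<inter> K) \<subseteq> U K"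
    "\<And>K. K \<in> \<D> \<Longrightarrow> measure lebesgue (U K) \<le> M' * measure lebesgue K"
    by metis
  have fin: "measure lebesgue (\<Union>K\<in>I. U K) \<le> e" if I: "I \<subseteq> \<D>" "finite I" for I
  proof -
    have "{} \<notin> I" using \<D>(2) I by force
    moreover have "\<And>K. K \<in> I \<Longrightarrow> \<exists>a b. K = cbox a b" using \<D>(2) I by blast
    ultimately have div: "I division_of \<Union>I"
      using pairwise_subset[OF \<D>(3) I(1)] I(2) unfolding pairwise_def division_of_def by force
    have "\<Union>I \<subseteq> T"
    proof
      fix y assume "y \<in> \<Union>I"
      then obtain K where K: "K \<in> I" "y \<in> K" by blast
      then obtain x where "x \<in> S" "K \<subseteq> ball x (R x)" using \<D>(4) I by blast
      then show "y \<in> T" using R(3) K by blast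
    qed
    then have IT: "measure lebesgue (\<Union>I) \<le> measure lebesgue T"
      using T(3) div by (intro measure_mono_fmeasurable) (auto dest: lmeasurable_division)
    have "measure lebesgue (\<Union>K\<in>I. U K) \<le> (\<Sum>K\<in>I. measure lebesgue (U K))"
      using U(1) I by (intro measure_UNION_le) (auto dest: fmeasurableD)
    also have "\<dots> \<le> (\<Sum>K\<in>I. M' * measure lebesgue K)"
      using U(3) I by (intro sum_mono) auto
    also have "\<dots> = M' * measure lebesgue (\<Union>I)"
    proof -
      have "(\<Sum>K\<in>I. measure lebesgue K) = (\<Sum>K\<in>I. measure lborel K)"
        using I \<D>(2) by (intro sum.cong) force+
      then show ?thesis using content_division[OF div] by (simp add: sum_distrib_left[symmetric])
    qed
    also have "\<dots> \<le> M' * (e / (M' + 1))" using IT T(4) M' by (intro mult_left_mono) auto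
    also have "\<dots> \<le> e" using M' e by (simp add: field_simps)
    finally show ?thesis .
  qed
  show "\<exists>W. f ` S \<subseteq> W \<and> W \<in> lmeasurable \<and> measure lebesgue W \<le> e"
  proof (intro exI conjI)
    show "f ` S \<subseteq> (\<Union>K\<in>\<D>. U K)" using \<D>(6) U(2) by blast
    show "(\<Union>K\<in>\<D>. U K) \<in> lmeasurable"
      by (intro fmeasurable_UN_bound[OF \<D>(1) U(1) fin])
    show "measure lebesgue (\<Union>K\<in>\<D>. U K) \<le> e"
      by (intro measure_UN_bound[OF \<D>(1) U(1) fin])
  qed
qed

text \<open>
  At a critical point the image of the derivative lies in a
  hyperplane, so a ball of radius \<open>r\<close> is mapped into a slab of width \<open>O(r)\<close> and thickness
  \<open>O(r\<^sup>2)\<close>. Its volume is of the order of \<open>r\<close> to the dimension of the domain, as required by the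
  covering argument. These volumes add up to an arbitrarily small total because the
  critical points form a null set; for larger critical sets the same estimate only gives a bounded total.
\<close>

lemma negligible_critical_values_one_more_dimension:
  fixes f :: "'a::euclidean_space \<Rightarrow> 'b::euclidean_space"
  assumes dim: "DIM('a) = DIM('b) + 1" and C: "negligible C"
    and crit: "\<And>x. x \<in> C \<Longrightarrow> \<exists>D B r. linear D \<and> \<not> surj D \<and> r > 0 \<and>
      (\<forall>y. norm (y - x) < r \<longrightarrow> norm (f y - f x - D (y - x)) \<le> B * (norm (y - x))\<^sup>2)"
  shows "negligible (f ` C)"
proof -
  \<comment> \<open>Countably many pieces on which all constants are uniform.\<close>
  define P where "P n x \<longleftrightarrow> norm x \<le> real n \<and> (\<exists>D. linear D \<and> \<not> surj D \<and> (\<forall>v. norm (D v) \<le> real (Suc n) * norm v) \<and>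
    (\<forall>y. norm (y - x) < 1 / real (Suc n) \<longrightarrow> norm (f y - f x - D (y - x)) \<le> real (Suc n) * (norm (y - x))\<^sup>2))" for n x
  define S where "S n = {x \<in> C. P n x}" for n
  have "negligible (f ` S n)" for n
  proof (rule negligible_image_if_small_on_balls)
    define N where "N = real (Suc n)"
    define V where "V = 3 * unit_ball_vol DIM('b) * 2 ^ DIM('b)"
    show "negligible (S n)" using C by (rule negligible_subset) (auto simp: S_def)
    show "bounded (S n)" unfolding bounded_iff S_def P_def by blast
    show "0 < 1 / (2 * N)" by (simp add: N_def)
    have N: "N \<ge> 1" by (simp add: N_def)
    show "0 \<le> V * N * (2 * N) ^ (DIM('b) - 1)"
      using N by (simp add: V_def)
    fix x r assume x: "x \<in> S n" and r: "0 < r" "r \<le> 1 / (2 * N)"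
    have r1: "r < 1 / N" "r \<le> 1"
    proof -
      have "1 / (2 * N) < 1 / N" "1 / (2 * N) \<le> 1" using N by (simp_all add: field_simps)
      then show "r < 1 / N" "r \<le> 1" using r by linarith+
    qed
    obtain D where D: "linear D" "\<not> surj D" "\<And>v. norm (D v) \<le> N * norm v"
      and f: "\<And>y. norm (y - x) < 1 / N \<Longrightarrow> norm (f y - f x - D (y - x)) \<le> N * (norm (y - x))\<^sup>2"
      using x unfolding S_def P_def N_def by blast
    have "subspace (range D)" by (rule linear_subspace_image[OF D(1) subspace_UNIV])
    then have "dim (range D) < DIM('b)"
      using D(2) dim_eq_full[of "range D"] dim_subset_UNIV[of "range D"]
      by (metis le_neq_implies_less span_eq_iff)
    then obtain b where b: "b \<noteq> 0" "range D \<subseteq> {x. b \<bullet> x = 0}"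
      using lowdim_subset_hyperplane[of "range D"] span_base by blast
    define a where "a = b /\<^sub>R norm b"
    have a: "norm a = 1" "\<And>v. a \<bullet> D v = 0"
      using b by (auto simp: a_def)
    define m where "m = 2 * N * r"
    define e where "e = N * r\<^sup>2"
    have me: "0 < m" "0 < e" using N r by (simp_all add: m_def e_def)
    define U where "U = (+) (f x) ` {z. norm z \<le> m \<and> \<bar>a \<bullet> z\<bar> \<le> e}"
    have "U \<in> lmeasurable"
      unfolding U_def by (intro measurable_translation measure_slab_le(1)[OF a(1) me])
    moreover have "f ` (S n \<inter> cball x r) \<subseteq> U"
    proof clarify
      fix y assume "y \<in> cball x r"
      then have y: "norm (y - x) \<le> r" by (simp add: dist_norm norm_minus_commute)
      define w where "w = f y - f x - D (y - x)"
      have "norm w \<le> N * (norm (y - x))\<^sup>2" unfolding w_def using f y r1 by simp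
      also have "\<dots> \<le> N * r\<^sup>2" using y N by (intro mult_left_mono power_mono) auto
      finally have w: "norm w \<le> e" by (simp add: e_def)
      have Dy: "norm (D (y - x)) \<le> N * r" using D(3)[of "y - x"] y N
        by (meson mult_left_mono order_trans zero_le_one)
      have "e \<le> N * r" using r r1(2) N by (simp add: e_def power2_eq_square mult_left_le)
      then have "norm (f y - f x) \<le> m"
        using norm_triangle_ineq[of w "D (y - x)"] w Dy by (simp add: w_def m_def)
      moreover have "\<bar>a \<bullet> (f y - f x)\<bar> \<le> e"
      proof -
        have "a \<bullet> (f y - f x) = a \<bullet> w" using a(2)[of "y - x"] by (simp add: w_def inner_diff_right)
        also have "\<bar>\<dots>\<bar> \<le> norm a * norm w" by (rule Cauchy_Schwarz_ineq2)
        finally show ?thesis using w a(1) by simp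
      qed
      ultimately show "f y \<in> U" unfolding U_def by (intro image_eqI[of _ _ "f y - f x"]) auto
    qed
    moreover have "measure lebesgue U \<le> V * N * (2 * N) ^ (DIM('b) - 1) * r ^ DIM('a)"
    proof -
      have "measure lebesgue U \<le> V * e * m ^ (DIM('b) - 1)"
        unfolding U_def V_def measure_translation by (rule measure_slab_le(2)[OF a(1) me])
      also have "\<dots> = V * N * (2 * N) ^ (DIM('b) - 1) * (r\<^sup>2 * r ^ (DIM('b) - 1))"
        by (simp add: e_def m_def power_mult_distrib)
      also have "r\<^sup>2 * r ^ (DIM('b) - 1) = r ^ DIM('a)"
      proof -
        have "2 + (DIM('b) - 1) = DIM('a)" using dim DIM_positive[where 'a='b] by linarith
        then show ?thesis by (metis power_add)
      qed
      finally show ?thesis .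
    qed
    ultimately show "\<exists>U. U \<in> lmeasurable \<and> f ` (S n \<inter> cball x r) \<subseteq> U \<and>
        measure lebesgue U \<le> V * N * (2 * N) ^ (DIM('b) - 1) * r ^ DIM('a)" by blast
  qed
  then have "negligible (\<Union>n. f ` S n)" by (rule negligible_Union_nat)
  moreover have "f ` C \<subseteq> (\<Union>n. f ` S n)"
  proof clarify
    fix x assume x: "x \<in> C"
    obtain D B r where D: "linear D" "\<not> surj D" and r: "r > 0"
      and f: "\<And>y. norm (y - x) < r \<Longrightarrow> norm (f y - f x - D (y - x)) \<le> B * (norm (y - x))\<^sup>2"
      using crit[OF x] by blast
    obtain B' where B': "\<And>v. norm (D v) \<le> B' * norm v" using linear_bounded[OF D(1)] by blast
    obtain n :: nat where n: "real n > max (max (norm x) B) (max B' (1 / r))" using reals_Archimedean2 by blast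
    have "norm x \<le> real n" using n by simp
    moreover have "norm (D v) \<le> real (Suc n) * norm v" for v
      using n by (intro order_trans[OF B' mult_right_mono]) auto
    moreover have "norm (f y - f x - D (y - x)) \<le> real (Suc n) * (norm (y - x))\<^sup>2" if "norm (y - x) < 1 / real (Suc n)" for y
    proof -
      have "1 / r < real (Suc n)" using n by simp
      then have "1 / real (Suc n) < r" using r by (simp add: field_simps)
      then have "norm (f y - f x - D (y - x)) \<le> B * (norm (y - x))\<^sup>2" using that f by simp
      also have "\<dots> \<le> real (Suc n) * (norm (y - x))\<^sup>2" using n by (intro mult_right_mono) auto
      finally show ?thesis .
    qed
    ultimately have "P n x" using D unfolding P_def by blast
    then show "f x \<in> (\<Union>n. f ` S n)" using x by (auto simp: S_def)
  qed
  ultimately show ?thesis using negligible_subset by blast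
qed

lemma negligible_if_finite_slices:
  fixes S :: "('a::euclidean_space \<times> real) set"
  assumes S: "S \<in> sets borel" and fin: "\<And>y. finite {t. (y, t) \<in> S}"
  shows "negligible S"
proof -
  have sets: "S \<in> sets (lborel \<Otimes>\<^sub>M lborel)" using S unfolding lborel_prod by simp
  have "emeasure (lborel \<Otimes>\<^sub>M lborel) S = (\<integral>\<^sup>+ y. emeasure lborel (Pair y -` S) \<partial>lborel)"
    by (rule lborel.emeasure_pair_measure_alt[OF sets])
  also have "\<dots> = (\<integral>\<^sup>+ y. 0 \<partial>(lborel :: 'a measure))"
  proof (rule nn_integral_cong)
    fix y
    have "Pair y -` S = {t. (y, t) \<in> S}" by auto
    then show "emeasure lborel (Pair y -` S) = 0"
      using fin[of y] by (simp add: emeasure_lborel_countable countable_finite)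
  qed
  finally have "emeasure lborel S = 0" unfolding lborel_prod by simp
  then have "S \<in> null_sets lborel" using S by (intro null_setsI) auto
  then show ?thesis by (simp add: negligible_iff_null_sets null_sets_completionI)
qed

lemma polynomial_function_quadratic_remainder:
  fixes f :: "'a::euclidean_space \<Rightarrow> 'b::euclidean_space"
  assumes f: "polynomial_function f" and D: "(f has_derivative D) (at x)"
  shows "\<exists>B. \<forall>y. norm (y - x) < 1 \<longrightarrow> norm (f y - f x - D (y - x)) \<le> B * (norm (y - x))\<^sup>2"
proof -
  define f' where "f' p = frechet_derivative f (at p)" for p
  note f' = polynomial_function_frechet_derivative(1)[OF f, folded f'_def]
  note pf' = polynomial_function_frechet_derivative(2)[OF f, folded f'_def]
  have D_eq: "D = f' x" by (rule has_derivative_unique[OF D f'])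
  define R where "R = norm x + 1"
  have "\<forall>b. \<exists>L>0. \<forall>p\<in>cball 0 R. \<forall>q\<in>cball 0 R. norm (f' p b - f' q b) \<le> L * norm (p - q)"
    by (intro allI polynomial_function_lipschitz_on_cball pf')
  then obtain L where L: "\<And>b. L b > 0"
     "\<And>b p q. p \<in> cball 0 R \<Longrightarrow> q \<in> cball 0 R \<Longrightarrow> norm (f' p b - f' q b) \<le> L b * norm (p - q)" by metis
  \<comment> \<open>The operator norm is at most the sum of the norms of the images of the basis vectors.\<close>
  define B where "B = (\<Sum>b\<in>Basis. L b)"
  have "norm (f y - f x - D (y - x)) \<le> B * (norm (y - x))\<^sup>2" if y: "norm (y - x) < 1" for y
  proof -
    define r where "r = norm (y - x)"
    define g where "g z = f z - D z" for z
    have lin: "linear D" by (rule has_derivative_linear[OF D])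
    have "norm (g y - g x) \<le> (B * r) * norm (y - x)"
    proof (rule differentiable_bound[OF convex_cball[of x r]])
      fix z assume z: "z \<in> cball x r"
      have "(D has_derivative D) (at z within cball x r)"
        by (rule bounded_linear_imp_has_derivative[OF has_derivative_bounded_linear[OF D]])
      then show "(g has_derivative (\<lambda>v. f' z v - D v)) (at z within cball x r)"
        unfolding g_def by (intro has_derivative_diff has_derivative_at_withinI[OF f'])
      have "onorm (\<lambda>v. f' z v - D v) \<le> (\<Sum>b\<in>Basis. norm (f' z b - D b))"
        by (intro onorm_componentwise bounded_linear_sub has_derivative_bounded_linear[OF f']
            has_derivative_bounded_linear[OF D])
      also have "\<dots> \<le> (\<Sum>b\<in>(Basis::'a set). L b * r)"
      proof (rule sum_mono)
        fix b :: 'a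
        have zx: "norm (z - x) \<le> r" using z by (simp add: dist_norm norm_minus_commute)
        have "norm z \<le> norm x + norm (z - x)" using norm_triangle_sub[of z x] by simp
        then have "z \<in> cball 0 R" "x \<in> cball 0 R" using zx y by (simp_all add: R_def r_def)
        then have "norm (f' z b - f' x b) \<le> L b * norm (z - x)" by (rule L(2))
        also have "\<dots> \<le> L b * r" using zx L(1)[of b] by (intro mult_left_mono) auto
        finally show "norm (f' z b - D b) \<le> L b * r" by (simp add: D_eq)
      qed
      finally show "onorm (\<lambda>v. f' z v - D v) \<le> B * r" by (simp add: B_def sum_distrib_right)
    qed (auto simp: r_def dist_norm norm_minus_commute)
    moreover have "g y - g x = f y - f x - D (y - x)"
      by (simp add: g_def linear_diff[OF lin])
    ultimately show ?thesis by (simp add: r_def power2_eq_square mult.assoc)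
  qed
  then show ?thesis by blast
qed

section \<open>The homotopy as a rescaled polynomial map\<close>

text \<open>
  Determinants need a coordinate space. The index type \<open>'n + 'n + 'n\<close> enumerates the coordinates of
  a triple.
\<close>

definition pack :: "('n::finite) triple \<Rightarrow> real^('n + 'n + 'n)" where
  "pack y = (\<chi> k. case k of Inl i \<Rightarrow> fst y $ i | Inr (Inl i) \<Rightarrow> fst (snd y) $ i | Inr (Inr i) \<Rightarrow> snd (snd y) $ i)"

definition unpack :: "real^(('n::finite) + 'n + 'n) \<Rightarrow> 'n triple" where
  "unpack u = ((\<chi> i. u $ Inl i), (\<chi> i. u $ Inr (Inl i)), (\<chi> i. u $ Inr (Inr i)))"

lemma linear_pack: "linear pack"
  by (intro linearI) (auto simp: pack_def vec_eq_iff split: sum.split)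

lemma linear_unpack: "linear unpack"
  by (intro linearI) (auto simp: unpack_def vec_eq_iff)

lemma pack_unpack: "pack (unpack u) = u"
  by (auto simp: pack_def unpack_def vec_eq_iff split: sum.split)

lemma unpack_pack: "unpack (pack y) = y"
  by (cases y) (auto simp: pack_def unpack_def)

lemma triple_kernel_field:
  fixes f :: "('n::finite) triple \<times> real \<Rightarrow> 'n triple"
  assumes "polynomial_function f"
  shows "\<exists>T. polynomial_function T \<and> (\<forall>p D. (f has_derivative D) (at p) \<longrightarrow>
    D (T p) = 0 \<and> (surj D \<longrightarrow> T p \<noteq> 0) \<and> (snd (T p) \<noteq> 0 \<longleftrightarrow> inj (\<lambda>v. D (v, 0))))"
proof (rule polynomial_kernel_field[OF assms linear_pack linear_unpack pack_unpack unpack_pack])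
  fix T assume T: "polynomial_function T"
    and 1: "\<And>p D. (f has_derivative D) (at p) \<Longrightarrow> D (T p) = 0"
    and 2: "\<And>p D. (f has_derivative D) (at p) \<Longrightarrow> surj D \<Longrightarrow> T p \<noteq> 0"
    and 3: "\<And>p D. (f has_derivative D) (at p) \<Longrightarrow> snd (T p) \<noteq> 0 \<longleftrightarrow> inj (\<lambda>v. D (v, 0))"
  show ?thesis
  proof (intro exI[of _ T] conjI allI impI T)
    fix p D assume D: "(f has_derivative D) (at p)"
    show "D (T p) = 0" by (rule 1[OF D])
    show "snd (T p) \<noteq> 0 \<longleftrightarrow> inj (\<lambda>v. D (v, 0))" by (rule 3[OF D])
    assume "surj D" with D show "T p \<noteq> 0" by (rule 2)
  qed
qed

lemma diag_mult: "diag z *v x = (\<chi> i. z $ i * x $ i)"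
  by (simp add: diag_def matrix_vector_mult_def vec_eq_iff if_distrib if_distribR cong: if_cong)

definition lagrange_grad :: "real^('n::finite)^'n \<Rightarrow> real^'n \<Rightarrow> 'n triple \<Rightarrow> real^'n" where
  "lagrange_grad A q y = (A + transpose A) *v fst y + q - fst (snd y) - transpose A *v snd (snd y)"

text \<open>
  With the parameter \<open>\<nu> = 1 / \<mu>\<close> the homotopy equation separates into a polynomial map of \<open>(y, \<nu>)\<close> and
  a constant given by the starting point. At \<open>\<nu> = 1\<close> the map is \<open>(x, Z\<^sub>1 x, Z\<^sub>2 (A x + q))\<close>.
\<close>

definition scaled_homotopy :: "real^('n::finite)^'n \<Rightarrow> real^'n \<Rightarrow> 'n triple \<times> real \<Rightarrow> 'n triple" where
  "scaled_homotopy A q p =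
     (fst (fst p) + (snd p - 1) *\<^sub>R lagrange_grad A q (fst p),
      snd p *\<^sub>R (\<chi> i. fst (snd (fst p)) $ i * fst (fst p) $ i),
      snd p *\<^sub>R (\<chi> i. snd (snd (fst p)) $ i * (A *v fst (fst p) + q) $ i))"

lemma homotopy_fun_eq:
  "homotopy_fun A q y y0 \<mu> =
     ((1 - \<mu>) *\<^sub>R lagrange_grad A q y + \<mu> *\<^sub>R (fst y - fst y0),
      (\<chi> i. fst (snd y) $ i * fst y $ i) - \<mu> *\<^sub>R (\<chi> i. fst (snd y0) $ i * fst y0 $ i),
      (\<chi> i. snd (snd y) $ i * (A *v fst y + q) $ i) - \<mu> *\<^sub>R (\<chi> i. snd (snd y0) $ i * (A *v fst y0 + q) $ i))"
  by (cases y, cases y0) (simp add: diag_mult lagrange_grad_def)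

text \<open>
  The separation of variables behind the genericity statement: all homotopies arise from one map,
  and the starting point only selects the level.
\<close>

lemma homotopy_fun_eq_scaled:
  assumes "\<mu> \<noteq> 0"
  shows "homotopy_fun A q y y0 \<mu> = \<mu> *\<^sub>R (scaled_homotopy A q (y, 1 / \<mu>) - scaled_homotopy A q (y0, 1))"
  using assms unfolding homotopy_fun_eq scaled_homotopy_def
  by (auto simp: scaleR_diff_right scaleR_add_right algebra_simps)

lemma polynomial_function_matrix_vector_mult:
  fixes M :: "real^'n^'m"
  assumes "polynomial_function f"
  shows "polynomial_function (\<lambda>p. M *v f p)"
  using polynomial_function_compose[OF assms polynomial_function_bounded_linear[OF matrix_vector_mul_bounded_linear[of M]]]
  unfolding o_def .

lemma polynomial_function_hadamard:
  assumes "polynomial_function f" "polynomial_function g"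
  shows "polynomial_function (\<lambda>p. (\<chi> i. f p $ i * g p $ i) :: real^'n)"
  by (intro polynomial_function_vec real_polynomial_function.intros(4) polynomial_function_nth assms)

lemmas polynomial_intros = polynomial_function_Pair polynomial_function_add polynomial_function_mult
  polynomial_function_diff polynomial_function_hadamard polynomial_function_matrix_vector_mult
  polynomial_function_nth polynomial_function_fst polynomial_function_snd polynomial_function_const
  polynomial_function_id

lemma polynomial_function_lagrange_grad:
  assumes "polynomial_function f"
  shows "polynomial_function (\<lambda>p. lagrange_grad A q (f p))"
  unfolding lagrange_grad_def
  by (intro polynomial_intros assms)

lemma polynomial_scaled_homotopy: "polynomial_function (scaled_homotopy A q)"
  unfolding scaled_homotopy_def[abs_def]
  by (intro polynomial_intros polynomial_function_lagrange_grad)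

lemma polynomial_homotopy: "polynomial_function (\<lambda>p. homotopy_fun A q (fst p) y0 (snd p))"
  unfolding homotopy_fun_eq
  by (intro polynomial_intros polynomial_function_lagrange_grad)

lemma bounded_bilinear_hadamard: "bounded_bilinear (\<lambda>x y. (\<chi> i. x $ i * y $ i) :: real^'n)"
  unfolding bilinear_conv_bounded_bilinear[symmetric] bilinear_def
  by (auto intro!: linearI simp: vec_eq_iff algebra_simps)

lemma feas1_int_iff:
  "y \<in> feas1_int A q \<longleftrightarrow> (\<forall>i. 0 < fst y $ i) \<and> (\<forall>i. 0 < (A *v fst y + q) $ i) \<and>
     (\<forall>i. 0 < fst (snd y) $ i) \<and> (\<forall>i. 0 < snd (snd y) $ i)"
  by (cases y) (auto simp: feas1_int_def feas_int_def)

lemma open_feas1_int: "open (feas1_int A q)"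
proof -
  have pos: "open {y. 0 < f y}" if "real_polynomial_function f" for f :: "'a triple \<Rightarrow> real"
    using that unfolding real_polynomial_function_eq
    by (intro open_Collect_less continuous_on_const continuous_on_polymonial_function)
  have "feas1_int A q = (\<Inter>i. {y. 0 < fst y $ i}) \<inter> (\<Inter>i. {y. 0 < (A *v fst y + q) $ i}) \<inter>
      (\<Inter>i. {y. 0 < fst (snd y) $ i}) \<inter> (\<Inter>i. {y. 0 < snd (snd y) $ i})"
    by (auto simp: feas1_int_iff)
  also have "open \<dots>"
    by (intro open_Int open_INT finite ballI pos polynomial_intros)
  finally show ?thesis .
qed

section \<open>Almost every starting point is regular\<close>

text \<open>
  The map \<open>(x, z\<^sub>1, z\<^sub>2) \<mapsto> (x, Z\<^sub>1 x, Z\<^sub>2 (A x + q))\<close> is triangular, with the positive entries of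
  \<open>x\<close> and \<open>A x + q\<close> on the diagonal of the second and third block.
\<close>

lemma initial_slice_derivative_inj:
  fixes A :: "real^('n::finite)^'n"
  assumes y: "y \<in> feas1_int A q" and D: "(scaled_homotopy A q has_derivative D) (at (y, 1))"
  shows "inj (\<lambda>v. D (v, 0))"
proof -
  let ?h = "\<lambda>x y. (\<chi> i. x $ i * y $ i) :: real^'n"
  interpret h: bounded_bilinear ?h by (rule bounded_bilinear_hadamard)
  define E where "E v = (fst v, ?h (fst (snd y)) (fst v) + ?h (fst (snd v)) (fst y),
     ?h (snd (snd y)) (A *v fst v) + ?h (snd (snd v)) (A *v fst y + q))" for v :: "'n triple"
  have slice: "(\<lambda>y. scaled_homotopy A q (y, 1)) =
     (\<lambda>y. (fst y, ?h (fst (snd y)) (fst y), ?h (snd (snd y)) (A *v fst y + q)))"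
    by (simp add: scaled_homotopy_def)
  have f: "(fst has_derivative fst) (at y)" "((\<lambda>y. fst (snd y)) has_derivative (\<lambda>v. fst (snd v))) (at y)"
    "((\<lambda>y. snd (snd y)) has_derivative (\<lambda>v. snd (snd v))) (at y)" for y :: "'n triple"
    by (auto intro!: bounded_linear_imp_has_derivative bounded_linear_intros)
  have w: "((\<lambda>y. A *v fst y + q) has_derivative (\<lambda>v. A *v fst v)) (at y)"
    by (rule derivative_eq_intros bounded_linear.has_derivative[OF matrix_vector_mul_bounded_linear] f | simp)+
  have E: "((\<lambda>y. scaled_homotopy A q (y, 1)) has_derivative E) (at y)"
    unfolding slice E_def[abs_def]
    by (intro has_derivative_Pair f h.FDERIV w)
  have "((\<lambda>y. (y, 1)) has_derivative (\<lambda>v. (v, 0))) (at y)"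
    by (intro has_derivative_Pair has_derivative_ident has_derivative_const)
  from has_derivative_compose[OF this D] have "((\<lambda>y. scaled_homotopy A q (y, 1)) has_derivative (\<lambda>v. D (v, 0))) (at y)" .
  then have DE: "(\<lambda>v. D (v, 0)) = E" by (rule has_derivative_unique[OF _ E])
  have "linear E" by (rule has_derivative_linear[OF E])
  then have "inj E"
    unfolding linear_injective_0[OF \<open>linear E\<close>]
  proof (intro allI impI)
    fix v assume v: "E v = 0"
    then have 1: "fst v = 0" by (simp add: E_def zero_prod_def)
    have "\<And>i. fst (snd v) $ i * fst y $ i = 0" "\<And>i. snd (snd v) $ i * (A *v fst y + q) $ i = 0"
      using v 1 by (auto simp: E_def zero_prod_def vec_eq_iff)
    moreover have "\<And>i. fst y $ i \<noteq> 0" "\<And>i. (A *v fst y + q) $ i \<noteq> 0"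
      using y unfolding feas1_int_iff by (metis less_irrefl)+
    ultimately have "fst (snd v) = 0" "snd (snd v) = 0"
      by (auto simp: vec_eq_iff)
    then show "v = 0" using 1 by (simp add: prod_eq_iff)
  qed
  then show ?thesis unfolding DE .
qed

text \<open>
  On the zero set the factor \<open>\<mu>\<close> and the substitution \<open>\<nu> = 1 / \<mu>\<close> do not affect surjectivity of the
  derivative: differentiating the factor produces a multiple of the value, which vanishes.
\<close>

lemma homotopy_derivative_surj_if_scaled_surj:
  fixes A :: "real^('n::finite)^'n"
  assumes \<mu>: "\<mu> > 0" and zero: "homotopy_fun A q y y0 \<mu> = 0"
    and D: "(scaled_homotopy A q has_derivative D) (at (y, 1 / \<mu>))" "surj D"
  shows "\<exists>D'. ((\<lambda>p. homotopy_fun A q (fst p) y0 (snd p)) has_derivative D') (at (y, \<mu>)) \<and> surj D'"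
proof -
  define k where "k = scaled_homotopy A q (y0, 1)"
  define g where "g p = (fst p, 1 / snd p)" for p :: "'n triple \<times> real"
  define g' where "g' v = (fst v, - snd v / \<mu>\<^sup>2)" for v :: "'n triple \<times> real"
  have z: "scaled_homotopy A q (y, 1 / \<mu>) - k = 0"
    using zero \<mu> homotopy_fun_eq_scaled[of \<mu> A q y y0] by (simp add: k_def)
  have "((\<lambda>p. 1 / snd p) has_derivative (\<lambda>v. - snd v / \<mu>\<^sup>2)) (at (y, \<mu>))"
    using \<mu> by (auto intro!: derivative_eq_intros simp: power2_eq_square field_simps)
  then have "(g has_derivative g') (at (y, \<mu>))"
    unfolding g_def[abs_def] g'_def[abs_def]
    by (intro has_derivative_Pair has_derivative_fst has_derivative_ident)
  moreover have "(scaled_homotopy A q has_derivative D) (at (g (y, \<mu>)))" using D(1) by (simp add: g_def)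
  ultimately have "((\<lambda>p. scaled_homotopy A q (g p)) has_derivative (\<lambda>v. D (g' v))) (at (y, \<mu>))"
    by (rule has_derivative_compose)
  then have "((\<lambda>p. scaled_homotopy A q (g p) - k) has_derivative (\<lambda>v. D (g' v))) (at (y, \<mu>))"
    using has_derivative_diff[OF _ has_derivative_const[of k]] by fastforce
  from has_derivative_scaleR[OF has_derivative_snd[OF has_derivative_ident] this]
  have der: "((\<lambda>p. snd p *\<^sub>R (scaled_homotopy A q (g p) - k)) has_derivative (\<lambda>v. \<mu> *\<^sub>R D (g' v))) (at (y, \<mu>))"
    using z by (simp add: g_def)
  have "((\<lambda>p. homotopy_fun A q (fst p) y0 (snd p)) has_derivative (\<lambda>v. \<mu> *\<^sub>R D (g' v))) (at (y, \<mu>))"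
  proof (rule has_derivative_transform_within_open[OF der, where s = "{p. 0 < snd p}"])
    show "open {p :: 'n triple \<times> real. 0 < snd p}" by (intro open_Collect_less continuous_intros)
    show "snd p *\<^sub>R (scaled_homotopy A q (g p) - k) = homotopy_fun A q (fst p) y0 (snd p)"
      if "p \<in> {p. 0 < snd p}" for p
      using that homotopy_fun_eq_scaled[of "snd p" A q "fst p" y0] by (simp add: g_def k_def)
  qed (use \<mu> in simp)
  moreover have "surj (\<lambda>v. \<mu> *\<^sub>R D (g' v))"
  proof (rule surjI)
    fix w
    define u where "u = inv D (w /\<^sub>R \<mu>)"
    have u: "D u = w /\<^sub>R \<mu>" unfolding u_def by (rule surj_f_inv_f[OF D(2)])
    have "g' (fst u, - \<mu>\<^sup>2 * snd u) = u" using \<mu> by (simp add: g'_def)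
    then show "\<mu> *\<^sub>R D (g' (fst (inv D (w /\<^sub>R \<mu>)), - \<mu>\<^sup>2 * snd (inv D (w /\<^sub>R \<mu>)))) = w"
      using u \<mu> by (simp add: u_def)
  qed
  ultimately show ?thesis by blast
qed

definition scaled_critical :: "real^('n::finite)^'n \<Rightarrow> real^'n \<Rightarrow> ('n triple \<times> real) set" where
  "scaled_critical A q = {p \<in> feas1_int A q \<times> UNIV.
     \<not> (\<exists>D. (scaled_homotopy A q has_derivative D) (at p) \<and> surj D)}"

text \<open>
  Critical points lie in the zero set of the last component of the kernel field. For each feasible
  \<open>y\<close> this component is a polynomial in the parameter that does not vanish at 1. So the critical
  set has finite slices, is a null set, and the preceding form of Sard's theorem applies.
\<close>

lemma negligible_critical_values_scaled_homotopy:
  fixes A :: "real^('n::finite)^'n"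
  shows "negligible (scaled_homotopy A q ` scaled_critical A q)"
proof (rule negligible_critical_values_one_more_dimension)
  define f' where "f' p = frechet_derivative (scaled_homotopy A q) (at p)" for p
  note f' = polynomial_function_frechet_derivative(1)[OF polynomial_scaled_homotopy[of A q], folded f'_def]
  obtain T where T: "polynomial_function T \<and> (\<forall>p D. (scaled_homotopy A q has_derivative D) (at p) \<longrightarrow>
    D (T p) = 0 \<and> (surj D \<longrightarrow> T p \<noteq> 0) \<and> (snd (T p) \<noteq> 0 \<longleftrightarrow> inj (\<lambda>v. D (v, 0))))"
    using triple_kernel_field[OF polynomial_scaled_homotopy[of A q]] by (elim exE)
  have pT: "polynomial_function T" using T by (rule conjunct1)
  have T': "snd (T p) \<noteq> 0 \<longleftrightarrow> inj (\<lambda>v. f' p (v, 0))" for p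
    using conjunct2[OF T, THEN spec, THEN spec, THEN mp, OF f'[of p]] by (elim conjE)
  define C where "C = {p \<in> feas1_int A q \<times> UNIV. snd (T p) = 0}"
  have "negligible C"
  proof (rule negligible_if_finite_slices)
    have "closed {p. snd (T p) = 0}"
      by (intro closed_Collect_eq continuous_intros continuous_on_polymonial_function pT)
    moreover have "open (feas1_int A q \<times> (UNIV :: real set))" by (intro open_Times open_feas1_int open_UNIV)
    moreover have "C = (feas1_int A q \<times> UNIV) \<inter> {p. snd (T p) = 0}" by (auto simp: C_def)
    ultimately show "C \<in> sets borel" by (simp add: borel_open borel_closed sets.Int)
    show "finite {t. (y, t) \<in> C}" for y
    proof (cases "y \<in> feas1_int A q")
      case True
      have "polynomial_function (\<lambda>t::real. (y, t))"
        by (intro polynomial_function_Pair polynomial_function_const polynomial_function_id)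
      from polynomial_function_snd[OF polynomial_function_compose[OF this pT]]
      have "real_polynomial_function (\<lambda>t. snd (T (y, t)))"
        unfolding o_def real_polynomial_function_eq .
      moreover have "snd (T (y, 1)) \<noteq> 0"
        unfolding T' by (rule initial_slice_derivative_inj[OF True f'])
      ultimately have "finite {t. snd (T (y, t)) = 0}"
        by (rule real_polynomial_function_finite_roots)
      then show ?thesis by (rule rev_finite_subset) (auto simp: C_def)
    qed (simp add: C_def)
  qed
  moreover have "scaled_critical A q \<subseteq> C"
  proof
    fix p assume p: "p \<in> scaled_critical A q"
    have "snd (T p) = 0"
    proof (rule ccontr)
      assume "snd (T p) \<noteq> 0"
      then have "inj (\<lambda>v. f' p (v, 0))" by (simp add: T')
      moreover have "linear (\<lambda>v. f' p (v, 0))"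
      proof -
        have l: "linear (\<lambda>v::'n triple. (v, 0::real))" by (intro linearI) auto
        show ?thesis
          using linear_compose[OF l has_derivative_linear[OF f'[of p]]] unfolding o_def .
      qed
      ultimately have "surj (\<lambda>v. f' p (v, 0))" using linear_injective_imp_surjective by blast
      then have "surj (f' p)" unfolding surj_def by metis
      then show False using p f' unfolding scaled_critical_def by blast
    qed
    then show "p \<in> C" using p by (auto simp: C_def scaled_critical_def)
  qed
  ultimately show "negligible (scaled_critical A q)"
    by (rule negligible_subset)
  show "DIM('n triple \<times> real) = DIM('n triple) + 1" by simp
  fix p assume "p \<in> scaled_critical A q"
  then have "\<not> surj (f' p)" using f' unfolding scaled_critical_def by blast
  moreover obtain B where "\<forall>y. norm (y - p) < 1 \<longrightarrow>
      norm (scaled_homotopy A q y - scaled_homotopy A q p - f' p (y - p)) \<le> B * (norm (y - p))\<^sup>2"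
    using polynomial_function_quadratic_remainder[OF polynomial_scaled_homotopy f'[of p]] by (elim exE)
  ultimately show "\<exists>D B r. linear D \<and> \<not> surj D \<and> r > 0 \<and>
      (\<forall>y. norm (y - p) < r \<longrightarrow>
        norm (scaled_homotopy A q y - scaled_homotopy A q p - D (y - p)) \<le> B * (norm (y - p))\<^sup>2)"
    by (intro exI[of _ "f' p"] exI[of _ B] exI[of _ 1] conjI has_derivative_linear[OF f']) auto
qed

lemma differentiable_vec_lambda:
  fixes f :: "'a::real_normed_vector \<Rightarrow> 'n::finite \<Rightarrow> real"
  assumes "\<And>i. (\<lambda>u. f u i) differentiable (at u)"
  shows "(\<lambda>u. (\<chi> i. f u i) :: real^'n) differentiable (at u)"
  by (rule differentiable_componentwise_within[THEN iffD2]) (use assms in \<open>auto simp: Basis_vec_def inner_axis\<close>)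

text \<open>
  The map \<open>Q y = (x, Z\<^sub>1 x, Z\<^sub>2 (A x + q))\<close> sends exceptional starting points to critical values of the
  scaled homotopy. It has a differentiable inverse on the feasible interior, so its preimage of a null set
  is a null set there.
\<close>

lemma negligible_not_regular_start:
  fixes A :: "real^('n::finite)^'n"
  shows "negligible {y \<in> feas1_int A q. \<not> regular_start A q y}"
proof -
  define Bad where "Bad = {y \<in> feas1_int A q. \<not> regular_start A q y}"
  define Q where "Q y = scaled_homotopy A q (y, 1)" for y
  define Qinv where "Qinv u = (fst u, (\<chi> i. fst (snd u) $ i / fst u $ i),
     (\<chi> i. snd (snd u) $ i / (A *v fst u + q) $ i))" for u :: "'n triple"
  have "Q ` Bad \<subseteq> scaled_homotopy A q ` scaled_critical A q"
  proof (rule image_subsetI)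
    fix y0 assume "y0 \<in> Bad"
    then obtain y \<mu> where p: "y \<in> feas1_int A q" "0 < \<mu>" "homotopy_fun A q y y0 \<mu> = 0"
      "\<not> (\<exists>D. ((\<lambda>p. homotopy_fun A q (fst p) y0 (snd p)) has_derivative D) (at (y, \<mu>)) \<and> surj D)"
      unfolding Bad_def regular_start_def regular_value_on_def by auto
    have "(y, 1 / \<mu>) \<in> scaled_critical A q"
    proof (rule ccontr)
      assume "(y, 1 / \<mu>) \<notin> scaled_critical A q"
      then have "\<exists>D. (scaled_homotopy A q has_derivative D) (at (y, 1 / \<mu>)) \<and> surj D"
        using p(1) unfolding scaled_critical_def by simp
      then obtain D where "(scaled_homotopy A q has_derivative D) (at (y, 1 / \<mu>))" "surj D"
        by (elim exE conjE)
      from homotopy_derivative_surj_if_scaled_surj[OF p(2,3) this] p(4) show False by simp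
    qed
    moreover have "Q y0 = scaled_homotopy A q (y, 1 / \<mu>)"
      using p(2,3) homotopy_fun_eq_scaled[of \<mu> A q y y0] by (simp add: Q_def)
    ultimately show "Q y0 \<in> scaled_homotopy A q ` scaled_critical A q" by blast
  qed
  then have "negligible (Q ` Bad)"
    using negligible_critical_values_scaled_homotopy[of A q] negligible_subset by blast
  moreover have "Qinv differentiable_on Q ` Bad"
  proof (rule differentiable_at_imp_differentiable_on)
    fix u assume "u \<in> Q ` Bad"
    then obtain y where y: "y \<in> feas1_int A q" "u = Q y" by (auto simp: Bad_def)
    then have nz: "fst u $ i \<noteq> 0" "(A *v fst u + q) $ i \<noteq> 0" for i
      by (auto simp: feas1_int_iff Q_def scaled_homotopy_def less_imp_neq[symmetric])
    have d: "(\<lambda>u. g u $ i) differentiable at u" if "bounded_linear g" for g :: "'n triple \<Rightarrow> real^'n" and i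
      using that bounded_linear_compose[OF bounded_linear_vec_nth that] bounded_linear_imp_differentiable by blast
    have "(\<lambda>u. (A *v fst u + q) $ i) differentiable at u" for i
      unfolding vector_add_component
      by (intro differentiable_add differentiable_const d
          bounded_linear_compose[OF matrix_vector_mul_bounded_linear] bounded_linear_fst)
    moreover have "(\<lambda>u::'n triple. fst u $ i) differentiable at u"
      "(\<lambda>u::'n triple. fst (snd u) $ i) differentiable at u"
      "(\<lambda>u::'n triple. snd (snd u) $ i) differentiable at u" for i
      by (intro d bounded_linear_fst bounded_linear_fst_comp bounded_linear_snd_comp bounded_linear_snd)+
    moreover have "fst differentiable at u"
      by (intro bounded_linear_imp_differentiable bounded_linear_fst)
    ultimately show "Qinv differentiable at u"
      unfolding Qinv_def[abs_def]
      by (intro differentiable_Pair differentiable_vec_lambda differentiable_divide nz)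
  qed
  ultimately have "negligible (Qinv ` Q ` Bad)"
    by (rule negligible_differentiable_image_negligible[OF order_refl])
  moreover have "Bad \<subseteq> Qinv ` Q ` Bad"
  proof
    fix y assume y: "y \<in> Bad"
    have "Qinv (Q y) = y"
    proof -
      have "\<And>i. fst y $ i \<noteq> 0" "\<And>i. (A *v fst y + q) $ i \<noteq> 0"
        using y by (auto simp: Bad_def feas1_int_iff less_imp_neq[symmetric])
      then show ?thesis
        by (simp add: Qinv_def Q_def scaled_homotopy_def prod_eq_iff vec_eq_iff)
    qed
    then show "y \<in> Qinv ` Q ` Bad" using y by (metis imageI)
  qed
  ultimately show ?thesis using negligible_subset unfolding Bad_def by blast
qed

section \<open>A priori bounds and limits of zeros\<close>

lemma zero_set_iff:
  "p \<in> zero_set A q y0 \<longleftrightarrow> fst p \<in> feas1_int A q \<and> 0 < snd p \<and> snd p \<le> 1 \<and>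
     homotopy_fun A q (fst p) y0 (snd p) = 0"
  by (cases p) (simp add: zero_set_def)

lemma homotopy_zero_iff:
  "homotopy_fun A q y y0 \<mu> = 0 \<longleftrightarrow>
     (1 - \<mu>) *\<^sub>R lagrange_grad A q y + \<mu> *\<^sub>R (fst y - fst y0) = 0 \<and>
     (\<forall>i. fst (snd y) $ i * fst y $ i = \<mu> * (fst (snd y0) $ i * fst y0 $ i)) \<and>
     (\<forall>i. snd (snd y) $ i * (A *v fst y + q) $ i = \<mu> * (snd (snd y0) $ i * (A *v fst y0 + q) $ i))"
  unfolding homotopy_fun_eq zero_prod_def by (simp add: vec_eq_iff)

text \<open>
  Moving the transpose onto \<open>v\<close> leaves only quantities whose signs are known: the slack \<open>A x + q\<close>, \<open>x\<close> and
  the multipliers.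
\<close>

lemma inner_lagrange_grad:
  "v \<bullet> lagrange_grad A q y = v \<bullet> (A *v fst y + q) + (A *v v) \<bullet> fst y - v \<bullet> fst (snd y) - (A *v v) \<bullet> snd (snd y)"
proof -
  have "v \<bullet> (transpose A *v z) = (A *v v) \<bullet> z" for z
    by (metis dot_lmul_matrix inner_commute transpose_matrix_vector)
  then show ?thesis
    by (simp add: lagrange_grad_def matrix_vector_mult_add_rdistrib inner_add_right inner_diff_right)
qed

lemma inner_nonneg_vec:
  fixes u v :: "real^'n"
  assumes "\<And>i. 0 \<le> u $ i" "\<And>i. 0 \<le> v $ i"
  shows "0 \<le> u \<bullet> v"
  using assms by (simp add: inner_vec_def sum_nonneg)

text \<open>
  Pair the first block with \<open>x - x\<^sub>0\<close>. Since \<open>A (x - x\<^sub>0) = w - w\<^sub>0\<close> for the slacks \<open>w = A x + q\<close> and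
  \<open>w\<^sub>0\<close>, all quadratic terms have a favourable sign, and complementarity evaluates \<open>z\<^sub>1 \<bullet> x\<close> and
  \<open>z\<^sub>2 \<bullet> w\<close>. What remains bounds the multipliers in terms of \<open>x\<close>.
\<close>

lemma multiplier_bound:
  assumes y0: "y0 \<in> feas1_int A q" and p: "(y, \<mu>) \<in> zero_set A q y0"
  shows "fst (snd y) \<bullet> fst y0 + snd (snd y) \<bullet> (A *v fst y0 + q) \<le>
     (A *v fst y + q) \<bullet> fst y0 + fst y \<bullet> (A *v fst y0 + q) +
     fst (snd y0) \<bullet> fst y0 + snd (snd y0) \<bullet> (A *v fst y0 + q)"
proof -
  define x z1 z2 w x0 w0 where defs: "x = fst y" "z1 = fst (snd y)" "z2 = snd (snd y)" "w = A *v fst y + q"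
    "x0 = fst y0" "w0 = A *v fst y0 + q"
  define c d where cd: "c = fst (snd y0) \<bullet> x0" "d = snd (snd y0) \<bullet> w0"
  have pos: "\<And>i. 0 < x $ i" "\<And>i. 0 < w $ i" "\<And>i. 0 < x0 $ i" "\<And>i. 0 < w0 $ i"
    "\<And>i. 0 < fst (snd y0) $ i" "\<And>i. 0 < snd (snd y0) $ i"
    using y0 p by (auto simp: defs zero_set_iff feas1_int_iff)
  have \<mu>: "0 < \<mu>" "\<mu> \<le> 1" using p by (auto simp: zero_set_iff)
  have E: "(1 - \<mu>) *\<^sub>R lagrange_grad A q y + \<mu> *\<^sub>R (x - x0) = 0"
    and E1: "\<And>i. z1 $ i * x $ i = \<mu> * (fst (snd y0) $ i * x0 $ i)"
    and E2: "\<And>i. z2 $ i * w $ i = \<mu> * (snd (snd y0) $ i * w0 $ i)"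
    using p by (auto simp: zero_set_iff homotopy_zero_iff defs)
  have nn: "u \<bullet> v \<ge> 0" if "\<And>i. 0 < u $ i" "\<And>i. 0 < v $ i" for u v :: "real^'a"
    using that by (intro inner_nonneg_vec less_imp_le)
  have zc: "z1 \<bullet> x = \<mu> * c" "z2 \<bullet> w = \<mu> * d"
    using E1 E2 by (simp_all add: inner_vec_def cd sum_distrib_left)
  have nonneg: "0 \<le> w \<bullet> x" "0 \<le> w \<bullet> x0" "0 \<le> x \<bullet> w0" "0 \<le> c" "0 \<le> d"
    unfolding cd by (intro nn pos)+
  have Aw: "A *v (x - x0) = w - w0" by (simp add: defs matrix_vector_mult_diff_distrib)
  have "z1 \<bullet> x0 + z2 \<bullet> w0 \<le> w \<bullet> x0 + x \<bullet> w0 + c + d"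
  proof (cases "\<mu> = 1")
    case True
    then have "x = x0" using E by simp
    then have "w = w0" by (simp add: defs)
    have "z1 \<bullet> x0 = c" "z2 \<bullet> w0 = d" using zc True \<open>x = x0\<close> \<open>w = w0\<close> by simp_all
    then show ?thesis using nonneg by simp
  next
    case False
    have "(x - x0) \<bullet> ((1 - \<mu>) *\<^sub>R lagrange_grad A q y + \<mu> *\<^sub>R (x - x0)) = 0" unfolding E by simp
    then have "(1 - \<mu>) * ((x - x0) \<bullet> lagrange_grad A q y) = - (\<mu> * ((x - x0) \<bullet> (x - x0)))"
      by (simp only: inner_add_right inner_scaleR_right eq_neg_iff_add_eq_0)
    also have "\<dots> \<le> 0" using \<mu> by simp
    finally have "(x - x0) \<bullet> lagrange_grad A q y \<le> 0" using False \<mu> by (simp add: mult_le_0_iff)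
    moreover have "(x - x0) \<bullet> lagrange_grad A q y =
       2 * (w \<bullet> x) - w \<bullet> x0 - x \<bullet> w0 + z1 \<bullet> x0 + z2 \<bullet> w0 - z1 \<bullet> x - z2 \<bullet> w"
      unfolding inner_lagrange_grad Aw defs(4)[symmetric] unfolding defs(1-3)[symmetric]
      by (simp add: inner_diff_left inner_diff_right inner_commute algebra_simps)
    ultimately have "z1 \<bullet> x0 + z2 \<bullet> w0 \<le> w \<bullet> x0 + x \<bullet> w0 + \<mu> * c + \<mu> * d"
      using nonneg(1) unfolding zc by linarith
    moreover have "\<mu> * c \<le> 1 * c" "\<mu> * d \<le> 1 * d" using \<mu> nonneg by (intro mult_right_mono; simp)+
    ultimately show ?thesis by linarith
  qed
  then show ?thesis by (simp add: defs cd)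
qed

text \<open>
  If \<open>X n / N n\<close> tends to a positive limit \<open>u\<close>, then \<open>X n\<close> tends to infinity with \<open>N n\<close>; for \<open>u = 0\<close>
  there is nothing to prove.
\<close>

lemma eventually_ratio_le_one:
  fixes X N :: "nat \<Rightarrow> real"
  assumes N: "filterlim N at_top sequentially" and lim: "(\<lambda>n. X n / N n) \<longlonglongrightarrow> u"
    and pos: "\<And>n. X n > 0" "\<And>n. N n > 0"
  shows "\<forall>\<^sub>F n in sequentially. u / X n \<le> 1"
proof -
  have u: "u \<ge> 0" using pos by (intro LIMSEQ_le_const[OF lim]) (auto intro!: exI[of _ 0] less_imp_le)
  show ?thesis
  proof (cases "u = 0")
    case False
    then have "u > 0" using u by simp
    then have "filterlim (\<lambda>n. X n / N n * N n) at_top sequentially"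
      by (rule filterlim_tendsto_pos_mult_at_top[OF lim _ N])
    moreover have "X n / N n * N n = X n" for n using pos(2)[of n] by simp
    ultimately have "filterlim X at_top sequentially" by simp
    then have "\<forall>\<^sub>F n in sequentially. u \<le> X n" by (simp add: filterlim_at_top)
    then show ?thesis by (rule eventually_mono) (use pos(1) in \<open>simp add: divide_le_eq\<close>)
  qed (simp add: always_eventually)
qed

text \<open>
  Suppose that there are zeros with \<open>norm x\<close> tending to infinity, and let \<open>l\<close> be a limit of their
  directions; then \<open>l\<close> and \<open>A l\<close> are nonnegative. Pair the first block with \<open>l\<close>. The terms \<open>l \<bullet> w\<close> and
  \<open>(A l) \<bullet> x\<close> are nonnegative, and the multiplier terms are at most a constant times \<open>\<mu>\<close>, because an index
  with \<open>l\<^sub>i > 0\<close> has \<open>x\<^sub>i\<close> tending to infinity and \<open>z\<^sub>1\<^sub>i x\<^sub>i\<close> is a multiple of \<open>\<mu>\<close> (similarly for \<open>w\<close> and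
  \<open>z\<^sub>2\<close>). Hence \<open>l \<bullet> (x - x\<^sub>0)\<close> stays bounded although it grows like \<open>norm x\<close>. Dividing by \<open>\<mu>\<close> is harmless even
  as \<open>\<mu>\<close> tends to 0, since all remaining terms carry that factor.
\<close>

lemma primal_component_bounded:
  fixes A :: "real^('n::finite)^'n"
  assumes K: "K \<subseteq> feas1_int A q"
    and B: "\<And>y0. y0 \<in> K \<Longrightarrow> norm (fst y0) \<le> B"
      "\<And>y0 i. y0 \<in> K \<Longrightarrow> fst (snd y0) $ i * fst y0 $ i \<le> B"
      "\<And>y0 i. y0 \<in> K \<Longrightarrow> snd (snd y0) $ i * (A *v fst y0 + q) $ i \<le> B"
  shows "\<exists>R. \<forall>y0\<in>K. \<forall>p\<in>zero_set A q y0. norm (fst (fst p)) \<le> R"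
proof (rule ccontr)
  assume "\<not> ?thesis"
  then have "\<forall>n::nat. \<exists>y0 p. y0 \<in> K \<and> p \<in> zero_set A q y0 \<and> real n < norm (fst (fst p))"
    by (meson not_le)
  then obtain y0 p where y0: "\<And>n. y0 n \<in> K" and p: "\<And>n. p n \<in> zero_set A q (y0 n)"
    and large: "\<And>n. real n < norm (fst (fst (p n)))"
    by metis
  define x where "x n = fst (fst (p n))" for n
  define u where "u n = x n /\<^sub>R norm (x n)" for n
  have xn: "norm (x n) > 0" for n
    using large[of n] of_nat_0_le_iff[of n, where 'a = real] unfolding x_def by linarith
  have "u n \<in> sphere 0 1" for n using xn[of n] by (simp add: u_def)
  then obtain l r where l: "l \<in> sphere 0 1" and r: "strict_mono r" and lim: "(u \<circ> r) \<longlonglongrightarrow> l"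
    using compact_sphere[of 0 1] unfolding compact_def by metis
  define N where "N n = norm (x (r n))" for n
  define X where "X n = x (r n)" for n
  define W where "W n = A *v X n + q" for n
  have N: "filterlim N at_top sequentially"
  proof (rule filterlim_at_top_mono[OF filterlim_real_sequentially])
    show "\<forall>\<^sub>F n in sequentially. real n \<le> N n"
    proof (rule always_eventually, rule allI)
      fix n
      have "real n \<le> real (r n)" using seq_suble[OF r] by simp
      also have "\<dots> \<le> N n" using large[of "r n"] by (simp add: N_def x_def)
      finally show "real n \<le> N n" .
    qed
  qed
  have Npos: "N n > 0" for n using xn by (simp add: N_def)
  have feas: "0 < X n $ i" "0 < W n $ i" for n i
    using p[of "r n"] by (auto simp: zero_set_iff feas1_int_iff X_def W_def x_def)
  have limu: "(\<lambda>n. X n /\<^sub>R N n) \<longlonglongrightarrow> l"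
    using lim by (simp add: o_def u_def X_def N_def)
  have limX: "(\<lambda>n. X n $ i / N n) \<longlonglongrightarrow> l $ i" for i
    using tendsto_vec_nth[OF limu, of i] by (simp add: field_simps)
  have limW: "(\<lambda>n. W n $ i / N n) \<longlonglongrightarrow> (A *v l) $ i" for i
  proof -
    have "(\<lambda>n. inverse (N n)) \<longlonglongrightarrow> 0" by (rule tendsto_inverse_0_at_top[OF N])
    then have "(\<lambda>n. A *v (X n /\<^sub>R N n) + inverse (N n) *\<^sub>R q) \<longlonglongrightarrow> A *v l + 0 *\<^sub>R q"
      by (intro tendsto_add tendsto_scaleR tendsto_const
          bounded_linear.tendsto[OF matrix_vector_mul_bounded_linear limu])
    moreover have "A *v (X n /\<^sub>R N n) + inverse (N n) *\<^sub>R q = W n /\<^sub>R N n" for n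
      by (simp add: W_def matrix_vector_mult_scaleR scaleR_add_right)
    ultimately have "(\<lambda>n. W n /\<^sub>R N n) \<longlonglongrightarrow> A *v l" by simp
    from tendsto_vec_nth[OF this, of i] show ?thesis by (simp add: field_simps)
  qed
  have l0: "0 \<le> l $ i" "0 \<le> (A *v l) $ i" for i
  proof -
    have "0 \<le> X n $ i / N n" "0 \<le> W n $ i / N n" for n
      using feas[of n i] Npos[of n] by simp_all
    then show "0 \<le> l $ i" "0 \<le> (A *v l) $ i"
      by (auto intro!: LIMSEQ_le_const[OF limX] LIMSEQ_le_const[OF limW])
  qed
  \<comment> \<open>The bound on \<open>l \<bullet> x\<close>: two multiplier terms and the contribution of the starting point.\<close>
  define RHS where "RHS = 2 * real CARD('n) * \<bar>B\<bar> + \<bar>B\<bar>"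
  have key: "l \<bullet> X n \<le> RHS"
    if e1: "\<forall>i. l $ i / X n $ i \<le> 1" and e2: "\<forall>i. (A *v l) $ i / W n $ i \<le> 1" for n
  proof -
    define y where "y = fst (p (r n))"
    define \<mu> where "\<mu> = snd (p (r n))"
    define s where "s = y0 (r n)"
    have sK: "s \<in> K" using y0 by (simp add: s_def)
    have "p (r n) = (y, \<mu>)" by (simp add: y_def \<mu>_def)
    then have ps: "(y, \<mu>) \<in> zero_set A q s" using p[of "r n"] by (simp add: s_def)
    have fy: "fst y = X n" by (simp add: y_def X_def x_def)
    have \<mu>: "0 < \<mu>" "\<mu> \<le> 1" using ps by (auto simp: zero_set_iff)
    have E: "(1 - \<mu>) *\<^sub>R lagrange_grad A q y + \<mu> *\<^sub>R (X n - fst s) = 0"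
      and E1: "\<And>i. fst (snd y) $ i * X n $ i = \<mu> * (fst (snd s) $ i * fst s $ i)"
      and E2: "\<And>i. snd (snd y) $ i * W n $ i = \<mu> * (snd (snd s) $ i * (A *v fst s + q) $ i)"
      using ps by (auto simp: zero_set_iff homotopy_zero_iff fy W_def)
    have nn: "v \<bullet> w \<ge> 0" if "\<And>i. 0 \<le> v $ i" "\<And>i. 0 < w $ i" for v w :: "real^'n"
      using that by (intro inner_nonneg_vec) (auto intro: less_imp_le)
    have z: "\<And>i. 0 < fst (snd y) $ i" "\<And>i. 0 < snd (snd y) $ i"
      using ps by (auto simp: zero_set_iff feas1_int_iff)
    have bound: "v \<bullet> zz \<le> \<mu> * (real CARD('n) * \<bar>B\<bar>)"
      if v: "\<And>i. 0 \<le> v $ i" "\<And>i. v $ i / xx $ i \<le> 1" and xx: "\<And>i. 0 < xx $ i"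
        and eq: "\<And>i. zz $ i * xx $ i = \<mu> * cc i" and cc: "\<And>i. cc i \<le> B" "\<And>i. 0 < zz $ i" for v zz xx :: "real^'n" and cc
    proof -
      have "v \<bullet> zz = (\<Sum>i\<in>UNIV. v $ i * zz $ i)" by (simp add: inner_vec_def)
      also have "\<dots> \<le> (\<Sum>i\<in>(UNIV::'n set). \<mu> * \<bar>B\<bar>)"
      proof (rule sum_mono)
        fix i
        have "v $ i * zz $ i = v $ i / xx $ i * (zz $ i * xx $ i)" using xx[of i] by simp
        also have "\<dots> \<le> 1 * (zz $ i * xx $ i)"
          using v(2)[of i] cc(2)[of i] xx[of i] by (intro mult_right_mono) auto
        also have "\<dots> = \<mu> * cc i" by (simp add: eq)
        also have "\<dots> \<le> \<mu> * \<bar>B\<bar>" using \<mu> cc(1)[of i] by (intro mult_left_mono) auto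
        finally show "v $ i * zz $ i \<le> \<mu> * \<bar>B\<bar>" .
      qed
      finally show ?thesis by (simp add: mult.left_commute)
    qed
    have b1: "l \<bullet> fst (snd y) \<le> \<mu> * (real CARD('n) * \<bar>B\<bar>)"
      using e1 by (intro bound[OF l0(1) _ feas(1) E1] B sK z) auto
    have b2: "(A *v l) \<bullet> snd (snd y) \<le> \<mu> * (real CARD('n) * \<bar>B\<bar>)"
      using e2 by (intro bound[OF l0(2) _ feas(2) E2] B sK z) auto
    have p0: "0 \<le> l \<bullet> W n" "0 \<le> (A *v l) \<bullet> X n" "0 \<le> l \<bullet> fst (snd y)" "0 \<le> (A *v l) \<bullet> snd (snd y)"
      using l0 feas z by (auto intro!: nn)
    have "l \<bullet> ((1 - \<mu>) *\<^sub>R lagrange_grad A q y + \<mu> *\<^sub>R (X n - fst s)) = 0" unfolding E by simp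
    then have "\<mu> * (l \<bullet> (X n - fst s)) = (1 - \<mu>) * (- (l \<bullet> lagrange_grad A q y))"
      by (simp add: inner_add_right)
    also have "\<dots> \<le> (1 - \<mu>) * (l \<bullet> fst (snd y) + (A *v l) \<bullet> snd (snd y))"
      using \<mu> p0 unfolding inner_lagrange_grad fy W_def[symmetric] by (intro mult_left_mono) auto
    also have "\<dots> \<le> 1 * (l \<bullet> fst (snd y) + (A *v l) \<bullet> snd (snd y))"
      using \<mu> p0 by (intro mult_right_mono) auto
    also have "\<dots> \<le> \<mu> * (2 * real CARD('n) * \<bar>B\<bar>)" using b1 b2 by (simp add: algebra_simps)
    finally have "l \<bullet> (X n - fst s) \<le> 2 * real CARD('n) * \<bar>B\<bar>" using \<mu> by simp
    moreover have "l \<bullet> fst s \<le> \<bar>B\<bar>"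
      using norm_cauchy_schwarz[of l "fst s"] l B(1)[OF sK] by simp
    ultimately show ?thesis by (simp add: RHS_def inner_diff_right)
  qed
  have ev: "\<forall>\<^sub>F n in sequentially. (\<forall>i. l $ i / X n $ i \<le> 1) \<and> (\<forall>i. (A *v l) $ i / W n $ i \<le> 1)"
    by (intro eventually_conj eventually_all_finite
        eventually_ratio_le_one[OF N limX feas(1) Npos] eventually_ratio_le_one[OF N limW feas(2) Npos])
  have "(\<lambda>n. l \<bullet> (X n /\<^sub>R N n)) \<longlonglongrightarrow> l \<bullet> l" by (intro tendsto_inner tendsto_const limu)
  then have "(\<lambda>n. l \<bullet> X n / N n) \<longlonglongrightarrow> 1"
    using l by (simp add: field_simps norm_eq_1)
  from filterlim_tendsto_pos_mult_at_top[OF this zero_less_one N]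
  have "filterlim (\<lambda>n. l \<bullet> X n) at_top sequentially"
    using Npos by (simp add: less_imp_neq[symmetric])
  then have "\<forall>\<^sub>F n in sequentially. RHS < l \<bullet> X n" by (simp add: filterlim_at_top_dense)
  with ev have "\<forall>\<^sub>F n in sequentially. False"
    by eventually_elim (use key in force)
  then show False by simp
qed

text \<open>
  Uniformity in the starting point is needed later, when an arbitrary start is approximated by
  regular ones.
\<close>

lemma bounded_zero_sets:
  fixes A :: "real^('n::finite)^'n"
  assumes K: "compact K" "K \<subseteq> feas1_int A q"
  shows "\<exists>R. \<forall>y0\<in>K. \<forall>p\<in>zero_set A q y0. norm p \<le> R"
proof -
  \<comment> \<open>A single continuous function that dominates every quantity to be bounded on \<open>K\<close>.\<close>
  define \<beta> where "\<beta> y = norm (fst y) + norm (A *v fst y + q) +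
     (\<Sum>i\<in>UNIV. fst (snd y) $ i * fst y $ i) + (\<Sum>i\<in>UNIV. snd (snd y) $ i * (A *v fst y + q) $ i) +
     (\<Sum>i\<in>UNIV. 1 / fst y $ i) + (\<Sum>i\<in>UNIV. 1 / (A *v fst y + q) $ i)" for y :: "'n triple"
  have "continuous_on K \<beta>"
    unfolding \<beta>_def
    using K(2) by (intro continuous_intros continuous_on_component
        continuous_on_compose2[OF linear_continuous_on[OF matrix_vector_mul_bounded_linear, of UNIV]])
      (auto simp: feas1_int_iff less_imp_neq[symmetric])
  then have "bounded (\<beta> ` K)" by (intro compact_imp_bounded compact_continuous_image K)
  then obtain B0 where B0: "\<And>y. y \<in> K \<Longrightarrow> \<bar>\<beta> y\<bar> \<le> B0" unfolding bounded_iff by fastforce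
  define B where "B = \<bar>B0\<bar>"
  have parts: "norm (fst y) \<le> B" "norm (A *v fst y + q) \<le> B"
    "(\<Sum>i\<in>UNIV. fst (snd y) $ i * fst y $ i) \<le> B" "(\<Sum>i\<in>UNIV. snd (snd y) $ i * (A *v fst y + q) $ i) \<le> B"
    "(\<Sum>i\<in>UNIV. 1 / fst y $ i) \<le> B" "(\<Sum>i\<in>UNIV. 1 / (A *v fst y + q) $ i) \<le> B" if y: "y \<in> K" for y
  proof -
    have "y \<in> feas1_int A q" using y K by blast
    then have "0 \<le> (\<Sum>i\<in>UNIV. fst (snd y) $ i * fst y $ i)" "0 \<le> (\<Sum>i\<in>UNIV. snd (snd y) $ i * (A *v fst y + q) $ i)"
      "0 \<le> (\<Sum>i\<in>UNIV. 1 / fst y $ i)" "0 \<le> (\<Sum>i\<in>UNIV. 1 / (A *v fst y + q) $ i)"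
      unfolding feas1_int_iff
      by (intro sum_nonneg mult_nonneg_nonneg divide_nonneg_nonneg; simp add: less_imp_le)+
    moreover have "\<beta> y \<le> B" using B0[OF y] unfolding B_def by linarith
    ultimately show "norm (fst y) \<le> B" "norm (A *v fst y + q) \<le> B"
    "(\<Sum>i\<in>UNIV. fst (snd y) $ i * fst y $ i) \<le> B" "(\<Sum>i\<in>UNIV. snd (snd y) $ i * (A *v fst y + q) $ i) \<le> B"
    "(\<Sum>i\<in>UNIV. 1 / fst y $ i) \<le> B" "(\<Sum>i\<in>UNIV. 1 / (A *v fst y + q) $ i) \<le> B"
      unfolding \<beta>_def using norm_ge_zero[of "fst y"] norm_ge_zero[of "A *v fst y + q"] by linarith+
  qed
  have single: "f i \<le> S" if "(\<Sum>i\<in>UNIV. f i) \<le> S" "\<And>i. 0 < f i" for f :: "'n \<Rightarrow> real" and i S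
    using member_le_sum[of i UNIV f] that by (auto intro: less_imp_le order_trans)
  have pos: "0 < fst y $ i" "0 < (A *v fst y + q) $ i" "0 < fst (snd y) $ i" "0 < snd (snd y) $ i"
    if "y \<in> feas1_int A q" for y i using that by (auto simp: feas1_int_iff)
  have "\<exists>R. \<forall>y0\<in>K. \<forall>p\<in>zero_set A q y0. norm (fst (fst p)) \<le> R"
  proof (rule primal_component_bounded[OF K(2)])
    fix y0 i assume y0: "y0 \<in> K"
    then have y0f: "y0 \<in> feas1_int A q" using K by blast
    show "norm (fst y0) \<le> B" by (rule parts[OF y0])
    show "fst (snd y0) $ i * fst y0 $ i \<le> B"
      by (rule single[OF parts(3)[OF y0]]) (use pos[OF y0f] in simp)
    show "snd (snd y0) $ i * (A *v fst y0 + q) $ i \<le> B"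
      by (rule single[OF parts(4)[OF y0]]) (use pos[OF y0f] in simp)
  qed
  then obtain R where R: "\<And>y0 p. y0 \<in> K \<Longrightarrow> p \<in> zero_set A q y0 \<Longrightarrow> norm (fst (fst p)) \<le> R" by blast
  obtain a where a: "a > 0" "\<And>v. norm (A *v v) \<le> a * norm v"
    using linear_bounded_pos[OF matrix_vector_mul_linear[of A]] by blast
  define M where "M = (a * \<bar>R\<bar> + norm q) * B + \<bar>R\<bar> * B + B + B"
  define n where "n = real CARD('n)"
  have "norm p \<le> \<bar>R\<bar> + n * (M * B) + n * (M * B) + 1" if y0: "y0 \<in> K" and p: "p \<in> zero_set A q y0" for y0 p
  proof -
    have y0f: "y0 \<in> feas1_int A q" using y0 K by blast
    obtain y \<mu> where py: "p = (y, \<mu>)" by (cases p)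
    have yf: "y \<in> feas1_int A q" and \<mu>: "0 < \<mu>" "\<mu> \<le> 1" using p by (auto simp: zero_set_iff py)
    have x: "norm (fst y) \<le> \<bar>R\<bar>" using R[OF y0 p] by (simp add: py)
    have "norm (A *v fst y + q) \<le> norm (A *v fst y) + norm q" by (rule norm_triangle_ineq)
    also have "\<dots> \<le> a * \<bar>R\<bar> + norm q"
      using order_trans[OF a(2)[of "fst y"] mult_left_mono[OF x]] a(1) by simp
    finally have w: "norm (A *v fst y + q) \<le> a * \<bar>R\<bar> + norm q" .
    have t1: "(A *v fst y + q) \<bullet> fst y0 \<le> (a * \<bar>R\<bar> + norm q) * B"
      using mult_mono[OF w parts(1)[OF y0]] a(1)
      by (intro order_trans[OF norm_cauchy_schwarz]) simp
    have t2: "fst y \<bullet> (A *v fst y0 + q) \<le> \<bar>R\<bar> * B"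
      using mult_mono[OF x parts(2)[OF y0]] by (intro order_trans[OF norm_cauchy_schwarz]) simp
    have t3: "fst (snd y0) \<bullet> fst y0 \<le> B" "snd (snd y0) \<bullet> (A *v fst y0 + q) \<le> B"
      using parts(3,4)[OF y0] by (simp_all add: inner_vec_def)
    have tot: "fst (snd y) \<bullet> fst y0 + snd (snd y) \<bullet> (A *v fst y0 + q) \<le> M"
      using multiplier_bound[OF y0f p[unfolded py]] t1 t2 t3 unfolding M_def by linarith
    have comp: "norm z \<le> n * (M * B)"
      if z: "\<And>i. 0 < z $ i" and v: "\<And>i. 0 < v $ i" and zv: "z \<bullet> v \<le> M" and inv: "(\<Sum>i\<in>UNIV. 1 / v $ i) \<le> B" for z v :: "real^'n"
    proof -
      have zi: "z $ i \<le> M * B" for i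
      proof -
        have 1: "z $ i * v $ i \<le> M"
          by (rule single[of "\<lambda>i. z $ i * v $ i"]) (use zv z v in \<open>auto simp: inner_vec_def\<close>)
        have 2: "1 / v $ i \<le> B" by (rule single[OF inv]) (use v in simp)
        have M0: "0 \<le> M" using 1 z[of i] v[of i] by (meson less_imp_le mult_pos_pos order_trans)
        have "z $ i = (z $ i * v $ i) * (1 / v $ i)" using v[of i] by simp
        also have "\<dots> \<le> M * B" using z[of i] v[of i] M0 by (intro mult_mono 1 2) auto
        finally show ?thesis .
      qed
      have "norm z \<le> (\<Sum>i\<in>UNIV. \<bar>z $ i\<bar>)" by (rule norm_le_l1_cart)
      also have "\<dots> \<le> (\<Sum>i\<in>(UNIV::'n set). M * B)"
        using zi z by (intro sum_mono) (auto simp: abs_of_pos)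
      finally show ?thesis by (simp add: n_def)
    qed
    have nn: "u \<bullet> v \<ge> 0" if "\<And>i. 0 < u $ i" "\<And>i. 0 < v $ i" for u v :: "real^'n"
      using that by (intro inner_nonneg_vec less_imp_le)
    have i1: "fst (snd y) \<bullet> fst y0 \<ge> 0" by (rule nn; rule pos; fact)
    have i2: "snd (snd y) \<bullet> (A *v fst y0 + q) \<ge> 0" by (rule nn; rule pos; fact)
    have n1: "norm (fst (snd y)) \<le> n * (M * B)"
    proof (rule comp[OF pos(3)[OF yf] pos(1)[OF y0f] _ parts(5)[OF y0]])
      show "fst (snd y) \<bullet> fst y0 \<le> M" using tot i2 by linarith
    qed
    have n2: "norm (snd (snd y)) \<le> n * (M * B)"
    proof (rule comp[OF pos(4)[OF yf] pos(2)[OF y0f] _ parts(6)[OF y0]])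
      show "snd (snd y) \<bullet> (A *v fst y0 + q) \<le> M" using tot i1 by linarith
    qed
    have "norm p \<le> norm y + norm \<mu>" unfolding py by (rule norm_Pair_le)
    moreover have "norm y \<le> norm (fst y) + norm (snd y)" using norm_Pair_le[of "fst y" "snd y"] by simp
    moreover have "norm (snd y) \<le> norm (fst (snd y)) + norm (snd (snd y))"
      using norm_Pair_le[of "fst (snd y)" "snd (snd y)"] by simp
    moreover have "norm \<mu> \<le> 1" using \<mu> by simp
    ultimately show ?thesis using x n1 n2 by linarith
  qed
  then show ?thesis by blast
qed

lemma homotopy_fun_tendsto:
  fixes A :: "real^('n::finite)^'n"
  assumes "(p \<longlongrightarrow> (y, \<mu>)) F" "(s \<longlongrightarrow> y0) F"
  shows "((\<lambda>k. homotopy_fun A q (fst (p k)) (s k) (snd (p k))) \<longlongrightarrow> homotopy_fun A q y y0 \<mu>) F"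
proof -
  have m: "((\<lambda>k. M *v f k) \<longlongrightarrow> M *v l) F" if "(f \<longlongrightarrow> l) F" for M :: "real^'n^'n" and f l
    by (rule bounded_linear.tendsto[OF matrix_vector_mul_bounded_linear that])
  have f: "((\<lambda>k. fst (p k)) \<longlongrightarrow> y) F" "((\<lambda>k. snd (p k)) \<longlongrightarrow> \<mu>) F"
    using tendsto_fst[OF assms(1)] tendsto_snd[OF assms(1)] by simp_all
  show ?thesis
    unfolding homotopy_fun_eq lagrange_grad_def
    by (intro tendsto_Pair tendsto_add tendsto_diff tendsto_scaleR tendsto_vec_lambda tendsto_mult
        tendsto_vec_nth tendsto_fst tendsto_snd tendsto_const m f assms(2))
qed

lemma zero_set_limit_closure:
  fixes A :: "real^('n::finite)^'n"
  assumes p: "\<And>k::nat. p k \<in> zero_set A q (s k)" and lim: "p \<longlonglongrightarrow> (y, \<mu>)" and s: "s \<longlonglongrightarrow> y0"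
  shows "y \<in> feas1_cl A q \<and> 0 \<le> \<mu> \<and> \<mu> \<le> 1 \<and> homotopy_fun A q y y0 \<mu> = 0"
proof -
  have f: "(\<lambda>k. fst (p k)) \<longlonglongrightarrow> y" "(\<lambda>k. snd (p k)) \<longlonglongrightarrow> \<mu>"
    using tendsto_fst[OF lim] tendsto_snd[OF lim] by simp_all
  have "0 \<le> snd (p k)" "snd (p k) \<le> 1" for k
    using p[of k] by (auto simp: zero_set_iff)
  then have "0 \<le> \<mu>" "\<mu> \<le> 1"
    by (auto intro!: LIMSEQ_le_const[OF f(2)] LIMSEQ_le_const2[OF f(2)])
  moreover have "homotopy_fun A q y y0 \<mu> = 0"
    using LIMSEQ_unique[OF homotopy_fun_tendsto[OF lim s, of A q]] p by (simp add: zero_set_iff)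
  moreover have "y \<in> feas1_cl A q"
  proof -
    have t: "(\<lambda>k. fst (fst (p k)) $ i) \<longlonglongrightarrow> fst y $ i" "(\<lambda>k. fst (snd (fst (p k))) $ i) \<longlonglongrightarrow> fst (snd y) $ i"
      "(\<lambda>k. snd (snd (fst (p k))) $ i) \<longlonglongrightarrow> snd (snd y) $ i"
      "(\<lambda>k. (A *v fst (fst (p k)) + q) $ i) \<longlonglongrightarrow> (A *v fst y + q) $ i" for i
      by (intro tendsto_vec_nth tendsto_fst tendsto_snd f tendsto_add tendsto_const
          bounded_linear.tendsto[OF matrix_vector_mul_bounded_linear])+
    have "fst (p k) \<in> feas1_int A q" for k using p[of k] by (simp add: zero_set_iff)
    then have nn: "0 \<le> fst (fst (p k)) $ i" "0 \<le> fst (snd (fst (p k))) $ i" "0 \<le> snd (snd (fst (p k))) $ i"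
      "0 \<le> (A *v fst (fst (p k)) + q) $ i" for k i
      unfolding feas1_int_iff by (meson less_imp_le)+
    have "0 \<le> fst y $ i" "0 \<le> fst (snd y) $ i" "0 \<le> snd (snd y) $ i" "0 \<le> (A *v fst y + q) $ i" for i
      by (rule LIMSEQ_le_const[OF t(1)], use nn(1) in blast, rule LIMSEQ_le_const[OF t(2)], use nn(2) in blast,
          rule LIMSEQ_le_const[OF t(3)], use nn(3) in blast, rule LIMSEQ_le_const[OF t(4)], use nn(4) in blast)
    then show ?thesis by (cases y) (auto simp: feas1_cl_def feas_cl_def)
  qed
  ultimately show ?thesis by simp
qed

text \<open>
  The products \<open>z\<^sub>1\<^sub>i x\<^sub>i\<close> and \<open>z\<^sub>2\<^sub>i w\<^sub>i\<close> are positive multiples of \<open>\<mu>\<close>, so no factor can vanish.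
\<close>

lemma homotopy_zero_interior:
  assumes y0: "y0 \<in> feas1_int A q" and y: "y \<in> feas1_cl A q" and \<mu>: "0 < \<mu>"
    and zero: "homotopy_fun A q y y0 \<mu> = 0"
  shows "y \<in> feas1_int A q"
proof -
  have nn: "0 \<le> fst y $ i" "0 \<le> fst (snd y) $ i" "0 \<le> snd (snd y) $ i" "0 \<le> (A *v fst y + q) $ i" for i
    using y by (cases y, auto simp: feas1_cl_def feas_cl_def)+
  have "0 < fst (snd y) $ i * fst y $ i" "0 < snd (snd y) $ i * (A *v fst y + q) $ i" for i
    using zero y0 \<mu> unfolding homotopy_zero_iff feas1_int_iff by simp_all
  then have "0 < fst y $ i" "0 < fst (snd y) $ i" "0 < snd (snd y) $ i" "0 < (A *v fst y + q) $ i" for i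
    using nn[of i] by (metis less_le mult_zero_left mult_zero_right)+
  then show ?thesis by (simp add: feas1_int_iff)
qed

lemma zero_set_limit:
  fixes A :: "real^('n::finite)^'n"
  assumes p: "\<And>k::nat. p k \<in> zero_set A q (s k)" and lim: "p \<longlonglongrightarrow> (y, \<mu>)" and s: "s \<longlonglongrightarrow> y0"
    and y0: "y0 \<in> feas1_int A q" and \<mu>: "0 < \<mu>"
  shows "(y, \<mu>) \<in> zero_set A q y0"
  using zero_set_limit_closure[OF p lim s] homotopy_zero_interior[OF y0 _ \<mu>] \<mu>
  by (auto simp: zero_set_iff)

lemma bounded_zero_set:
  assumes "y0 \<in> feas1_int A q"
  shows "bounded (zero_set A q y0)"
  using bounded_zero_sets[of "{y0}" A q] assms by (auto simp: bounded_iff)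

lemma compact_zero_set_above:
  fixes A :: "real^('n::finite)^'n"
  assumes y0: "y0 \<in> feas1_int A q" and \<epsilon>: "\<epsilon> > 0"
  shows "compact (zero_set A q y0 \<inter> {p. \<epsilon> \<le> snd p})"
  unfolding compact_eq_bounded_closed
proof
  show "bounded (zero_set A q y0 \<inter> {p. \<epsilon> \<le> snd p})"
    using bounded_zero_set[OF y0] by (rule bounded_subset) auto
  show "closed (zero_set A q y0 \<inter> {p. \<epsilon> \<le> snd p})"
    unfolding closed_sequential_limits
  proof (intro allI impI, elim conjE)
    fix p l assume p: "\<forall>k. p k \<in> zero_set A q y0 \<inter> {p. \<epsilon> \<le> snd p}" and lim: "p \<longlonglongrightarrow> l"
    have "\<epsilon> \<le> snd l" using p by (auto intro!: LIMSEQ_le_const[OF tendsto_snd[OF lim]])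
    moreover have "(fst l, snd l) \<in> zero_set A q y0"
      using p lim \<epsilon> \<open>\<epsilon> \<le> snd l\<close> by (intro zero_set_limit[OF _ _ tendsto_const y0]) auto
    ultimately show "l \<in> zero_set A q y0 \<inter> {p. \<epsilon> \<le> snd p}" by simp
  qed
qed

lemma start_in_zero_set:
  "y0 \<in> feas1_int A q \<Longrightarrow> (y0, 1) \<in> zero_set A q y0"
  by (simp add: zero_set_iff homotopy_zero_iff)

lemma homotopy_curve_subset: "homotopy_curve A q y0 \<subseteq> zero_set A q y0"
  unfolding homotopy_curve_def by (rule connected_component_subset)

lemma limit_set_properties:
  fixes A :: "real^('n::finite)^'n"
  assumes y: "y \<in> limit_set A q y0"
  shows "y \<in> feas1_cl A q" and "homotopy_fun A q y y0 0 = 0"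
proof -
  obtain s l where *: "\<And>k. (s k, l k) \<in> homotopy_curve A q y0" "l \<longlonglongrightarrow> 0" "s \<longlonglongrightarrow> y"
    using y unfolding limit_set_def by blast
  have "y \<in> feas1_cl A q \<and> 0 \<le> (0::real) \<and> 0 \<le> (1::real) \<and> homotopy_fun A q y y0 0 = 0"
    by (rule zero_set_limit_closure[OF _ tendsto_Pair[OF *(3,2)] tendsto_const])
       (use *(1) homotopy_curve_subset in blast)
  then show "y \<in> feas1_cl A q" "homotopy_fun A q y y0 0 = 0" by auto
qed

lemma limit_set_nonempty:
  assumes y0: "y0 \<in> feas1_int A q"
    and small: "\<And>\<epsilon>. \<epsilon> > 0 \<Longrightarrow> \<exists>p\<in>homotopy_curve A q y0. snd p < \<epsilon>"
  shows "limit_set A q y0 \<noteq> {}"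
proof -
  have "\<forall>k::nat. \<exists>p\<in>homotopy_curve A q y0. snd p < 1 / real (Suc k)" using small by simp
  then obtain p where p: "\<And>k. p k \<in> homotopy_curve A q y0" "\<And>k. snd (p k) < 1 / real (Suc k)" by metis
  have "bounded (range p)"
    using bounded_zero_set[OF y0] by (rule bounded_subset) (use p(1) homotopy_curve_subset in blast)
  then obtain l r where r: "strict_mono r" "(p \<circ> r) \<longlonglongrightarrow> l" using bounded_imp_convergent_subsequence by blast
  have "(\<lambda>k. snd (p k)) \<longlonglongrightarrow> 0"
  proof (rule Lim_null_comparison[OF _ LIMSEQ_inverse_real_of_nat])
    show "\<forall>\<^sub>F k in sequentially. norm (snd (p k)) \<le> inverse (real (Suc k))"
    proof (rule always_eventually, rule allI)
      fix k
      have "0 < snd (p k)" using p(1)[of k] homotopy_curve_subset[of A q y0] by (auto simp: zero_set_iff)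
      then show "norm (snd (p k)) \<le> inverse (real (Suc k))"
        using p(2)[of k] by (simp add: inverse_eq_divide del: of_nat_Suc)
    qed
  qed
  then have "(\<lambda>k. snd (p (r k))) \<longlonglongrightarrow> 0" using LIMSEQ_subseq_LIMSEQ[OF _ r(1)] by (force simp: o_def)
  moreover have "(\<lambda>k. fst (p (r k))) \<longlonglongrightarrow> fst l" using tendsto_fst[OF r(2)] by (simp add: o_def)
  ultimately have "fst l \<in> limit_set A q y0"
    unfolding limit_set_def using p(1)
    by (auto intro!: exI[of _ "\<lambda>k. fst (p (r k))"] exI[of _ "\<lambda>k. snd (p (r k))"])
  then show ?thesis by blast
qed

section \<open>The curve of a regular starting point\<close>

lemma openin_if_locally_contained:
  assumes "I \<subseteq> C" "\<And>x. x \<in> I \<Longrightarrow> \<exists>W. open W \<and> x \<in> W \<and> C \<inter> W \<subseteq> I"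
  shows "openin (top_of_set C) I"
proof -
  have "\<forall>x\<in>I. \<exists>W. open W \<and> x \<in> W \<and> C \<inter> W \<subseteq> I" using assms(2) by (rule ballI)
  then obtain W where W: "\<forall>x\<in>I. open (W x) \<and> x \<in> W x \<and> C \<inter> W x \<subseteq> I" by (rule bchoice[THEN exE])
  then have "I = C \<inter> (\<Union>x\<in>I. W x)" using assms(1) by blast
  moreover have "open (\<Union>x\<in>I. W x)" using W by (intro open_UN) blast
  ultimately show ?thesis by (metis openin_open_Int)
qed

lemma nonvanishing_stays_positive:
  fixes g :: "real \<Rightarrow> real"
  assumes g: "continuous_on UNIV g" and "g 0 > 0" and nz: "\<And>t. g t \<noteq> 0"
  shows "g t > 0"
proof (rule ccontr)
  assume "\<not> g t > 0"
  then have "g t \<le> 0" by simp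
  have "connected (range g)" by (intro connected_continuous_image g connected_UNIV)
  then have "0 \<in> range g"
    using \<open>g 0 > 0\<close> \<open>g t \<le> 0\<close> unfolding connected_iff_interval by (meson less_imp_le rangeI)
  then show False using nz by force
qed

text \<open>
  At the first return to the level 1 the function would have to be nondecreasing from the left.
\<close>

lemma below_one_if_decreasing_at_one:
  fixes m :: "real \<Rightarrow> real"
  assumes m: "continuous_on UNIV m" and "m 0 \<le> 1"
    and dec: "\<And>t. m t = 1 \<Longrightarrow> \<exists>d<0. (m has_real_derivative d) (at t)" and t: "t > 0"
  shows "m t < 1"
proof (rule ccontr)
  assume "\<not> m t < 1"
  then have mt: "1 \<le> m t" by simp
  have "\<exists>s. 0 \<le> s \<and> s < t \<and> m s < 1"
  proof (cases "m 0 = 1")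
    case True
    obtain d where "d < 0" "(m has_real_derivative d) (at 0)" using dec[OF True] by blast
    then obtain e where e: "e > 0" "\<And>h. 0 < h \<Longrightarrow> h < e \<Longrightarrow> m (0 + h) < m 0"
      using DERIV_neg_dec_right by blast
    define h where "h = min e t / 2"
    have "0 < h" "h < e" "h < t" using e(1) t by (auto simp: h_def)
    then show ?thesis using e(2)[of h] True by (intro exI[of _ h]) auto
  qed (use \<open>m 0 \<le> 1\<close> t in force)
  then obtain s where s: "0 \<le> s" "s < t" "m s < 1" by blast
  define S where "S = {s..t} \<inter> {u. 1 \<le> m u}"
  have "closed {u. 1 \<le> m u}" by (intro closed_Collect_le continuous_on_const m)
  then have "compact S" unfolding S_def by (intro compact_Int_closed compact_Icc)
  moreover have "t \<in> S" using s mt by (simp add: S_def)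
  ultimately obtain u where u: "u \<in> S" "\<And>v. v \<in> S \<Longrightarrow> u \<le> v"
    using compact_attains_inf[of S] by blast
  have su: "s < u" using u(1) s(3) unfolding S_def by (cases "u = s") auto
  have less: "m v < 1" if "s \<le> v" "v < u" for v
    using u(2)[of v] u(1) that unfolding S_def by force
  have mu: "m u = 1"
  proof (rule ccontr)
    assume "m u \<noteq> 1"
    then have "1 < m u" using u(1) by (simp add: S_def)
    then obtain v where "s \<le> v" "v \<le> u" "m v = 1"
      using IVT'[of m s 1 u] s su continuous_on_subset[OF m] by auto
    then show False using less[of v] \<open>m u \<noteq> 1\<close> by (cases "v = u") auto
  qed
  obtain d where "d < 0" "(m has_real_derivative d) (at u)" using dec[OF mu] by blast
  then obtain e where e: "e > 0" "\<And>h. 0 < h \<Longrightarrow> h < e \<Longrightarrow> m u < m (u - h)"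
    using DERIV_neg_dec_left by blast
  define h where "h = min e (u - s) / 2"
  have "0 < h" "h < e" "h < u - s" using e(1) su by (auto simp: h_def)
  then show False using e(2)[of h] less[of "u - h"] mu by auto
qed

lemma homotopy_zero_at_one:
  assumes y0: "y0 \<in> feas1_int A q" and zero: "homotopy_fun A q y y0 1 = 0"
  shows "y = y0"
proof -
  have x: "fst y = fst y0" using zero by (simp add: homotopy_zero_iff)
  have nz: "fst y0 $ i \<noteq> 0" "(A *v fst y0 + q) $ i \<noteq> 0" for i
    using y0 unfolding feas1_int_iff by (metis less_irrefl)+
  have "fst (snd y) $ i * fst y0 $ i = fst (snd y0) $ i * fst y0 $ i"
    "snd (snd y) $ i * (A *v fst y0 + q) $ i = snd (snd y0) $ i * (A *v fst y0 + q) $ i" for i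
    using zero unfolding homotopy_zero_iff x by simp_all
  then have "fst (snd y) = fst (snd y0)" "snd (snd y) = snd (snd y0)"
    using nz by (simp_all add: vec_eq_iff)
  with x show ?thesis by (simp add: prod_eq_iff)
qed

text \<open>
  The data of the construction for one regular starting point: a field \<open>T\<close> that spans the kernel of
  the derivative along the zero set and points towards smaller parameters at the start, a cutoff, and the complete
  flow of the field \<open>cut p * snd p * T p\<close>. The factor \<open>snd p\<close> makes the hyperplane
  of parameter 0 invariant, so that trajectories take infinite time to approach it.
\<close>

locale homotopy_flow =
  fixes A :: "real^('n::finite)^'n" and q :: "real^'n" and y0 :: "'n triple"
    and T :: "'n triple \<times> real \<Rightarrow> 'n triple \<times> real" and cut :: "'n triple \<times> real \<Rightarrow> real"
    and \<phi> :: "'n triple \<times> real \<Rightarrow> real \<Rightarrow> 'n triple \<times> real"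
  assumes y0: "y0 \<in> feas1_int A q" and reg: "regular_start A q y0"
    and T_poly: "polynomial_function T"
    and T_kernel: "\<And>p D. ((\<lambda>p. homotopy_fun A q (fst p) y0 (snd p)) has_derivative D) (at p) \<Longrightarrow> D (T p) = 0"
    and T_nonzero: "\<And>p D. ((\<lambda>p. homotopy_fun A q (fst p) y0 (snd p)) has_derivative D) (at p) \<Longrightarrow> surj D \<Longrightarrow> T p \<noteq> 0"
    and T_start: "snd (T (y0, 1)) < 0"
    and cut_cont: "continuous_on UNIV cut" and cut_one: "\<And>p. p \<in> zero_set A q y0 \<Longrightarrow> cut p = 1"
    and flow_0: "\<And>p. \<phi> p 0 = p"
    and flow_deriv: "\<And>p t. (\<phi> p has_vector_derivative (cut (\<phi> p t) * snd (\<phi> p t)) *\<^sub>R T (\<phi> p t)) (at t)"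
    and flow_add: "\<And>p s t. \<phi> (\<phi> p s) t = \<phi> p (s + t)"
begin

abbreviation "f p \<equiv> homotopy_fun A q (fst p) y0 (snd p)"

lemma regular_derivative:
  assumes p: "p \<in> zero_set A q y0"
  shows "\<exists>D. (f has_derivative D) (at p) \<and> surj D"
proof -
  have "p \<in> feas1_int A q \<times> {0<..1}" "f p = 0" using p by (simp_all add: zero_set_iff mem_Times_iff)
  with reg[unfolded regular_start_def regular_value_on_def, THEN bspec] show ?thesis by simp
qed

lemma flow_continuous: "continuous_on UNIV (\<phi> p)"
  by (intro continuous_at_imp_continuous_on ballI has_vector_derivative_continuous[OF flow_deriv])

lemma flow_level: "f (\<phi> p t) = f p"
proof -
  have "((\<lambda>t. f (\<phi> p t)) has_vector_derivative 0) (at t)" for t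
  proof -
    have "f differentiable (at (\<phi> p t))"
      by (rule differentiable_at_polynomial_function[OF polynomial_homotopy])
    then obtain D where D: "(f has_derivative D) (at (\<phi> p t))"
      unfolding differentiable_def by (elim exE)
    have "((\<lambda>t. f (\<phi> p t)) has_derivative
        (\<lambda>h. D (h *\<^sub>R ((cut (\<phi> p t) * snd (\<phi> p t)) *\<^sub>R T (\<phi> p t))))) (at t)"
      by (rule has_derivative_compose[OF flow_deriv[unfolded has_vector_derivative_def] D])
    moreover have "D (h *\<^sub>R ((cut (\<phi> p t) * snd (\<phi> p t)) *\<^sub>R T (\<phi> p t))) = 0" for h
      using T_kernel[OF D] by (simp add: linear_scale[OF has_derivative_linear[OF D]])
    ultimately show ?thesis by (simp add: has_vector_derivative_def)
  qed
  note const = this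
  show ?thesis
  proof (rule has_vector_derivative_zero_constant[OF convex_UNIV])
    show "((\<lambda>t. f (\<phi> p t)) has_vector_derivative 0) (at t within UNIV)" for t by (rule const)
    fix c assume c: "\<And>t. t \<in> UNIV \<Longrightarrow> f (\<phi> p t) = c"
    show "f (\<phi> p t) = f p" using c[of t] c[of 0] by (simp add: flow_0)
  qed
qed

lemma flow_snd_deriv:
  "((\<lambda>t. snd (\<phi> p t)) has_real_derivative cut (\<phi> p t) * snd (\<phi> p t) * snd (T (\<phi> p t))) (at t)"
  using bounded_linear.has_vector_derivative[OF bounded_linear_snd flow_deriv[of p t]]
  by (simp add: has_real_derivative_iff_has_vector_derivative)

lemma flow_snd_continuous: "continuous_on UNIV (\<lambda>t. snd (\<phi> p t))"
  by (intro continuous_on_snd flow_continuous)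

text \<open>
  The parameter solves a linear equation \<open>m' = a m\<close> along the flow, so it is its initial value times an
  exponential.
\<close>

lemma flow_param_positive:
  assumes p: "0 < snd p"
  shows "0 < snd (\<phi> p t)"
proof -
  define a where "a t = cut (\<phi> p t) * snd (T (\<phi> p t))" for t
  have "continuous_on UNIV a"
    unfolding a_def
    by (intro continuous_on_mult continuous_on_snd continuous_on_compose2[OF cut_cont flow_continuous]
        continuous_on_compose2[OF continuous_on_polymonial_function[OF T_poly] flow_continuous]) auto
  then obtain F where F: "\<And>t. (F has_vector_derivative a t) (at t)"
    using continuous_antiderivative[of a] by auto
  define k where "k t = snd (\<phi> p t) * exp (- F t)" for t
  have "(k has_real_derivative 0) (at t)" for t
    unfolding k_def
    by (rule derivative_eq_intros flow_snd_deriv F[unfolded has_real_derivative_iff_has_vector_derivative[symmetric]] refl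
        | simp add: a_def algebra_simps)+
  then have "k t = k 0" by (intro DERIV_isconst_all) auto
  then have "snd (\<phi> p t) * exp (- F t) = snd p * exp (- F 0)" by (simp add: k_def flow_0)
  moreover have "0 < snd p * exp (- F 0)" using p by simp
  ultimately show ?thesis by (metis exp_gt_zero zero_less_mult_pos2)
qed

text \<open>
  Along a trajectory of zeros the products \<open>z\<^sub>1\<^sub>i x\<^sub>i\<close> and \<open>z\<^sub>2\<^sub>i w\<^sub>i\<close> never vanish, so the factors keep their
  signs.
\<close>

lemma flow_interior:
  assumes p: "fst p \<in> feas1_int A q" "0 < snd p" "f p = 0"
  shows "fst (\<phi> p t) \<in> feas1_int A q"
proof -
  have zero: "f (\<phi> p t) = 0" for t using flow_level p(3) by simp
  have \<mu>: "0 < snd (\<phi> p t)" for t by (rule flow_param_positive[OF p(2)])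
  have prod: "fst (snd (fst (\<phi> p t))) $ i * fst (fst (\<phi> p t)) $ i \<noteq> 0"
      "snd (snd (fst (\<phi> p t))) $ i * (A *v fst (fst (\<phi> p t)) + q) $ i \<noteq> 0" for t i
    using zero[of t] \<mu>[of t] y0 unfolding homotopy_zero_iff feas1_int_iff
    by (simp_all, (metis less_irrefl)+)
  have c: "continuous_on UNIV (\<lambda>t. r (\<phi> p t))" if "real_polynomial_function r" for r
    using that unfolding real_polynomial_function_eq
    by (intro continuous_on_compose2[OF continuous_on_polymonial_function flow_continuous]) auto
  have pos: "0 < fst (fst p) $ i" "0 < (A *v fst (fst p) + q) $ i" "0 < fst (snd (fst p)) $ i" "0 < snd (snd (fst p)) $ i" for i
    using p(1) by (simp_all add: feas1_int_iff)
  have "0 < fst (fst (\<phi> p t)) $ i" for i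
    by (rule nonvanishing_stays_positive[OF c])
       (use prod(1)[of _ i] pos in \<open>auto simp: flow_0 intro!: polynomial_intros\<close>)
  moreover have "0 < fst (snd (fst (\<phi> p t))) $ i" for i
    by (rule nonvanishing_stays_positive[OF c])
       (use prod(1)[of _ i] pos in \<open>auto simp: flow_0 intro!: polynomial_intros\<close>)
  moreover have "0 < snd (snd (fst (\<phi> p t))) $ i" for i
    by (rule nonvanishing_stays_positive[OF c])
       (use prod(2)[of _ i] pos in \<open>auto simp: flow_0 intro!: polynomial_intros\<close>)
  moreover have "0 < (A *v fst (fst (\<phi> p t)) + q) $ i" for i
  proof (rule nonvanishing_stays_positive[where g = "\<lambda>t. (A *v fst (fst (\<phi> p t)) + q) $ i"])
    show "continuous_on UNIV (\<lambda>t. (A *v fst (fst (\<phi> p t)) + q) $ i)"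
      by (rule c) (intro polynomial_intros)
    show "(A *v fst (fst (\<phi> p t)) + q) $ i \<noteq> 0" for t
      using prod(2)[of t i] by (metis mult_zero_right)
    show "0 < (A *v fst (fst (\<phi> p 0)) + q) $ i" unfolding flow_0 by (rule pos)
  qed
  ultimately show ?thesis by (simp only: feas1_int_iff simp_thms)
qed

text \<open>
  The only zero at parameter 1 is the starting point, and the field decreases the parameter there.
\<close>

lemma flow_param_less_one:
  assumes p: "p \<in> zero_set A q y0" and t: "t > 0"
  shows "snd (\<phi> p t) < 1"
proof (rule below_one_if_decreasing_at_one[OF flow_snd_continuous _ _ t])
  have p': "fst p \<in> feas1_int A q" "0 < snd p" "f p = 0" using p by (auto simp: zero_set_iff)
  show "snd (\<phi> p 0) \<le> 1" using p by (simp add: flow_0 zero_set_iff)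
  fix s assume s: "snd (\<phi> p s) = 1"
  have "homotopy_fun A q (fst (\<phi> p s)) y0 1 = 0"
    using flow_level[of p s] p'(3) s by simp
  then have "fst (\<phi> p s) = y0" by (rule homotopy_zero_at_one[OF y0])
  then have eq: "\<phi> p s = (y0, 1)" using s by (simp add: prod_eq_iff)
  show "\<exists>d<0. ((\<lambda>t. snd (\<phi> p t)) has_real_derivative d) (at s)"
    using flow_snd_deriv[of p s] T_start cut_one[OF start_in_zero_set[OF y0]] unfolding eq by auto
qed

lemma flow_in_zero_set:
  assumes p: "p \<in> zero_set A q y0" and t: "t \<ge> 0"
  shows "\<phi> p t \<in> zero_set A q y0"
proof (cases "t = 0")
  case False
  then show ?thesis
    using p t flow_param_less_one[OF p, of t] flow_interior[of p t] flow_param_positive[of p t] flow_level[of p t]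
    by (simp add: zero_set_iff)
qed (simp add: flow_0 p)

lemma flow_box:
  assumes p: "p \<in> zero_set A q y0" and \<delta>: "\<delta> > 0"
  shows "\<exists>W. open W \<and> p \<in> W \<and> (\<forall>p'\<in>W. p' \<in> zero_set A q y0 \<longrightarrow> (\<exists>s. \<bar>s\<bar> < \<delta> \<and> p' = \<phi> p s))"
proof -
  have p': "fst p \<in> feas1_int A q" "0 < snd p" "snd p \<le> 1" "f p = 0" using p by (auto simp: zero_set_iff)
  obtain D where D: "(f has_derivative D) (at p)" "surj D"
    using regular_derivative[OF p] by (elim exE conjE)
  define V where "V = snd p *\<^sub>R T p"
  have "D V = 0" using T_kernel[OF D(1)] by (simp add: V_def linear_scale[OF has_derivative_linear[OF D(1)]])
  moreover have "V \<noteq> 0" using T_nonzero[OF D] p'(2) by (simp add: V_def)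
  moreover have "(\<phi> p has_vector_derivative V) (at 0)"
    using flow_deriv[of p 0] by (simp add: flow_0 cut_one[OF p] V_def)
  ultimately have "\<exists>W. open W \<and> \<phi> p 0 \<in> W \<and> (\<forall>p'\<in>W. f p' = f (\<phi> p 0) \<longrightarrow> (\<exists>s. \<bar>s\<bar> < \<delta> \<and> p' = \<phi> p s))"
    using D
    by (intro polynomial_level_set_flow_box[where D = D and V = V] polynomial_homotopy flow_continuous \<delta>)
       (simp_all add: flow_0 flow_level)
  then show ?thesis unfolding flow_0 p'(4) by (auto simp: zero_set_iff)
qed

definition \<gamma> :: "real \<Rightarrow> 'n triple \<times> real" where "\<gamma> = \<phi> (y0, 1)"

lemma \<gamma>_0: "\<gamma> 0 = (y0, 1)" by (simp add: \<gamma>_def flow_0)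

lemma \<gamma>_add: "\<phi> (\<gamma> s) t = \<gamma> (s + t)" by (simp add: \<gamma>_def flow_add)

lemma \<gamma>_in_zero_set: "t \<ge> 0 \<Longrightarrow> \<gamma> t \<in> zero_set A q y0"
  unfolding \<gamma>_def by (rule flow_in_zero_set[OF start_in_zero_set[OF y0]])

lemma \<gamma>_continuous: "continuous_on S \<gamma>"
  unfolding \<gamma>_def by (rule continuous_on_subset[OF flow_continuous]) simp

text \<open>
  Backwards in time the trajectory leaves the zero set at once: otherwise flowing forward again
  would reach the starting point, whose parameter is 1, after positive time.
\<close>

lemma \<gamma>_time_nonneg:
  assumes "\<gamma> r \<in> zero_set A q y0"
  shows "r \<ge> 0"
proof (rule ccontr)
  assume "\<not> r \<ge> 0"
  then have "snd (\<phi> (\<gamma> r) (- r)) < 1" by (intro flow_param_less_one[OF assms]) simp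
  then show False by (simp add: \<gamma>_add \<gamma>_0)
qed

text \<open>
  A repetition would give a return to the starting point, by shifting time.
\<close>

lemma \<gamma>_inj: "inj_on \<gamma> {0..}"
proof -
  have *: False if "\<gamma> s = \<gamma> t" "s < t" "0 \<le> s" for s t
  proof -
    have "\<gamma> (t - s) = \<phi> (\<gamma> t) (- s)" by (simp add: \<gamma>_add)
    also have "\<dots> = (y0, 1)" unfolding that(1)[symmetric] by (simp add: \<gamma>_add \<gamma>_0)
    finally have "snd (\<gamma> (t - s)) = 1" by simp
    moreover have "snd (\<gamma> (t - s)) < 1"
      unfolding \<gamma>_def using that by (intro flow_param_less_one[OF start_in_zero_set[OF y0]]) simp
    ultimately show False by simp
  qed
  show ?thesis
  proof (rule inj_onI)
    fix s t :: real assume "s \<in> {0..}" "t \<in> {0..}" "\<gamma> s = \<gamma> t"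
    then show "s = t" using *[of s t] *[of t s] by (metis atLeast_iff linorder_cases)
  qed
qed

lemma \<gamma>_neighbourhood:
  assumes t: "t \<ge> 0" and \<delta>: "\<delta> > 0"
  shows "\<exists>W. open W \<and> \<gamma> t \<in> W \<and> (\<forall>p\<in>W. p \<in> zero_set A q y0 \<longrightarrow> (\<exists>r\<ge>0. \<bar>r - t\<bar> < \<delta> \<and> p = \<gamma> r))"
proof -
  obtain W where W: "open W" "\<gamma> t \<in> W" "\<And>p. p \<in> W \<Longrightarrow> p \<in> zero_set A q y0 \<Longrightarrow> \<exists>s. \<bar>s\<bar> < \<delta> \<and> p = \<phi> (\<gamma> t) s"
    using flow_box[OF \<gamma>_in_zero_set[OF t] \<delta>] by blast
  have "\<exists>r\<ge>0. \<bar>r - t\<bar> < \<delta> \<and> p = \<gamma> r" if p: "p \<in> W" "p \<in> zero_set A q y0" for p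
  proof -
    obtain s where s: "\<bar>s\<bar> < \<delta>" "p = \<gamma> (t + s)" using W(3)[OF p] by (auto simp: \<gamma>_add)
    have "t + s \<ge> 0" using \<gamma>_time_nonneg p(2) unfolding s(2) by blast
    then show ?thesis using s by (intro exI[of _ "t + s"]) auto
  qed
  with W(1,2) show ?thesis by blast
qed

text \<open>
  Every zero that the trajectory approaches is on the trajectory, at a nearby time. Applied to zeros of
  the component it shows that the image is closed; applied to accumulation points at late times it
  contradicts injectivity.
\<close>

lemma passes_through_limit:
  assumes p: "p \<in> zero_set A q y0" and \<delta>: "\<delta> > 0"
  shows "\<exists>W. open W \<and> p \<in> W \<and> (\<forall>t\<ge>0. \<gamma> t \<in> W \<longrightarrow> (\<exists>r\<ge>0. \<bar>r - t\<bar> < \<delta> \<and> p = \<gamma> r))"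
proof -
  obtain W where W: "open W" "p \<in> W" "\<And>p'. p' \<in> W \<Longrightarrow> p' \<in> zero_set A q y0 \<Longrightarrow> \<exists>s. \<bar>s\<bar> < \<delta> \<and> p' = \<phi> p s"
    using flow_box[OF p \<delta>] by blast
  have "\<exists>r\<ge>0. \<bar>r - t\<bar> < \<delta> \<and> p = \<gamma> r" if t: "t \<ge> 0" "\<gamma> t \<in> W" for t
  proof -
    obtain s where s: "\<bar>s\<bar> < \<delta>" "\<gamma> t = \<phi> p s" using W(3)[OF t(2) \<gamma>_in_zero_set[OF t(1)]] by blast
    have "\<gamma> (t - s) = \<phi> (\<gamma> t) (- s)" by (simp add: \<gamma>_add)
    also have "\<dots> = p" unfolding s(2) by (simp add: flow_add flow_0)
    finally have eq: "p = \<gamma> (t - s)" ..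
    then have "t - s \<ge> 0" using \<gamma>_time_nonneg p by blast
    then show ?thesis using s(1) eq by (intro exI[of _ "t - s"]) auto
  qed
  with W(1,2) show ?thesis by blast
qed

text \<open>
  The trajectory is connected, and flow boxes show that it is open and closed in the component.
\<close>

lemma \<gamma>_image: "\<gamma> ` {0..} = homotopy_curve A q y0"
proof -
  define C where "C = homotopy_curve A q y0"
  have CZ: "C \<subseteq> zero_set A q y0" unfolding C_def by (rule homotopy_curve_subset)
  have conn: "connected C" unfolding C_def homotopy_curve_def by (rule connected_connected_component)
  have "connected (\<gamma> ` {0..})" by (intro connected_continuous_image \<gamma>_continuous connected_Ici)
  moreover have "(y0, 1) \<in> \<gamma> ` {0..}" using \<gamma>_0 by (metis atLeast_iff image_eqI order_refl)
  moreover have "\<gamma> ` {0..} \<subseteq> zero_set A q y0" using \<gamma>_in_zero_set by auto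
  ultimately have sub: "\<gamma> ` {0..} \<subseteq> C"
    unfolding C_def homotopy_curve_def by (intro connected_component_maximal)
  have "openin (top_of_set C) (\<gamma> ` {0..})"
  proof (rule openin_if_locally_contained[OF sub])
    fix p assume "p \<in> \<gamma> ` {0..}"
    then obtain t where t: "t \<ge> 0" "p = \<gamma> t" by auto
    obtain W where W: "open W" "\<gamma> t \<in> W"
      and near: "\<forall>p\<in>W. p \<in> zero_set A q y0 \<longrightarrow> (\<exists>r\<ge>0. \<bar>r - t\<bar> < 1 \<and> p = \<gamma> r)"
      using \<gamma>_neighbourhood[OF t(1) zero_less_one] by (elim exE conjE)
    have "C \<inter> W \<subseteq> \<gamma> ` {0..}"
    proof
      fix p' assume "p' \<in> C \<inter> W"
      then obtain r where "r \<ge> 0" "p' = \<gamma> r" using near CZ by auto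
      then show "p' \<in> \<gamma> ` {0..}" by simp
    qed
    then show "\<exists>W. open W \<and> p \<in> W \<and> C \<inter> W \<subseteq> \<gamma> ` {0..}"
      using W unfolding t(2) by (intro exI[of _ W] conjI)
  qed
  moreover have "openin (top_of_set C) (C - \<gamma> ` {0..})"
  proof (rule openin_if_locally_contained)
    fix p assume p: "p \<in> C - \<gamma> ` {0..}"
    then have pZ: "p \<in> zero_set A q y0" using CZ by blast
    obtain W where W: "open W" "p \<in> W"
      and near: "\<forall>t\<ge>0. \<gamma> t \<in> W \<longrightarrow> (\<exists>r\<ge>0. \<bar>r - t\<bar> < 1 \<and> p = \<gamma> r)"
      using passes_through_limit[OF pZ zero_less_one] by (elim exE conjE)
    have "C \<inter> W \<subseteq> C - \<gamma> ` {0..}"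
    proof
      fix p' assume p': "p' \<in> C \<inter> W"
      have "p' \<notin> \<gamma> ` {0..}"
      proof
        assume "p' \<in> \<gamma> ` {0..}"
        then obtain t where "t \<ge> 0" "p' = \<gamma> t" by auto
        then obtain r where "r \<ge> 0" "p = \<gamma> r" using near p' by auto
        then show False using p by simp
      qed
      then show "p' \<in> C - \<gamma> ` {0..}" using p' by simp
    qed
    then show "\<exists>W. open W \<and> p \<in> W \<and> C \<inter> W \<subseteq> C - \<gamma> ` {0..}"
      using W by (intro exI[of _ W] conjI)
  qed auto
  then have "closedin (top_of_set C) (\<gamma> ` {0..})" using sub by (simp add: closedin_def)
  ultimately have "\<gamma> ` {0..} = {} \<or> \<gamma> ` {0..} = C"
    using conn unfolding connected_clopen by blast
  then show ?thesis by (auto simp: C_def)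
qed

lemma \<gamma>_homeomorphism: "homeomorphism {0..} (homotopy_curve A q y0) \<gamma> (inv_into {0..} \<gamma>)"
proof (rule homeomorphismI)
  let ?h = "inv_into {0..} \<gamma>"
  have h: "?h (\<gamma> t) = t" if "t \<ge> 0" for t using \<gamma>_inj that by (simp add: inv_into_f_f)
  show "continuous_on (homotopy_curve A q y0) ?h"
    unfolding continuous_on_topological
  proof (intro ballI allI impI)
    fix p B assume p: "p \<in> homotopy_curve A q y0" and B: "open B" "?h p \<in> B"
    obtain t where t: "t \<ge> 0" "p = \<gamma> t" using p unfolding \<gamma>_image[symmetric] by auto
    then have "t \<in> B" using B(2) h by simp
    then obtain \<delta> where \<delta>: "\<delta> > 0" "\<And>r. \<bar>r - t\<bar> < \<delta> \<Longrightarrow> r \<in> B"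
      using B(1) unfolding open_dist by (auto simp: dist_real_def)
    obtain W where W: "open W" "\<gamma> t \<in> W" "\<And>p. p \<in> W \<Longrightarrow> p \<in> zero_set A q y0 \<Longrightarrow> \<exists>r\<ge>0. \<bar>r - t\<bar> < \<delta> \<and> p = \<gamma> r"
      using \<gamma>_neighbourhood[OF t(1) \<delta>(1)] by blast
    have "?h p' \<in> B" if p': "p' \<in> homotopy_curve A q y0" "p' \<in> W" for p'
    proof -
      have "p' \<in> zero_set A q y0" using p'(1) homotopy_curve_subset[of A q y0] by blast
      then obtain r where r: "r \<ge> 0" "\<bar>r - t\<bar> < \<delta>" "p' = \<gamma> r" using W(3)[OF p'(2)] by auto
      then show ?thesis using h[OF r(1)] \<delta>(2)[OF r(2)] by simp
    qed
    then show "\<exists>W. open W \<and> p \<in> W \<and> (\<forall>p'\<in>homotopy_curve A q y0. p' \<in> W \<longrightarrow> ?h p' \<in> B)"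
      using W(1,2) t(2) by blast
  qed
  show "continuous_on {0..} \<gamma>" by (rule \<gamma>_continuous)
  show "\<gamma> ` {0..} \<subseteq> homotopy_curve A q y0" by (simp add: \<gamma>_image)
  show "?h ` homotopy_curve A q y0 \<subseteq> {0..}" unfolding \<gamma>_image[symmetric] using h by auto
  show "?h (\<gamma> t) = t" if "t \<in> {0..}" for t using h that by simp
  show "\<gamma> (?h p) = p" if "p \<in> homotopy_curve A q y0" for p
    using that unfolding \<gamma>_image[symmetric] by (rule f_inv_into_f)
qed

text \<open>
  Otherwise the trajectory returns infinitely often to the compact set of zeros with parameter at
  least \<open>\<epsilon>\<close>, accumulates at a zero, and passes through that zero at arbitrarily late times, contrary to
  injectivity.
\<close>

lemma \<gamma>_param_tendsto_0: "((\<lambda>t. snd (\<gamma> t)) \<longlongrightarrow> 0) at_top"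
proof (rule order_tendstoI)
  fix a :: real assume "a < 0"
  then have "a < snd (\<gamma> t)" if "t \<ge> 0" for t
    using \<gamma>_in_zero_set[OF that] by (simp add: zero_set_iff)
  then show "\<forall>\<^sub>F t in at_top. a < snd (\<gamma> t)" using eventually_ge_at_top[of 0] by (rule eventually_mono[rotated]) simp
next
  fix \<epsilon> :: real assume \<epsilon>: "0 < \<epsilon>"
  show "\<forall>\<^sub>F t in at_top. snd (\<gamma> t) < \<epsilon>"
  proof (rule ccontr)
    assume "\<not> ?thesis"
    then have "\<forall>k::nat. \<exists>t\<ge>real k. \<epsilon> \<le> snd (\<gamma> t)"
      unfolding eventually_at_top_linorder by (meson not_less)
    then obtain t where t: "\<And>k. t k \<ge> real k" "\<And>k. \<epsilon> \<le> snd (\<gamma> (t k))" by metis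
    have t0: "0 \<le> t k" for k using t(1)[of k] of_nat_0_le_iff[of k, where 'a = real] by linarith
    have "\<forall>k. \<gamma> (t k) \<in> zero_set A q y0 \<inter> {p. \<epsilon> \<le> snd p}"
      using t(2) \<gamma>_in_zero_set[OF t0] by simp
    then obtain p r where p: "p \<in> zero_set A q y0 \<inter> {p. \<epsilon> \<le> snd p}" and r: "strict_mono r"
      and lim: "((\<lambda>k. \<gamma> (t k)) \<circ> r) \<longlonglongrightarrow> p"
      using compact_zero_set_above[OF y0 \<epsilon>] unfolding compact_def by meson
    obtain W where W: "open W" "p \<in> W" "\<And>t. t \<ge> 0 \<Longrightarrow> \<gamma> t \<in> W \<Longrightarrow> \<exists>r\<ge>0. \<bar>r - t\<bar> < 1 \<and> p = \<gamma> r"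
      using passes_through_limit[OF _ zero_less_one, of p] p by blast
    have ev: "\<forall>\<^sub>F k in sequentially. \<gamma> (t (r k)) \<in> W"
      using topological_tendstoD[OF lim W(1,2)] by (simp add: o_def)
    then obtain N where N: "\<And>k. k \<ge> N \<Longrightarrow> \<gamma> (t (r k)) \<in> W"
      unfolding eventually_sequentially by blast
    \<comment> \<open>Two visits near \<open>p\<close> more than 2 apart give two different times at which the curve is at \<open>p\<close>.\<close>
    obtain M :: nat where M: "real M > t (r N) + 2" using reals_Archimedean2 by blast
    define k where "k = max N M"
    have "t (r k) \<ge> real (r k)" by (rule t(1))
    also have "real (r k) \<ge> real k" using seq_suble[OF r] by simp
    finally have far: "t (r k) > t (r N) + 2" using M by (simp add: k_def)
    obtain s where s: "s \<ge> 0" "\<bar>s - t (r N)\<bar> < 1" "p = \<gamma> s" using W(3)[OF t0 N[of N]] by blast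
    obtain s' where s': "s' \<ge> 0" "\<bar>s' - t (r k)\<bar> < 1" "p = \<gamma> s'" using W(3)[OF t0 N[of k]] by (auto simp: k_def)
    have "s = s'" using \<gamma>_inj s s' by (auto dest: inj_onD)
    then show False using far s(2) s'(2) by linarith
  qed
qed

lemma smooth_curve:
  "\<exists>g. smooth_curve_param (homotopy_curve A q y0) (y0, 1) g \<and> ((\<lambda>t. snd (g t)) \<longlongrightarrow> 0) (at_left 1)"
proof (intro exI conjI)
  have "smooth_curve_param (homotopy_curve A q y0) (\<gamma> 0) (\<lambda>s. \<gamma> (s / (1 - s)))"
  proof (rule polynomial_integral_curve_smooth_param[where X = "\<lambda>p. snd p *\<^sub>R T p"])
    show "polynomial_function (\<lambda>p. snd p *\<^sub>R T p)"
      by (intro polynomial_intros T_poly)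
    fix t :: real assume t: "t \<ge> 0"
    have Z: "\<gamma> t \<in> zero_set A q y0" by (rule \<gamma>_in_zero_set[OF t])
    show "(\<gamma> has_vector_derivative snd (\<gamma> t) *\<^sub>R T (\<gamma> t)) (at t)"
      using flow_deriv[of "(y0, 1)" t] cut_one[OF Z] by (simp add: \<gamma>_def)
    obtain D where "(f has_derivative D) (at (\<gamma> t))" "surj D"
      using regular_derivative[OF Z] by (elim exE conjE)
    then have "T (\<gamma> t) \<noteq> 0" by (rule T_nonzero)
    then show "snd (\<gamma> t) *\<^sub>R T (\<gamma> t) \<noteq> 0" using Z by (simp add: zero_set_iff)
  qed (rule \<gamma>_homeomorphism)
  then show "smooth_curve_param (homotopy_curve A q y0) (y0, 1) (\<lambda>s. \<gamma> (s / (1 - s)))"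
    by (simp add: \<gamma>_0)
  have "((\<lambda>s::real. 1 - s) \<longlongrightarrow> 1 - 1) (at_left 1)" by (intro tendsto_intros)
  moreover have "\<forall>\<^sub>F s in at_left (1::real). 0 < 1 - s"
    by (rule eventually_mono[OF eventually_at_left_real[of 0]]) auto
  ultimately have "filterlim (\<lambda>s::real. inverse (1 - s)) at_top (at_left 1)"
    by (intro filterlim_inverse_at_top) simp_all
  from filterlim_tendsto_pos_mult_at_top[OF tendsto_ident_at zero_less_one this]
  have "filterlim (\<lambda>s::real. s / (1 - s)) at_top (at_left 1)"
    by (simp add: divide_inverse)
  then show "((\<lambda>s. snd (\<gamma> (s / (1 - s)))) \<longlongrightarrow> 0) (at_left 1)"
    by (rule filterlim_compose[OF \<gamma>_param_tendsto_0])
qed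

end

text \<open>
  At the start the last component of the kernel field is nonzero because the derivative in \<open>y\<close> is
  injective there; a sign change makes it negative. The cutoff equals 1 on a ball that contains the
  bounded zero set.
\<close>

lemma homotopy_flow_exists:
  fixes A :: "real^('n::finite)^'n"
  assumes y0: "y0 \<in> feas1_int A q" and reg: "regular_start A q y0"
  shows "\<exists>T cut \<phi>. homotopy_flow A q y0 T cut \<phi>"
proof -
  let ?f = "\<lambda>p. homotopy_fun A q (fst p) y0 (snd p)"
  obtain T0 where T0: "polynomial_function T0 \<and> (\<forall>p D. (?f has_derivative D) (at p) \<longrightarrow>
    D (T0 p) = 0 \<and> (surj D \<longrightarrow> T0 p \<noteq> 0) \<and> (snd (T0 p) \<noteq> 0 \<longleftrightarrow> inj (\<lambda>v. D (v, 0))))"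
    using triple_kernel_field[OF polynomial_homotopy[of A q y0]] by (elim exE)
  note T0p = conjunct1[OF T0] and T0' = conjunct2[OF T0, THEN spec, THEN spec, THEN mp]
  have "snd (T0 (y0, 1)) \<noteq> 0"
  proof -
    obtain D where D: "(?f has_derivative D) (at (y0, 1))"
      using differentiable_at_polynomial_function[OF polynomial_homotopy[of A q y0], of "(y0, 1)" UNIV]
      unfolding differentiable_def by (elim exE)
    obtain E where E: "(scaled_homotopy A q has_derivative E) (at (y0, 1))"
      using differentiable_at_polynomial_function[OF polynomial_scaled_homotopy[of A q], of "(y0, 1)" UNIV]
      unfolding differentiable_def by (elim exE)
    have sl: "((\<lambda>y::'n triple. (y, 1::real)) has_derivative (\<lambda>v. (v, 0))) (at y0)"
      by (intro has_derivative_Pair has_derivative_ident has_derivative_const)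
    have "((\<lambda>y. ?f (y, 1)) has_derivative (\<lambda>v. D (v, 0))) (at y0)"
      by (rule has_derivative_compose[OF sl D])
    also have "(\<lambda>y. ?f (y, 1)) = (\<lambda>y. scaled_homotopy A q (y, 1) - scaled_homotopy A q (y0, 1))"
      using homotopy_fun_eq_scaled[of 1 A q] by simp
    finally have d1: "((\<lambda>y. scaled_homotopy A q (y, 1) - scaled_homotopy A q (y0, 1))
        has_derivative (\<lambda>v. D (v, 0))) (at y0)" .
    have d2: "((\<lambda>y. scaled_homotopy A q (y, 1) - scaled_homotopy A q (y0, 1))
        has_derivative (\<lambda>v. E (v, 0) - 0)) (at y0)"
      by (intro has_derivative_diff has_derivative_compose[OF sl E] has_derivative_const)
    have "(\<lambda>v. D (v, 0)) = (\<lambda>v. E (v, 0) - 0)" by (rule has_derivative_unique[OF d1 d2])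
    then have "inj (\<lambda>v. D (v, 0))" using initial_slice_derivative_inj[OF y0 E] by simp
    then show ?thesis using T0'[OF D] by simp
  qed
  \<comment> \<open>Orientation: the parameter is to decrease at the start.\<close>
  define \<sigma> :: real where "\<sigma> = - sgn (snd (T0 (y0, 1)))"
  have \<sigma>: "\<sigma> \<noteq> 0" using \<open>snd (T0 (y0, 1)) \<noteq> 0\<close> by (simp add: \<sigma>_def sgn_eq_0_iff)
  define T where "T p = \<sigma> *\<^sub>R T0 p" for p
  have pT: "polynomial_function T" unfolding T_def by (intro polynomial_function_cmul T0p)
  obtain R where R: "\<And>p. p \<in> zero_set A q y0 \<Longrightarrow> norm p \<le> R"
    using bounded_zero_set[OF y0] unfolding bounded_iff by blast
  have "polynomial_function (\<lambda>p. snd p *\<^sub>R T p)"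
    by (intro polynomial_intros pT)
  from polynomial_field_cutoff[OF this, of R]
  obtain cut L B where cut: "continuous_on UNIV cut" "\<forall>p. norm p \<le> R \<longrightarrow> cut p = 1" "L > 0"
    "\<forall>p q. norm (cut p *\<^sub>R snd p *\<^sub>R T p - cut q *\<^sub>R snd q *\<^sub>R T q) \<le> L * norm (p - q)"
    "\<forall>p. norm (cut p *\<^sub>R snd p *\<^sub>R T p) \<le> B"
    by (elim exE conjE)
  obtain \<phi> where \<phi>: "\<forall>p. \<phi> p 0 = p \<and> (\<forall>t. (\<phi> p has_vector_derivative
       cut (\<phi> p t) *\<^sub>R snd (\<phi> p t) *\<^sub>R T (\<phi> p t)) (at t)) \<and> (\<forall>s t. \<phi> (\<phi> p s) t = \<phi> p (s + t))"
    using lipschitz_flow_exists[OF cut(4)[THEN spec, THEN spec] cut(3) cut(5)[THEN spec]] by (elim exE)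
  have "homotopy_flow A q y0 T cut \<phi>"
  proof
    show "y0 \<in> feas1_int A q" "regular_start A q y0" "polynomial_function T" "continuous_on UNIV cut"
      by (fact y0 reg pT cut(1))+
    show "cut p = 1" if "p \<in> zero_set A q y0" for p using cut(2) R[OF that] by blast
    show "snd (T (y0, 1)) < 0"
      using \<open>snd (T0 (y0, 1)) \<noteq> 0\<close> by (simp add: T_def \<sigma>_def sgn_if)
    show "D (T p) = 0" if "(?f has_derivative D) (at p)" for p D
      using T0'[OF that] by (simp add: T_def linear_scale[OF has_derivative_linear[OF that]])
    show "T p \<noteq> 0" if "(?f has_derivative D) (at p)" "surj D" for p D
      using T0'[OF that(1)] that(2) \<sigma> by (simp add: T_def)
    show "\<phi> p 0 = p" for p using \<phi>[THEN spec, of p] by (rule conjunct1)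
    show "(\<phi> p has_vector_derivative (cut (\<phi> p t) * snd (\<phi> p t)) *\<^sub>R T (\<phi> p t)) (at t)" for p t
      using conjunct1[OF conjunct2[OF \<phi>[THEN spec, of p]], THEN spec, of t] by simp
    show "\<phi> (\<phi> p s) t = \<phi> p (s + t)" for p s t
      using conjunct2[OF conjunct2[OF \<phi>[THEN spec, of p]]] by blast
  qed
  then show ?thesis by blast
qed

theorem homotopy_curve_smooth_if_regular:
  fixes A :: "real^('n::finite)^'n"
  assumes "y0 \<in> feas1_int A q" "regular_start A q y0"
  shows "\<exists>g. smooth_curve_param (homotopy_curve A q y0) (y0, 1) g \<and> ((\<lambda>t. snd (g t)) \<longlongrightarrow> 0) (at_left 1)"
proof -
  obtain T cut \<phi> where "homotopy_flow A q y0 T cut \<phi>"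
    using homotopy_flow_exists[OF assms] by blast
  then interpret homotopy_flow A q y0 T cut \<phi> .
  show ?thesis by (rule smooth_curve)
qed

section \<open>The curve of an arbitrary starting point\<close>

lemma regular_curve_reaches_small_parameter:
  fixes A :: "real^('n::finite)^'n"
  assumes y0: "y0 \<in> feas1_int A q" and reg: "regular_start A q y0" and \<epsilon>: "\<epsilon> > 0"
  shows "\<exists>p\<in>homotopy_curve A q y0. snd p < \<epsilon>"
proof -
  obtain g where g: "smooth_curve_param (homotopy_curve A q y0) (y0, 1) g" "((\<lambda>t. snd (g t)) \<longlongrightarrow> 0) (at_left 1)"
    using homotopy_curve_smooth_if_regular[OF y0 reg] by (elim exE conjE)
  have img: "g ` {0..<1} = homotopy_curve A q y0"
    using g(1) by (auto simp: smooth_curve_param_def homeomorphism_def)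
  have "\<forall>\<^sub>F t in at_left 1. snd (g t) < \<epsilon>" by (rule order_tendstoD(2)[OF g(2) \<epsilon>])
  moreover have "\<forall>\<^sub>F t in at_left (1::real). t \<in> {0<..<1}" by (rule eventually_at_left_real) simp
  ultimately have "\<forall>\<^sub>F t in at_left 1. snd (g t) < \<epsilon> \<and> t \<in> {0<..<1}" by (rule eventually_conj)
  then obtain t where "snd (g t) < \<epsilon>" "t \<in> {0<..<1}"
    using eventually_happens[of _ "at_left (1::real)"] by (auto simp: trivial_limit_at_left_real)
  then show ?thesis by (intro bexI[of _ "g t"]) (auto simp flip: img)
qed

lemma locally_compact_zero_set:
  fixes A :: "real^('n::finite)^'n"
  shows "locally compact (zero_set A q y0)"
proof -
  have "zero_set A q y0 = feas1_int A q \<times> {0<..} \<inter>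
      ({p. snd p \<le> 1} \<inter> {p. homotopy_fun A q (fst p) y0 (snd p) = 0})"
    by (auto simp: zero_set_iff)
  moreover have "locally compact (feas1_int A q \<times> {0::real<..})"
    by (intro open_imp_locally_compact open_Times open_feas1_int open_greaterThan)
  moreover have "closed ({p :: 'n triple \<times> real. snd p \<le> 1} \<inter> {p. homotopy_fun A q (fst p) y0 (snd p) = 0})"
    by (intro closed_Int closed_Collect_le closed_Collect_eq continuous_on_snd continuous_on_id continuous_on_const
        continuous_on_polymonial_function polynomial_homotopy)
  ultimately show ?thesis by (simp add: locally_compact_Int closed_imp_locally_compact)
qed

lemma regular_starts_dense:
  fixes A :: "real^('n::finite)^'n"
  assumes y0: "y0 \<in> feas1_int A q" and r: "r > 0"
  shows "\<exists>s\<in>feas1_int A q. regular_start A q s \<and> dist s y0 < r"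
proof (rule ccontr)
  assume none: "\<not> ?thesis"
  have "feas1_int A q \<inter> ball y0 r \<subseteq> {y \<in> feas1_int A q. \<not> regular_start A q y}"
    using none by (auto simp: dist_commute)
  then have "negligible (feas1_int A q \<inter> ball y0 r)"
    by (rule negligible_subset[OF negligible_not_regular_start])
  moreover have "open (feas1_int A q \<inter> ball y0 r)" by (intro open_Int open_feas1_int open_ball)
  moreover have "y0 \<in> feas1_int A q \<inter> ball y0 r" using y0 r by simp
  ultimately show False using open_not_negligible by blast
qed

text \<open>
  A curve that stays above a positive parameter is a compact component of a locally compact set. By the
  Sura-Bura theorem it has arbitrarily small compact neighbourhoods that are open in the zero set.
\<close>

lemma compact_curve_clopen_neighbourhood:
  fixes A :: "real^('n::finite)^'n"
  assumes y0: "y0 \<in> feas1_int A q" and \<epsilon>: "\<epsilon> > 0"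
    and above: "\<And>p. p \<in> homotopy_curve A q y0 \<Longrightarrow> \<epsilon> \<le> snd p"
  shows "\<exists>K G. compact K \<and> open G \<and> (y0, 1) \<in> K \<and> K = zero_set A q y0 \<inter> G \<and> K \<subseteq> {p. \<epsilon> / 2 < snd p}"
proof -
  define Z where "Z = zero_set A q y0"
  define C where "C = homotopy_curve A q y0"
  have p0: "(y0, 1) \<in> Z" unfolding Z_def by (rule start_in_zero_set[OF y0])
  have C_comp: "C \<in> components Z"
    unfolding C_def homotopy_curve_def Z_def[symmetric] using p0 by (rule componentsI)
  have "C \<subseteq> Z" unfolding C_def Z_def by (rule homotopy_curve_subset)
  have "closedin (top_of_set Z) C" by (rule closedin_component[OF C_comp])
  then obtain F where F: "closed F" "C = Z \<inter> F" unfolding closedin_closed by blast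
  have "C = (Z \<inter> {p. \<epsilon> \<le> snd p}) \<inter> F" using F(2) above unfolding C_def by blast
  moreover have "compact (Z \<inter> {p. \<epsilon> \<le> snd p})" unfolding Z_def by (rule compact_zero_set_above[OF y0 \<epsilon>])
  ultimately have "compact C" using compact_Int_closed[OF _ F(1)] by metis
  have U: "open {p :: 'n triple \<times> real. \<epsilon> / 2 < snd p}"
    by (intro open_Collect_less continuous_on_const continuous_on_snd continuous_on_id)
  have CU: "C \<subseteq> {p. \<epsilon> / 2 < snd p}"
  proof
    fix p assume "p \<in> C"
    then show "p \<in> {p. \<epsilon> / 2 < snd p}" using above[of p] \<epsilon> by (simp add: C_def)
  qed
  obtain K where K: "openin (top_of_set Z) K" "compact K" "C \<subseteq> K" "K \<subseteq> {p. \<epsilon> / 2 < snd p}"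
    using Sura_Bura_clopen_subset[OF locally_compact_zero_set[of A q y0, folded Z_def] C_comp \<open>compact C\<close> U CU] by metis
  obtain G where "open G" "K = Z \<inter> G" using K(1) unfolding openin_open by blast
  moreover have "(y0, 1) \<in> C"
    unfolding C_def homotopy_curve_def using p0 by (simp add: Z_def)
  ultimately show ?thesis using K unfolding Z_def by blast
qed

text \<open>
  At a nonregular start the zero set may branch, so the curve is compared with curves of regular
  starting points nearby. If it stayed above \<open>\<epsilon>\<close>, it would lie in a compact relatively open part \<open>K\<close> of
  the zero set. Curves of regular starts close to \<open>y0\<close> begin near \<open>K\<close> and have points outside a neighbourhood
  of it, so each contains a point at a fixed small distance \<open>r\<close> from \<open>K\<close>. These points accumulate at a zero
  of the original homotopy that has distance \<open>r\<close> from \<open>K\<close> and yet lies in the neighbourhood in which \<open>K\<close>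
  comprises all zeros.
\<close>

lemma curve_reaches_small_parameter:
  fixes A :: "real^('n::finite)^'n"
  assumes y0: "y0 \<in> feas1_int A q" and \<epsilon>: "\<epsilon> > 0"
  shows "\<exists>p\<in>homotopy_curve A q y0. snd p < \<epsilon>"
proof (rule ccontr)
  assume "\<not> ?thesis"
  then have above: "\<epsilon> \<le> snd p" if "p \<in> homotopy_curve A q y0" for p using that by force
  have "\<exists>K G. compact K \<and> open G \<and> (y0, 1) \<in> K \<and> K = zero_set A q y0 \<inter> G \<and> K \<subseteq> {p. \<epsilon> / 2 < snd p}"
    by (rule compact_curve_clopen_neighbourhood[OF y0 \<epsilon> above])
  then obtain K G where K: "compact K" "open G" "(y0, 1) \<in> K" "K = zero_set A q y0 \<inter> G" "K \<subseteq> {p. \<epsilon> / 2 < snd p}"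
    by (elim exE conjE)
  \<comment> \<open>Inside \<open>V\<close> every zero of the homotopy of \<open>y0\<close> belongs to \<open>K\<close>.\<close>
  define V where "V = G \<inter> {p. \<epsilon> / 2 < snd p}"
  have "open V" unfolding V_def
    by (intro open_Int K(2) open_Collect_less continuous_on_const continuous_on_snd continuous_on_id)
  moreover have "K \<subseteq> V" using K(4,5) by (auto simp: V_def)
  ultimately obtain e where e: "e > 0" "(\<Union>x\<in>K. ball x e) \<subseteq> V"
    using compact_subset_open_imp_ball_epsilon_subset[OF K(1)] by metis
  have near: "p \<in> V" if "infdist p K < e" for p
  proof -
    have "K \<noteq> {}" "closed K" using K(1,3) by (auto intro: compact_imp_closed)
    then obtain k where "k \<in> K" "infdist p K = dist p k" using infdist_attains_inf by metis
    then have "p \<in> ball k e" using that by (simp add: dist_commute)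
    then show ?thesis using \<open>k \<in> K\<close> e(2) by blast
  qed
  define r where "r = e / 2"
  have r: "0 < r" "r < e" using e(1) by (simp_all add: r_def)
  obtain \<rho> where \<rho>: "\<rho> > 0" "cball y0 \<rho> \<subseteq> feas1_int A q"
    using open_feas1_int y0 open_contains_cball by blast
  have "\<forall>k::nat. \<exists>s\<in>feas1_int A q. regular_start A q s \<and> dist s y0 < min \<rho> (min r (inverse (real (Suc k))))"
    using \<rho>(1) r(1) by (intro allI regular_starts_dense[OF y0]) simp
  then obtain s where s: "\<And>k. s k \<in> feas1_int A q" "\<And>k. regular_start A q (s k)"
    "\<And>k. dist (s k) y0 < min \<rho> (min r (inverse (real (Suc k))))" by metis
  have s_lim: "s \<longlonglongrightarrow> y0"
  proof (rule tendsto_dist_iff[THEN iffD2], rule Lim_null_comparison[OF _ LIMSEQ_inverse_real_of_nat], rule always_eventually, rule allI)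
    show "norm (dist (s k) y0) \<le> inverse (real (Suc k))" for k
      using s(3)[of k] by (simp del: of_nat_Suc)
  qed
  have "\<exists>p\<in>homotopy_curve A q (s k). infdist p K = r" for k
  proof -
    let ?C = "homotopy_curve A q (s k)"
    have "connected ?C" unfolding homotopy_curve_def by (rule connected_connected_component)
    then have conn: "connected ((\<lambda>p. infdist p K) ` ?C)"
      by (intro connected_continuous_image continuous_on_infdist continuous_on_id)
    have start: "(s k, 1) \<in> ?C"
      unfolding homotopy_curve_def using start_in_zero_set[OF s(1)] by simp
    have "infdist (s k, 1) K \<le> dist (s k, 1) (y0, 1 :: real)" by (rule infdist_le[OF K(3)])
    also have "\<dots> < r" using s(3)[of k] by (simp add: dist_Pair_Pair)
    finally have lo: "infdist (s k, 1) K \<le> r" by simp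
    \<comment> \<open>The curve starts closer than \<open>r\<close> to \<open>K\<close> and also contains points outside \<open>V\<close>.\<close>
    obtain p where p: "p \<in> ?C" "snd p < \<epsilon> / 2"
      using regular_curve_reaches_small_parameter[OF s(1)[of k] s(2)[of k] half_gt_zero[OF \<epsilon>]] by (elim bexE)
    then have "p \<notin> V" by (simp add: V_def)
    then have hi: "r \<le> infdist p K" using near[of p] r by force
    have "r \<in> (\<lambda>p. infdist p K) ` ?C"
      using conn[unfolded connected_iff_interval] lo hi start p(1) by (meson imageI)
    then show ?thesis by auto
  qed
  then obtain p where p: "\<And>k. p k \<in> homotopy_curve A q (s k)" "\<And>k. infdist (p k) K = r" by metis
  have pZ: "p k \<in> zero_set A q (s k)" for k using p(1) homotopy_curve_subset by blast
  obtain R where R: "\<forall>y\<in>cball y0 \<rho>. \<forall>p\<in>zero_set A q y. norm p \<le> R"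
    using bounded_zero_sets[OF compact_cball \<rho>(2)] by (elim exE)
  have "norm (p k) \<le> R" for k
  proof -
    have "s k \<in> cball y0 \<rho>" using s(3)[of k] by (simp add: dist_commute)
    then show ?thesis using R pZ[of k] by blast
  qed
  then have "bounded (range p)" by (auto simp: bounded_iff)
  then obtain l t where t: "strict_mono t" "(p \<circ> t) \<longlonglongrightarrow> l" using bounded_imp_convergent_subsequence by blast
  have "(\<lambda>k. infdist ((p \<circ> t) k) K) \<longlonglongrightarrow> infdist l K" by (intro tendsto_infdist t(2))
  then have dl: "infdist l K = r" using LIMSEQ_unique[OF _ tendsto_const] p(2) by (simp add: o_def)
  then have lV: "l \<in> V" using near[of l] r by simp
  then have "0 < snd l" using \<epsilon> by (simp add: V_def)
  have "(fst l, snd l) \<in> zero_set A q y0"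
  proof (rule zero_set_limit[OF _ _ _ y0 \<open>0 < snd l\<close>])
    show "(p \<circ> t) k \<in> zero_set A q ((s \<circ> t) k)" for k by (simp add: pZ)
    show "(p \<circ> t) \<longlonglongrightarrow> (fst l, snd l)" using t(2) by simp
    show "(s \<circ> t) \<longlonglongrightarrow> y0" by (rule LIMSEQ_subseq_LIMSEQ[OF s_lim t(1)])
  qed
  then have "l \<in> K" using lV unfolding K(4) by (simp add: V_def)
  then show False using dl r(1) by simp
qed

theorem theorem3p5:
  fixes A :: "real^'n^'n" and q :: "real^'n" and y0 :: "'n triple"
  assumes "y0 \<in> feas1_int A q"
  shows "homotopy_curve A q y0 \<subseteq> feas1_int A q \<times> {0<..1} \<and>
         (y0, 1) \<in> homotopy_curve A q y0 \<and>
         bounded (homotopy_curve A q y0) \<and>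
         (\<forall>\<epsilon>>0. \<exists>(y, \<mu>) \<in> homotopy_curve A q y0. \<mu> < \<epsilon>) \<and>
         (regular_start A q y0 \<longrightarrow>
            (\<exists>\<gamma>. smooth_curve_param (homotopy_curve A q y0) (y0, 1) \<gamma> \<and>
                 ((\<lambda>t. snd (\<gamma> t)) \<longlongrightarrow> 0) (at_left 1))) \<and>
         negligible {y \<in> feas1_int A q. \<not> regular_start A q y} \<and>
         limit_set A q y0 \<noteq> {} \<and>
         limit_set A q y0 \<times> {0::real} \<subseteq> feas1_cl A q \<times> {0} \<and>
         (\<forall>(x, z1, z2) \<in> limit_set A q y0.
            (A + transpose A) *v x + q - z1 - transpose A *v z2 = 0 \<and>
            diag z1 *v x = 0 \<and>
            diag z2 *v (A *v x + q) = 0)"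
proof (intro conjI)
  show "homotopy_curve A q y0 \<subseteq> feas1_int A q \<times> {0<..1}"
    using homotopy_curve_subset[of A q y0] by (auto simp: zero_set_iff)
  show "(y0, 1) \<in> homotopy_curve A q y0"
    unfolding homotopy_curve_def using start_in_zero_set[OF assms] by simp
  show "bounded (homotopy_curve A q y0)"
    by (rule bounded_subset[OF bounded_zero_set[OF assms] homotopy_curve_subset])
  show "\<forall>\<epsilon>>0. \<exists>(y, \<mu>) \<in> homotopy_curve A q y0. \<mu> < \<epsilon>"
    using curve_reaches_small_parameter[OF assms] by (simp add: case_prod_beta)
  show "regular_start A q y0 \<longrightarrow>
            (\<exists>\<gamma>. smooth_curve_param (homotopy_curve A q y0) (y0, 1) \<gamma> \<and>
                 ((\<lambda>t. snd (\<gamma> t)) \<longlongrightarrow> 0) (at_left 1))"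
    by (intro impI homotopy_curve_smooth_if_regular[OF assms])
  show "negligible {y \<in> feas1_int A q. \<not> regular_start A q y}"
    by (rule negligible_not_regular_start)
  show "limit_set A q y0 \<noteq> {}"
    by (rule limit_set_nonempty[OF assms curve_reaches_small_parameter[OF assms]])
  show "limit_set A q y0 \<times> {0::real} \<subseteq> feas1_cl A q \<times> {0}"
    using limit_set_properties(1) by blast
  show "\<forall>(x, z1, z2) \<in> limit_set A q y0.
            (A + transpose A) *v x + q - z1 - transpose A *v z2 = 0 \<and>
            diag z1 *v x = 0 \<and> diag z2 *v (A *v x + q) = 0"
  proof clarify
    fix x z1 z2 assume y: "(x, z1, z2) \<in> limit_set A q y0"
    obtain x0 z10 z20 where y0: "y0 = (x0, z10, z20)" by (cases y0)
    show "(A + transpose A) *v x + q - z1 - transpose A *v z2 = 0 \<and>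
            diag z1 *v x = 0 \<and> diag z2 *v (A *v x + q) = 0"
      using limit_set_properties(2)[OF y] by (simp add: y0 zero_prod_def)
  qed
qed

end
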